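(* Let $p$ be a prime and $s>-1$ a real number. (a) The measure $\mu_s^\infty$ on $\mathrm{Mat}(\infty,\mathbb{Q}_p)$ is quasiinvariant with respect to the action $z\mapsto(a+zc)^{-1}(b+zd)$ of the group $\mathrm{GL}(2\infty,\mathbb{O}_p)$. The Radon--Nikodym derivative is $|\det(a+zc)|^{s}$, i.e. $d\mu_s^\infty\bigl((a+zc)^{-1}(b+zd)\bigr)=|\det(a+zc)|^s\,d\mu_s^\infty(z)$. (b) In particular, for $s=0$ the measure $\mu_0^\infty$ is $\mathrm{GL}(2\infty,\mathbb{O}_p)$-invariant. (c) The measure $\mu_s^\infty$ is invariant with respect to the subgroup $P\subset\mathrm{GL}(2\infty,\mathbb{O}_p)$ consisting of matrices $\begin{pmatrix} a & b \\ 0 & d \end{pmatrix}$.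
   Context: $\mathbb{Q}_p$ is the field of $p$-adic numbers with its norm $|\cdot|$ ($|p|=p^{-1}$), $\mathbb{O}_p$ the ring of $p$-adic integers, $\mathrm{Mat}(n,\mathbb{Q}_p)$ the space of $n\times n$ matrices over $\mathbb{Q}_p$, $\mathrm{vol}$ the translation-invariant measure on it with $\mathrm{vol}(\mathrm{Mat}(n,\mathbb{O}_p))=1$, and $\mathrm{GL}(n,\mathbb{O}_p)$ the group of $n\times n$ matrices invertible over $\mathbb{O}_p$. Measures. Any $z\in\mathrm{Mat}(n,\mathbb{Q}_p)$ can be written as $z=A\,\mathrm{diag}(p^{-k_1},\dots,p^{-k_n})\,B$ with $A,B\in\mathrm{GL}(n,\mathbb{O}_p)$ and $k_1\ge\dots\ge k_n\ge-\infty$ ($k_j$ integers or $-\infty$, with $p^{-k_j}=0$ if $k_j=-\infty$). Put $\gamma(z)=\prod_{j:\,k_j>0}p^{k_j}$ (empty product equal to $1$). For $s>-1$ let $\mu_s^n$ be the probability measure on $\mathrm{Mat}(n,\mathbb{Q}_p)$ with $d\mu_s^n(z)=c(n,s+2n)^{-1}\gamma(z)^{-s-2n}\,d\mathrm{vol}(z)$, where $c(n,\alpha)=\int\gamma(z)^{-\alpha}\,d\mathrm{vol}(z)$. The pushforward of $\mu_s^{n+1}$ under taking the upper left $n\times n$ corner is $\mu_s^n$; hence, by Kolmogorov's theorem, there is a unique probability measure $\mu_s^\infty$ on the space $\mathrm{Mat}(\infty,\mathbb{Q}_p)\simeq\mathbb{Q}_p^{\infty\times\infty}$ of all infinite matrices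 $(z_{ij})_{i,j\ge1}$ over $\mathbb{Q}_p$ (with the product $\sigma$-algebra) whose pushforward under taking the upper left $n\times n$ corner is $\mu_s^n$ for every $n$. Group. $\mathrm{GL}(2\infty,\mathbb{O}_p)$ is the group of $(\infty+\infty)\times(\infty+\infty)$ block matrices $g=\begin{pmatrix} a & b \\ c & d \end{pmatrix}$ with entries in $\mathbb{O}_p$ such that $g^{-1}$ also has entries in $\mathbb{O}_p$ and $g-1$ has only finitely many nonzero entries. Action and determinant. For $g\in\mathrm{GL}(2\infty,\mathbb{O}_p)$ and $k$ sufficiently large, write $a=\begin{pmatrix} a_{11} & 0 \\ 0 & 1 \end{pmatrix}$, $b=\begin{pmatrix} b_{11} & 0 \\ 0 & 0 \end{pmatrix}$, $c=\begin{pmatrix} c_{11} & 0 \\ 0 & 0 \end{pmatrix}$, $d=\begin{pmatrix} d_{11} & 0 \\ 0 & 1 \end{pmatrix}$ and $z=\begin{pmatrix} z_{11} & z_{12} \\ z_{21} & z_{22} \end{pmatrix}$ in blocks of size $k+\infty$. Then $a+zc=\begin{pmatrix} a_{11}+z_{11}c_{11} & 0 \\ z_{21}c_{11} & 1 \end{pmatrix}$, and one sets $\det(a+zc):=\det(a_{11}+z_{11}c_{11})$, which does not depend on the choice of large $k$. The transformation $z\mapsto(a+zc)^{-1}(b+zd)$ is defined for $z$ with $\det(a+zc)\neq0$, i.e. $\mu_s^\infty$-almost everywhere. Quasiinvariance with Radon--Nikodym derivative $h$ under an almost everywhere defined invertible transformation $\phi$, written $d\mu(\phi(z))=h(z)\,d\mu(z)$,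 means that $\phi$ preserves the class of null sets and $\mu(\phi(B))=\int_B h\,d\mu$ for measurable $B$ in the domain of $\phi$. *)

theory Defs
  imports
    "HOL-Probability.Probability"
    "HOL-Library.Option_ord"
    "HOL-Library.Groups_Big_Fun"
    "Jordan_Normal_Form.Determinant"
    "Berlekamp_Zassenhaus.Finite_Field"
begin

hide_const (open) Finite_Cartesian_Product.mat Determinants.det

section \<open>The p-adic absolute value on the rationals\<close>

definition padic_abs :: "nat \<Rightarrow> rat \<Rightarrow> real" where
  "padic_abs p x = (if x = 0 then 0 else
     real p powi (int (multiplicity (int p) (snd (quotient_of x)))
                - int (multiplicity (int p) (fst (quotient_of x)))))"

lemma padic_abs_0 [simp]: "padic_abs p 0 = 0"
  by (simp add: padic_abs_def)

lemma padic_abs_fraction: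
  assumes p: "prime p" and nz: "a \<noteq> 0" "b \<noteq> 0"
  shows "padic_abs p (of_int a / of_int b) =
           real p powi (int (multiplicity (int p) b) - int (multiplicity (int p) a))"
proof -
  obtain c d where cd: "quotient_of (of_int a / of_int b) = (c, d)"
    by (cases "quotient_of (of_int a / of_int b)")
  have d: "d > 0" using quotient_of_denom_pos[OF cd] .
  have eq: "(of_int a / of_int b :: rat) = of_int c / of_int d"
    using quotient_of_div[OF cd] .
  have nz': "(of_int a / of_int b :: rat) \<noteq> 0" using nz by simp
  have c: "c \<noteq> 0" using eq nz' by auto
  have "(of_int (a * d) :: rat) = of_int (c * b)"
    using eq nz d by (simp add: field_simps)
  hence "a * d = c * b" by (simp only: of_int_eq_iff)
  moreover have "prime_elem (int p)" using p by simp
  ultimately have "multiplicity (int p) a + multiplicity (int p) d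
                 = multiplicity (int p) c + multiplicity (int p) b"
    using nz c d by (metis less_irrefl prime_elem_multiplicity_mult_distrib)
  hence "int (multiplicity (int p) d) - int (multiplicity (int p) c)
       = int (multiplicity (int p) b) - int (multiplicity (int p) a)" by linarith
  thus ?thesis using nz' cd by (simp add: padic_abs_def)
qed

lemma rat_common_denominator:
  fixes x y :: rat
  obtains a b d where "x = of_int a / of_int d" "y = of_int b / of_int d" "d \<noteq> 0"
proof -
  obtain a c where x: "quotient_of x = (a, c)" by (cases "quotient_of x")
  obtain b e where y: "quotient_of y = (b, e)" by (cases "quotient_of y")
  have "c > 0" "e > 0" using quotient_of_denom_pos[OF x] quotient_of_denom_pos[OF y] .
  thus ?thesis
    using quotient_of_div[OF x] quotient_of_div[OF y] that[of "a * e" "c * e" "b * c"]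
    by (simp add: field_simps)
qed

context
  fixes p :: nat
  assumes p: "prime p"
begin

lemma padic_abs_pos: "x \<noteq> 0 \<Longrightarrow> padic_abs p x > 0"
  using prime_gt_0_nat[OF p] by (simp add: padic_abs_def)

lemma padic_abs_nonneg [simp]: "padic_abs p x \<ge> 0"
  using padic_abs_pos[of x] by (cases "x = 0") auto

lemma padic_abs_eq_0_iff [simp]: "padic_abs p x = 0 \<longleftrightarrow> x = 0"
  using padic_abs_pos[of x] by (cases "x = 0") auto

lemma padic_abs_1 [simp]: "padic_abs p 1 = 1"
  using padic_abs_fraction[OF p, of 1 1] by simp

lemma padic_abs_self: "padic_abs p (of_nat p) = 1 / real p"
  using padic_abs_fraction[OF p, of "int p" 1] prime_gt_1_nat[OF p]
  by (simp add: multiplicity_self power_int_minus field_simps)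

lemma padic_abs_mult: "padic_abs p (x * y) = padic_abs p x * padic_abs p y"
proof (cases "x = 0 \<or> y = 0")
  case False
  obtain a b d where xy: "x = of_int a / of_int d" "y = of_int b / of_int d" "d \<noteq> 0"
    by (rule rat_common_denominator)
  have nz: "a \<noteq> 0" "b \<noteq> 0" using False xy by auto
  have pe: "prime_elem (int p)" using p by simp
  have p0: "real p \<noteq> 0" using prime_gt_0_nat[OF p] by simp
  have "padic_abs p (x * y) = padic_abs p (of_int (a * b) / of_int (d * d))"
    by (simp add: xy)
  also have "\<dots> = real p powi (int (multiplicity (int p) d) - int (multiplicity (int p) a)
                             + (int (multiplicity (int p) d) - int (multiplicity (int p) b)))"
    using nz xy pe
    by (subst padic_abs_fraction[OF p]) (simp_all add: prime_elem_multiplicity_mult_distrib algebra_simps)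
  also have "\<dots> = padic_abs p x * padic_abs p y"
    using nz xy p0 by (subst power_int_add) (auto simp: padic_abs_fraction[OF p])
  finally show ?thesis .
qed auto

lemma padic_abs_minus [simp]: "padic_abs p (- x) = padic_abs p x"
proof -
  have "padic_abs p (-1) * padic_abs p (-1) = 1"
    by (simp flip: padic_abs_mult)
  hence "padic_abs p (-1) = 1"
    using padic_abs_nonneg[of "-1"] by (smt (verit) mult_eq_1 mult_less_cancel_right2 mult_le_one not_one_le_zero power2_eq_1_iff power2_eq_square)
  thus ?thesis using padic_abs_mult[of "-1" x] by simp
qed

lemma padic_abs_minus_commute: "padic_abs p (x - y) = padic_abs p (y - x)"
  using padic_abs_minus[of "x - y"] by simp

lemma padic_abs_ultrametric: "padic_abs p (x + y) \<le> max (padic_abs p x) (padic_abs p y)"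
proof (cases "x = 0 \<or> y = 0 \<or> x + y = 0")
  case True
  thus ?thesis by (auto simp: le_max_iff_disj)
next
  case False
  obtain a b d where xy: "x = of_int a / of_int d" "y = of_int b / of_int d" "d \<noteq> 0"
    by (rule rat_common_denominator)
  have sum: "x + y = of_int (a + b) / of_int d" using xy by (simp add: add_divide_distrib)
  have nz: "a \<noteq> 0" "b \<noteq> 0" "a + b \<noteq> 0"
    using False xy sum by (auto simp del: of_int_add)
  let ?m = "multiplicity (int p)"
  have "int p ^ min (?m a) (?m b) dvd a + b"
    by (intro dvd_add; rule multiplicity_dvd'; simp)
  hence "min (?m a) (?m b) \<le> ?m (a + b)"
    using nz prime_gt_1_nat[OF p] by (intro multiplicity_geI) auto
  hence "real p powi (int (?m d) - int (?m (a + b)))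
         \<le> real p powi (int (?m d) - int (min (?m a) (?m b)))"
    using prime_gt_1_nat[OF p] by (intro power_int_increasing) auto
  also have "\<dots> \<le> max (real p powi (int (?m d) - int (?m a))) (real p powi (int (?m d) - int (?m b)))"
    by (simp add: min_def)
  finally show ?thesis
    unfolding sum unfolding xy using nz xy(3) by (simp add: padic_abs_fraction[OF p] del: of_int_add)
qed

lemma padic_abs_triangle: "padic_abs p (x + y) \<le> padic_abs p x + padic_abs p y"
  using padic_abs_ultrametric[of x y] padic_abs_nonneg[of x] padic_abs_nonneg[of y] by linarith

lemma padic_abs_diff_abs: "\<bar>padic_abs p x - padic_abs p y\<bar> \<le> padic_abs p (x - y)"
  using padic_abs_triangle[of "x - y" y] padic_abs_triangle[of "y - x" x]
  by (simp add: padic_abs_minus_commute[of y x])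

lemma padic_abs_inverse: "padic_abs p (inverse x) = inverse (padic_abs p x)"
proof (cases "x = 0")
  case False
  hence "padic_abs p x * padic_abs p (inverse x) = 1" by (simp flip: padic_abs_mult)
  thus ?thesis using False by (simp add: field_simps)
qed auto

end


section \<open>The field of p-adic numbers\<close>

definition padic_cauchy :: "nat \<Rightarrow> (nat \<Rightarrow> rat) \<Rightarrow> bool" where
  "padic_cauchy p X \<longleftrightarrow> (\<forall>e>0. \<exists>N. \<forall>m\<ge>N. \<forall>n\<ge>N. padic_abs p (X m - X n) < e)"

definition padic_null :: "nat \<Rightarrow> (nat \<Rightarrow> rat) \<Rightarrow> bool" where
  "padic_null p X \<longleftrightarrow> (\<lambda>n. padic_abs p (X n)) \<longlonglongrightarrow> 0"

definition padic_rel :: "nat \<Rightarrow> (nat \<Rightarrow> rat) \<Rightarrow> (nat \<Rightarrow> rat) \<Rightarrow> bool" where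
  "padic_rel p X Y \<longleftrightarrow> padic_cauchy p X \<and> padic_cauchy p Y \<and> padic_null p (\<lambda>n. X n - Y n)"

lemma padic_null_zero [simp]: "padic_null p (\<lambda>_. 0)"
  by (simp add: padic_null_def)

lemma padic_cauchy_const [simp]: "padic_cauchy p (\<lambda>_. c)"
  by (auto simp: padic_cauchy_def)

context
  fixes p :: nat
  assumes p: "prime p"
begin

lemma padic_null_le:
  assumes "padic_null p X" "\<And>n. padic_abs p (Y n) \<le> C * padic_abs p (X n)"
  shows "padic_null p Y"
  unfolding padic_null_def
proof (rule tendsto_sandwich[OF _ _ tendsto_const])
  show "(\<lambda>n. C * padic_abs p (X n)) \<longlonglongrightarrow> 0"
    using tendsto_mult_left[OF assms(1)[unfolded padic_null_def], of C] by simp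
qed (use assms(2) in \<open>auto simp: padic_abs_nonneg[OF p]\<close>)

lemma padic_null_minus: "padic_null p X \<Longrightarrow> padic_null p (\<lambda>n. - X n)"
  by (simp add: padic_null_def padic_abs_minus[OF p])

lemma padic_null_add:
  assumes "padic_null p X" "padic_null p Y"
  shows "padic_null p (\<lambda>n. X n + Y n)"
  unfolding padic_null_def
proof (rule tendsto_sandwich[OF _ _ tendsto_const])
  show "(\<lambda>n. padic_abs p (X n) + padic_abs p (Y n)) \<longlonglongrightarrow> 0"
    using tendsto_add[OF assms[unfolded padic_null_def]] by simp
qed (auto simp: padic_abs_nonneg[OF p] padic_abs_triangle[OF p])

lemma padic_cauchy_minus: "padic_cauchy p X \<Longrightarrow> padic_cauchy p (\<lambda>n. - X n)"
  unfolding padic_cauchy_def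
  by (simp add: padic_abs_minus_commute[OF p])

lemma padic_cauchy_add:
  assumes "padic_cauchy p X" "padic_cauchy p Y"
  shows "padic_cauchy p (\<lambda>n. X n + Y n)"
  unfolding padic_cauchy_def
proof (intro allI impI)
  fix e :: real assume e: "e > 0"
  obtain M where M: "\<And>m n. m \<ge> M \<Longrightarrow> n \<ge> M \<Longrightarrow> padic_abs p (X m - X n) < e"
    using assms(1) e unfolding padic_cauchy_def by blast
  obtain N where N: "\<And>m n. m \<ge> N \<Longrightarrow> n \<ge> N \<Longrightarrow> padic_abs p (Y m - Y n) < e"
    using assms(2) e unfolding padic_cauchy_def by blast
  have "padic_abs p (X m + Y m - (X n + Y n)) < e" if "m \<ge> max M N" "n \<ge> max M N" for m n
    using padic_abs_ultrametric[OF p, of "X m - X n" "Y m - Y n"] M[of m n] N[of m n] that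
    by (simp add: algebra_simps)
  thus "\<exists>N. \<forall>m\<ge>N. \<forall>n\<ge>N. padic_abs p (X m + Y m - (X n + Y n)) < e" by blast
qed

lemma padic_cauchy_convergent:
  assumes "padic_cauchy p X"
  shows "convergent (\<lambda>n. padic_abs p (X n))"
proof -
  have "Cauchy (\<lambda>n. padic_abs p (X n))"
    unfolding Cauchy_def dist_real_def
  proof (intro allI impI)
    fix e :: real assume "e > 0"
    then obtain N where "\<And>m n. m \<ge> N \<Longrightarrow> n \<ge> N \<Longrightarrow> padic_abs p (X m - X n) < e"
      using assms unfolding padic_cauchy_def by blast
    thus "\<exists>M. \<forall>m\<ge>M. \<forall>n\<ge>M. \<bar>padic_abs p (X m) - padic_abs p (X n)\<bar> < e"
      using padic_abs_diff_abs[OF p] by (meson le_less_trans)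
  qed
  thus ?thesis by (simp add: Cauchy_convergent_iff)
qed

lemma padic_cauchy_bounded:
  assumes "padic_cauchy p X"
  obtains C where "C > 0" "\<And>n. padic_abs p (X n) \<le> C"
proof -
  have "Bseq (\<lambda>n. padic_abs p (X n))"
    using padic_cauchy_convergent[OF assms] by (rule convergent_imp_Bseq)
  thus ?thesis
    using that unfolding Bseq_def by (auto simp: padic_abs_nonneg[OF p])
qed

lemma padic_cauchy_mult:
  assumes X: "padic_cauchy p X" and Y: "padic_cauchy p Y"
  shows "padic_cauchy p (\<lambda>n. X n * Y n)"
  unfolding padic_cauchy_def
proof (intro allI impI)
  fix e :: real assume e: "e > 0"
  obtain C where C: "C > 0" "\<And>n. padic_abs p (X n) \<le> C" using padic_cauchy_bounded[OF X] by blast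
  obtain D where D: "D > 0" "\<And>n. padic_abs p (Y n) \<le> D" using padic_cauchy_bounded[OF Y] by blast
  obtain M where M: "\<And>m n. m \<ge> M \<Longrightarrow> n \<ge> M \<Longrightarrow> padic_abs p (X m - X n) < e / D"
    using X e D(1) unfolding padic_cauchy_def by (meson divide_pos_pos)
  obtain N where N: "\<And>m n. m \<ge> N \<Longrightarrow> n \<ge> N \<Longrightarrow> padic_abs p (Y m - Y n) < e / C"
    using Y e C(1) unfolding padic_cauchy_def by (meson divide_pos_pos)
  have "padic_abs p (X m * Y m - X n * Y n) < e" if "m \<ge> max M N" "n \<ge> max M N" for m n
  proof -
    have "padic_abs p (X m * (Y m - Y n)) \<le> C * padic_abs p (Y m - Y n)"
      using C by (simp add: padic_abs_mult[OF p] padic_abs_nonneg[OF p] mult_right_mono)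
    also have "\<dots> < C * (e / C)" using C N that by (intro mult_strict_left_mono) auto
    finally have 1: "padic_abs p (X m * (Y m - Y n)) < e" using C by simp
    have "padic_abs p ((X m - X n) * Y n) \<le> padic_abs p (X m - X n) * D"
      using D by (simp add: padic_abs_mult[OF p] padic_abs_nonneg[OF p] mult_left_mono)
    also have "\<dots> < e / D * D" using D M that by (intro mult_strict_right_mono) auto
    finally have 2: "padic_abs p ((X m - X n) * Y n) < e" using D by simp
    show ?thesis
      using padic_abs_ultrametric[OF p, of "X m * (Y m - Y n)" "(X m - X n) * Y n"] 1 2
      by (simp add: algebra_simps)
  qed
  thus "\<exists>N. \<forall>m\<ge>N. \<forall>n\<ge>N. padic_abs p (X m * Y m - X n * Y n) < e" by blast
qed

lemma padic_null_mult:
  assumes "padic_cauchy p X" "padic_null p Y"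
  shows "padic_null p (\<lambda>n. X n * Y n)"
proof -
  obtain C where C: "\<And>n. padic_abs p (X n) \<le> C" using padic_cauchy_bounded[OF assms(1)] by blast
  show ?thesis
    by (rule padic_null_le[OF assms(2), of _ C])
       (simp add: padic_abs_mult[OF p] C mult_right_mono padic_abs_nonneg[OF p])
qed

lemma padic_not_null_bound:
  assumes X: "padic_cauchy p X" and nz: "\<not> padic_null p X"
  obtains b N where "b > 0" "\<And>n. n \<ge> N \<Longrightarrow> padic_abs p (X n) > b"
proof -
  obtain L where L: "(\<lambda>n. padic_abs p (X n)) \<longlonglongrightarrow> L"
    using padic_cauchy_convergent[OF X] by (auto simp: convergent_def)
  have "L \<ge> 0" using L by (rule LIMSEQ_le_const) (auto simp: padic_abs_nonneg[OF p])
  moreover have "L \<noteq> 0" using L nz by (auto simp: padic_null_def)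
  ultimately have "L > 0" by simp
  hence "eventually (\<lambda>n. padic_abs p (X n) > L / 2) sequentially"
    using L by (intro order_tendstoD(1)) auto
  thus ?thesis using that[of "L / 2"] \<open>L > 0\<close> by (auto simp: eventually_sequentially)
qed

lemma padic_cauchy_inverse:
  assumes X: "padic_cauchy p X" and nz: "\<not> padic_null p X"
  shows "padic_cauchy p (\<lambda>n. inverse (X n))"
  unfolding padic_cauchy_def
proof (intro allI impI)
  fix e :: real assume e: "e > 0"
  obtain b M where b: "b > 0" "\<And>n. n \<ge> M \<Longrightarrow> padic_abs p (X n) > b"
    using padic_not_null_bound[OF X nz] by blast
  obtain N where N: "\<And>m n. m \<ge> N \<Longrightarrow> n \<ge> N \<Longrightarrow> padic_abs p (X m - X n) < e * b * b"
    using X e b(1) unfolding padic_cauchy_def by (meson mult_pos_pos)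
  have "padic_abs p (inverse (X m) - inverse (X n)) < e" if "m \<ge> max M N" "n \<ge> max M N" for m n
  proof -
    have bm: "padic_abs p (X m) > b" "padic_abs p (X n) > b" using b that by auto
    hence nz: "X m \<noteq> 0" "X n \<noteq> 0" using b(1) by auto
    have "inverse (X m) - inverse (X n) = - (inverse (X m) * (X m - X n) * inverse (X n))"
      using nz by (simp add: field_simps)
    hence "padic_abs p (inverse (X m) - inverse (X n))
         = inverse (padic_abs p (X m)) * padic_abs p (X m - X n) * inverse (padic_abs p (X n))"
      by (simp add: padic_abs_mult[OF p] padic_abs_inverse[OF p] padic_abs_minus[OF p])
    also have "\<dots> < inverse b * (e * b * b) * inverse b"
      using b(1) bm N[of m n] that
      by (intro mult_strict_mono' less_imp_inverse_less mult_nonneg_nonneg)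
         (auto simp: padic_abs_nonneg[OF p])
    also have "\<dots> = e" using b(1) by (simp add: field_simps)
    finally show ?thesis .
  qed
  thus "\<exists>N. \<forall>m\<ge>N. \<forall>n\<ge>N. padic_abs p (inverse (X m) - inverse (X n)) < e" by blast
qed

lemma padic_rel_part_equivp: "part_equivp (padic_rel p)"
proof (rule part_equivpI)
  show "\<exists>X. padic_rel p X X" by (rule exI[of _ "\<lambda>_. 0"]) (simp add: padic_rel_def)
  show "symp (padic_rel p)"
    unfolding symp_def padic_rel_def padic_null_def by (simp add: padic_abs_minus_commute[OF p])
  show "transp (padic_rel p)"
  proof (rule transpI)
    fix X Y Z assume "padic_rel p X Y" "padic_rel p Y Z"
    thus "padic_rel p X Z"
      using padic_null_add[of "\<lambda>n. X n - Y n" "\<lambda>n. Y n - Z n"] by (simp add: padic_rel_def)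
  qed
qed

lemma padic_rel_null_cong: "padic_rel p X Y \<Longrightarrow> padic_null p X \<longleftrightarrow> padic_null p Y"
  using padic_null_add[of "\<lambda>n. X n - Y n" Y] padic_null_add[of "\<lambda>n. - (X n - Y n)" X]
    padic_null_minus[of "\<lambda>n. X n - Y n"]
  by (auto simp: padic_rel_def)

lemma padic_rel_add:
  assumes "padic_rel p X Y" "padic_rel p X' Y'"
  shows "padic_rel p (\<lambda>n. X n + X' n) (\<lambda>n. Y n + Y' n)"
  using assms padic_null_add[of "\<lambda>n. X n - Y n" "\<lambda>n. X' n - Y' n"]
  by (auto simp: padic_rel_def padic_cauchy_add algebra_simps)

lemma padic_rel_minus:
  assumes "padic_rel p X Y"
  shows "padic_rel p (\<lambda>n. - X n) (\<lambda>n. - Y n)"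
  using assms padic_null_minus[of "\<lambda>n. X n - Y n"]
  by (auto simp: padic_rel_def padic_cauchy_minus algebra_simps)

lemma padic_rel_mult:
  assumes "padic_rel p X Y" "padic_rel p X' Y'"
  shows "padic_rel p (\<lambda>n. X n * X' n) (\<lambda>n. Y n * Y' n)"
proof -
  have "padic_null p (\<lambda>n. X n * (X' n - Y' n) + Y' n * (X n - Y n))"
    using assms by (intro padic_null_add padic_null_mult) (auto simp: padic_rel_def)
  thus ?thesis using assms by (auto simp: padic_rel_def padic_cauchy_mult algebra_simps)
qed

lemma padic_rel_inverse:
  assumes XY: "padic_rel p X Y"
  shows "padic_rel p (if padic_null p X then (\<lambda>_. 0) else (\<lambda>n. inverse (X n)))
                     (if padic_null p Y then (\<lambda>_. 0) else (\<lambda>n. inverse (Y n)))"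
proof (cases "padic_null p X")
  case True
  thus ?thesis using padic_rel_null_cong[OF XY] by (simp add: padic_rel_def)
next
  case False
  have nY: "\<not> padic_null p Y" using False padic_rel_null_cong[OF XY] by simp
  have cX: "padic_cauchy p X" and cY: "padic_cauchy p Y" and nXY: "padic_null p (\<lambda>n. X n - Y n)"
    using XY by (auto simp: padic_rel_def)
  obtain b M where b: "b > 0" "\<And>n. n \<ge> M \<Longrightarrow> padic_abs p (X n) > b"
    using padic_not_null_bound[OF cX False] by blast
  obtain d N where d: "d > 0" "\<And>n. n \<ge> N \<Longrightarrow> padic_abs p (Y n) > d"
    using padic_not_null_bound[OF cY nY] by blast
  have "padic_null p (\<lambda>n. (- (inverse (X n) * inverse (Y n))) * (X n - Y n))"
    by (intro padic_null_mult nXY padic_cauchy_minus padic_cauchy_mult padic_cauchy_inverse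
          cX cY False nY)
  moreover have "eventually (\<lambda>n. padic_abs p ((- (inverse (X n) * inverse (Y n))) * (X n - Y n))
      = padic_abs p (inverse (X n) - inverse (Y n))) sequentially"
    using eventually_ge_at_top[of "max M N"]
  proof eventually_elim
    case (elim n)
    hence "X n \<noteq> 0" "Y n \<noteq> 0" using b(1) b(2)[of n] d(1) d(2)[of n] by auto
    thus ?case by (intro arg_cong[of _ _ "padic_abs p"]) (simp add: field_simps)
  qed
  ultimately have "padic_null p (\<lambda>n. inverse (X n) - inverse (Y n))"
    unfolding padic_null_def by (rule Lim_transform_eventually)
  thus ?thesis
    using False nY cX cY by (simp add: padic_rel_def padic_cauchy_inverse)
qed

lemma padic_rel_lim:
  assumes XY: "padic_rel p X Y"
  shows "lim (\<lambda>n. padic_abs p (X n)) = lim (\<lambda>n. padic_abs p (Y n))"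
proof -
  have "(\<lambda>n. padic_abs p (X n)) \<longlonglongrightarrow> lim (\<lambda>n. padic_abs p (X n))"
    using XY padic_cauchy_convergent by (simp add: padic_rel_def convergent_LIMSEQ_iff)
  moreover have "(\<lambda>n. padic_abs p (X n) - padic_abs p (Y n)) \<longlonglongrightarrow> 0"
  proof (rule Lim_null_comparison)
    show "\<forall>\<^sub>F n in sequentially. norm (padic_abs p (X n) - padic_abs p (Y n)) \<le> padic_abs p (X n - Y n)"
      by (simp add: padic_abs_diff_abs[OF p])
    show "(\<lambda>n. padic_abs p (X n - Y n)) \<longlonglongrightarrow> 0"
      using XY by (simp add: padic_rel_def padic_null_def)
  qed
  ultimately have "(\<lambda>n. padic_abs p (Y n)) \<longlonglongrightarrow> lim (\<lambda>n. padic_abs p (X n))"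
    using tendsto_diff by fastforce
  thus ?thesis by (simp add: limI)
qed

end

text \<open>
  The prime \<open>p\<close> is \<open>CARD('p)\<close>, where \<open>'p\<close> is a type variable of class \<open>prime_card\<close>;
  \<open>'p padic\<close> is the completion of the rationals for the absolute value \<open>padic_abs CARD('p)\<close>.
\<close>

typedef 'a padic = "{S. \<exists>X. padic_rel CARD('a::prime_card) X X \<and> S = Collect (padic_rel CARD('a) X)}"
proof -
  have "padic_rel CARD('a) (\<lambda>_. 0) (\<lambda>_. 0)" by (simp add: padic_rel_def)
  thus ?thesis by blast
qed

interpretation padic: quot_type "padic_rel CARD('a::prime_card)"
  "Abs_padic :: _ \<Rightarrow> 'a padic" Rep_padic
proof
  fix x y :: "'a padic" and c
  show "part_equivp (padic_rel CARD('a))" by (rule padic_rel_part_equivp[OF prime_card])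
  show "\<exists>X. padic_rel CARD('a) X X \<and> Rep_padic x = Collect (padic_rel CARD('a) X)"
    using Rep_padic[of x] by blast
  show "Abs_padic (Rep_padic x) = x" by (rule Rep_padic_inverse)
  show "Rep_padic (Abs_padic c :: 'a padic) = c"
    if "\<exists>X. padic_rel CARD('a) X X \<and> c = Collect (padic_rel CARD('a) X)"
    using that by (intro Abs_padic_inverse) blast
  show "Rep_padic x = Rep_padic y \<longleftrightarrow> x = y" by (rule Rep_padic_inject)
qed

definition padic_of :: "(nat \<Rightarrow> rat) \<Rightarrow> 'a::prime_card padic" where
  "padic_of = padic.abs"

definition cr_padic :: "(nat \<Rightarrow> rat) \<Rightarrow> 'a::prime_card padic \<Rightarrow> bool" where
  "cr_padic \<equiv> \<lambda>X x. padic_rel CARD('a) X X \<and> padic_of X = x"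

lemma Quotient_padic: "Quotient (padic_rel CARD('a)) padic_of padic.rep
    (cr_padic :: _ \<Rightarrow> 'a::prime_card padic \<Rightarrow> bool)"
  using Quotient3_to_Quotient[OF padic.Quotient cr_padic_def[unfolded padic_of_def]]
  by (simp add: padic_of_def)

setup_lifting Quotient_padic

instantiation padic :: (prime_card) field
begin

lift_definition zero_padic :: "'a padic" is "\<lambda>_. 0"
  by (simp add: padic_rel_def)

lift_definition one_padic :: "'a padic" is "\<lambda>_. 1"
  by (simp add: padic_rel_def)

lift_definition plus_padic :: "'a padic \<Rightarrow> 'a padic \<Rightarrow> 'a padic" is "\<lambda>X Y n. X n + Y n"
  by (rule padic_rel_add[OF prime_card])

lift_definition uminus_padic :: "'a padic \<Rightarrow> 'a padic" is "\<lambda>X n. - X n"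
  by (rule padic_rel_minus[OF prime_card])

lift_definition times_padic :: "'a padic \<Rightarrow> 'a padic \<Rightarrow> 'a padic" is "\<lambda>X Y n. X n * Y n"
  by (rule padic_rel_mult[OF prime_card])

lift_definition inverse_padic :: "'a padic \<Rightarrow> 'a padic"
  is "\<lambda>X. if padic_null CARD('a) X then (\<lambda>_. 0) else (\<lambda>n. inverse (X n))"
  by (rule padic_rel_inverse[OF prime_card])

definition minus_padic :: "'a padic \<Rightarrow> 'a padic \<Rightarrow> 'a padic" where
  "minus_padic x y = x + - y"

definition divide_padic :: "'a padic \<Rightarrow> 'a padic \<Rightarrow> 'a padic" where
  "divide_padic x y = x * inverse y"

instance
proof
  fix x y z :: "'a padic"
  show "x * y * z = x * (y * z)"
    by transfer (simp add: padic_rel_def padic_cauchy_mult[OF prime_card] mult.assoc)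
  show "x * y = y * x"
    by transfer (simp add: padic_rel_def padic_cauchy_mult[OF prime_card] mult.commute)
  show "1 * x = x" by transfer (simp add: padic_rel_def)
  show "x + y + z = x + (y + z)"
    by transfer (simp add: padic_rel_def padic_cauchy_add[OF prime_card] add.assoc)
  show "x + y = y + x"
    by transfer (simp add: padic_rel_def padic_cauchy_add[OF prime_card] add.commute)
  show "0 + x = x" by transfer (simp add: padic_rel_def)
  show "- x + x = 0" by transfer (simp add: padic_rel_def)
  show "x - y = x + - y" by (rule minus_padic_def)
  show "(x + y) * z = x * z + y * z"
    by transfer (simp add: padic_rel_def padic_cauchy_mult[OF prime_card]
          padic_cauchy_add[OF prime_card] distrib_right)
  show "(0 :: 'a padic) \<noteq> 1"
    by transfer (simp add: padic_rel_def padic_null_def padic_abs_minus[OF prime_card]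
          padic_abs_1[OF prime_card] LIMSEQ_const_iff)
  show "x div y = x * inverse y" by (rule divide_padic_def)
  show "inverse (0 :: 'a padic) = 0" by transfer (simp add: padic_rel_def)
  show "inverse x * x = 1" if "x \<noteq> 0"
    using that
  proof transfer
    fix X assume X: "padic_rel CARD('a) X X" and nz: "\<not> padic_rel CARD('a) X (\<lambda>_. 0)"
    have cX: "padic_cauchy CARD('a) X" using X by (simp add: padic_rel_def)
    have nn: "\<not> padic_null CARD('a) X" using nz cX by (simp add: padic_rel_def)
    obtain b N where b: "b > 0" "\<And>n. n \<ge> N \<Longrightarrow> padic_abs CARD('a) (X n) > b"
      using padic_not_null_bound[OF prime_card cX nn] by blast
    have "X n \<noteq> 0" if "n \<ge> N" for n using b(1) b(2)[OF that] by auto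
    hence "eventually (\<lambda>n. 0 = padic_abs CARD('a) (inverse (X n) * X n - 1)) sequentially"
      unfolding eventually_sequentially by (intro exI[of _ N]) auto
    hence "padic_null CARD('a) (\<lambda>n. inverse (X n) * X n - 1)"
      unfolding padic_null_def by (rule Lim_transform_eventually[OF tendsto_const])
    thus "padic_rel CARD('a)
            (\<lambda>n. (if padic_null CARD('a) X then \<lambda>_. 0 else (\<lambda>n. inverse (X n))) n * X n) (\<lambda>_. 1)"
      using nn cX by (simp add: padic_rel_def padic_cauchy_mult[OF prime_card]
          padic_cauchy_inverse[OF prime_card])
  qed
qed

end

lift_definition padic_norm :: "'p::prime_card padic \<Rightarrow> real"
  is "\<lambda>X. lim (\<lambda>n. padic_abs CARD('p) (X n))"
  by (rule padic_rel_lim[OF prime_card])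

lemma padic_norm_tendsto:
  assumes "padic_cauchy CARD('p::prime_card) X"
  shows "(\<lambda>n. padic_abs CARD('p) (X n)) \<longlonglongrightarrow> lim (\<lambda>n. padic_abs CARD('p) (X n))"
  using padic_cauchy_convergent[OF prime_card assms] by (simp add: convergent_LIMSEQ_iff)

lemma padic_norm_eq_0_iff [simp]: "padic_norm (x :: 'p::prime_card padic) = 0 \<longleftrightarrow> x = 0"
proof transfer
  fix X assume X: "padic_rel CARD('p) X X"
  hence "padic_null CARD('p) X \<longleftrightarrow> lim (\<lambda>n. padic_abs CARD('p) (X n)) = 0"
    using padic_norm_tendsto[of X] LIMSEQ_unique unfolding padic_null_def padic_rel_def by metis
  thus "lim (\<lambda>n. padic_abs CARD('p) (X n)) = 0 \<longleftrightarrow> padic_rel CARD('p) X (\<lambda>_. 0)"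
    using X by (simp add: padic_rel_def)
qed

lemma padic_norm_nonneg [simp]: "padic_norm (x :: 'p::prime_card padic) \<ge> 0"
  by transfer (auto simp: padic_rel_def padic_abs_nonneg[OF prime_card]
        intro!: LIMSEQ_le_const[OF padic_norm_tendsto])

lemma padic_norm_mult: "padic_norm (x * y :: 'p::prime_card padic) = padic_norm x * padic_norm y"
  by transfer
     (auto simp: padic_rel_def padic_abs_mult[OF prime_card] intro!: limI tendsto_mult padic_norm_tendsto)

lemma padic_norm_ultrametric:
  "padic_norm (x + y :: 'p::prime_card padic) \<le> max (padic_norm x) (padic_norm y)"
proof transfer
  fix X Y assume "padic_rel CARD('p) X X" "padic_rel CARD('p) Y Y"
  hence c: "padic_cauchy CARD('p) X" "padic_cauchy CARD('p) Y" by (auto simp: padic_rel_def)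
  show "lim (\<lambda>n. padic_abs CARD('p) (X n + Y n))
      \<le> max (lim (\<lambda>n. padic_abs CARD('p) (X n))) (lim (\<lambda>n. padic_abs CARD('p) (Y n)))"
    by (rule LIMSEQ_le[OF padic_norm_tendsto tendsto_max[OF padic_norm_tendsto padic_norm_tendsto]])
       (use c in \<open>auto simp: padic_cauchy_add[OF prime_card] padic_abs_ultrametric[OF prime_card]\<close>)
qed

lemma padic_norm_minus [simp]: "padic_norm (- x :: 'p::prime_card padic) = padic_norm x"
  by transfer (simp add: padic_abs_minus[OF prime_card])

lemma padic_norm_minus_commute: "padic_norm (x - y :: 'p::prime_card padic) = padic_norm (y - x)"
  using padic_norm_minus[of "x - y"] by simp

lift_definition padic_of_rat :: "rat \<Rightarrow> 'p::prime_card padic" is "\<lambda>q _. q"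
  by (simp add: padic_rel_def)

lemma padic_norm_of_rat: "padic_norm (padic_of_rat q :: 'p::prime_card padic) = padic_abs CARD('p) q"
  by transfer simp

lemma padic_norm_prime: "padic_norm (of_nat CARD('p) :: 'p::prime_card padic) = 1 / real CARD('p)"
proof -
  have *: "of_nat n = (padic_of_rat (of_nat n) :: 'p padic)" for n
  proof (induction n)
    case 0
    show ?case by simp (transfer, simp add: padic_rel_def)
  next
    case (Suc n)
    show ?case unfolding of_nat_Suc Suc by transfer (simp add: padic_rel_def)
  qed
  have "padic_norm (of_nat CARD('p) :: 'p padic) = padic_abs CARD('p) (of_nat CARD('p))"
    unfolding *[of "CARD('p)"] by (rule padic_norm_of_rat)
  also have "\<dots> = 1 / real CARD('p)" by (simp add: padic_abs_self[OF prime_card])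
  finally show ?thesis .
qed

instantiation padic :: (prime_card) metric_space
begin

definition dist_padic :: "'a padic \<Rightarrow> 'a padic \<Rightarrow> real" where
  "dist_padic x y = padic_norm (x - y)"

definition uniformity_padic :: "('a padic \<times> 'a padic) filter" where
  "uniformity_padic = (INF e\<in>{0<..}. principal {(x, y). dist x y < e})"

definition open_padic :: "'a padic set \<Rightarrow> bool" where
  "open_padic U \<longleftrightarrow> (\<forall>x\<in>U. eventually (\<lambda>(x', y). x' = x \<longrightarrow> y \<in> U) uniformity)"

instance
proof
  fix x y z :: "'a padic"
  show "dist x y = 0 \<longleftrightarrow> x = y" by (simp add: dist_padic_def)
  show "dist x y \<le> dist x z + dist y z"
    using padic_norm_ultrametric[of "x - z" "z - y"]
    by (simp add: dist_padic_def padic_norm_minus_commute[of y z] order.trans max_def split: if_splits)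
qed (simp_all add: uniformity_padic_def open_padic_def)

end

definition padic_ints :: "'p::prime_card padic set" where
  "padic_ints = {x. padic_norm x \<le> 1}"


section \<open>Finite matrices\<close>

definition GL_padic_ints :: "nat \<Rightarrow> 'p::prime_card padic mat set" where
  "GL_padic_ints n = {A \<in> carrier_mat n n. elements_mat A \<subseteq> padic_ints \<and>
     (\<exists>B\<in>carrier_mat n n. elements_mat B \<subseteq> padic_ints \<and> A * B = 1\<^sub>m n \<and> B * A = 1\<^sub>m n)}"

text \<open>The value \<open>None\<close> of type \<open>int option\<close>, which is the least one, stands for \<open>-\<infinity>\<close>.\<close>

definition p_power_neg :: "int option \<Rightarrow> 'p::prime_card padic" where
  "p_power_neg k = (case k of None \<Rightarrow> 0 | Some m \<Rightarrow> of_nat CARD('p) powi (- m))"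

definition singular_exponents :: "'p::prime_card padic mat \<Rightarrow> (nat \<Rightarrow> int option) \<Rightarrow> bool" where
  "singular_exponents z k \<longleftrightarrow> (let n = dim_row z in
     (\<forall>i j. i \<le> j \<longrightarrow> j < n \<longrightarrow> k j \<le> k i) \<and>
     (\<exists>A\<in>GL_padic_ints n. \<exists>B\<in>GL_padic_ints n. z = A * mat_diag n (\<lambda>j. p_power_neg (k j)) * B))"

text \<open>The product does not depend on the choice of the decomposition.\<close>

definition gamma_mat :: "'p::prime_card padic mat \<Rightarrow> real" where
  "gamma_mat z = (THE c. \<exists>k. singular_exponents z k \<and>
     c = (\<Prod>j\<in>{j. j < dim_row z \<and> k j > Some 0}. real CARD('p) powi the (k j)))"


section \<open>The measures\<close>

text \<open>
  The measure space of \<open>n \<times> n\<close> matrices is the product \<open>\<sigma>\<close>-algebra on extensional functions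
  on \<open>{..<n} \<times> {..<n}\<close>, that of infinite matrices the product \<open>\<sigma>\<close>-algebra on
  functions on \<open>nat \<times> nat\<close>. Indices start at 0. For \<open>z\<close> of either kind, \<open>Matrix.mat n n z\<close> is
  its upper left \<open>n \<times> n\<close> corner as an element of \<open>carrier_mat n n\<close>.
\<close>

definition mat_idx :: "nat \<Rightarrow> (nat \<times> nat) set" where
  "mat_idx n = {..<n} \<times> {..<n}"

definition mat_algebra :: "nat \<Rightarrow> (nat \<times> nat \<Rightarrow> 'p::prime_card padic) measure" where
  "mat_algebra n = (\<Pi>\<^sub>M ij\<in>mat_idx n. borel)"

definition inf_mat_algebra :: "(nat \<times> nat \<Rightarrow> 'p::prime_card padic) measure" where
  "inf_mat_algebra = (\<Pi>\<^sub>M ij\<in>UNIV. borel)"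

definition vol :: "nat \<Rightarrow> (nat \<times> nat \<Rightarrow> 'p::prime_card padic) measure" where
  "vol n = (THE V. sets V = sets (mat_algebra n) \<and>
     (\<forall>w\<in>space V. distr V V (\<lambda>z. \<lambda>ij\<in>mat_idx n. z ij + w ij) = V) \<and>
     emeasure V (\<Pi>\<^sub>E ij\<in>mat_idx n. padic_ints) = 1)"

definition c_const :: "'p::prime_card itself \<Rightarrow> nat \<Rightarrow> real \<Rightarrow> ennreal" where
  "c_const _ n \<alpha> =
     (\<integral>\<^sup>+z. ennreal (gamma_mat (Matrix.mat n n z) powr (- \<alpha>))
        \<partial>(vol n :: (nat \<times> nat \<Rightarrow> 'p padic) measure))"

definition mu_fin :: "real \<Rightarrow> nat \<Rightarrow> (nat \<times> nat \<Rightarrow> 'p::prime_card padic) measure" where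
  "mu_fin s n = density (vol n)
     (\<lambda>z. ennreal (gamma_mat (Matrix.mat n n z) powr (- s - 2 * real n))
          / c_const TYPE('p) n (s + 2 * real n))"

definition is_mu_inf :: "real \<Rightarrow> (nat \<times> nat \<Rightarrow> 'p::prime_card padic) measure \<Rightarrow> bool" where
  "is_mu_inf s M \<longleftrightarrow> prob_space M \<and> sets M = sets inf_mat_algebra \<and>
     (\<forall>n\<ge>1. distr M (mat_algebra n) (\<lambda>z. restrict z (mat_idx n)) = mu_fin s n)"


section \<open>Infinite matrices and the group\<close>

text \<open>
  A product of infinite matrices is only used where all the sums over the inner index are finite.
\<close>

definition imat_mult :: "('i \<times> 'k \<Rightarrow> 'a::comm_ring_1) \<Rightarrow> ('k \<times> 'j \<Rightarrow> 'a) \<Rightarrow> ('i \<times> 'j \<Rightarrow> 'a)"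
    (infixl "**\<^sub>i" 70) where
  "A **\<^sub>i B = (\<lambda>(i, j). Sum_any (\<lambda>k. A (i, k) * B (k, j)))"

definition imat_add :: "('i \<times> 'j \<Rightarrow> 'a::comm_ring_1) \<Rightarrow> ('i \<times> 'j \<Rightarrow> 'a) \<Rightarrow> ('i \<times> 'j \<Rightarrow> 'a)"
    (infixl "++\<^sub>i" 65) where
  "A ++\<^sub>i B = (\<lambda>ij. A ij + B ij)"

definition imat_one :: "'i \<times> 'i \<Rightarrow> 'a::comm_ring_1" where
  "imat_one = (\<lambda>(i, j). if i = j then 1 else 0)"

definition row_finite :: "('i \<times> 'j \<Rightarrow> 'a::comm_ring_1) \<Rightarrow> bool" where
  "row_finite A \<longleftrightarrow> (\<forall>i. finite {j. A (i, j) \<noteq> 0})"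

text \<open>
  Row finite matrices form a ring, and the inverse is taken in this ring. If \<open>c\<close> and \<open>a - 1\<close> have
  finitely many nonzero entries, then \<open>a + zc\<close> is row finite.
\<close>

definition imat_inv :: "('i \<times> 'i \<Rightarrow> 'a::comm_ring_1) \<Rightarrow> ('i \<times> 'i \<Rightarrow> 'a)" where
  "imat_inv A = (THE B. row_finite B \<and> A **\<^sub>i B = imat_one \<and> B **\<^sub>i A = imat_one)"

text \<open>The two copies of \<open>nat\<close> in \<open>nat + nat\<close> index the two block rows and block columns.\<close>

type_synonym 'a block_imat = "(nat + nat) \<times> (nat + nat) \<Rightarrow> 'a"

definition blk_a :: "'a block_imat \<Rightarrow> nat \<times> nat \<Rightarrow> 'a" where
  "blk_a g = (\<lambda>(i, j). g (Inl i, Inl j))"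

definition blk_b :: "'a block_imat \<Rightarrow> nat \<times> nat \<Rightarrow> 'a" where
  "blk_b g = (\<lambda>(i, j). g (Inl i, Inr j))"

definition blk_c :: "'a block_imat \<Rightarrow> nat \<times> nat \<Rightarrow> 'a" where
  "blk_c g = (\<lambda>(i, j). g (Inr i, Inl j))"

definition blk_d :: "'a block_imat \<Rightarrow> nat \<times> nat \<Rightarrow> 'a" where
  "blk_d g = (\<lambda>(i, j). g (Inr i, Inr j))"

definition GL_2inf :: "'p::prime_card padic block_imat set" where
  "GL_2inf = {g. range g \<subseteq> padic_ints \<and> finite {ij. g ij \<noteq> imat_one ij} \<and>
     (\<exists>h. range h \<subseteq> padic_ints \<and> g **\<^sub>i h = imat_one \<and> h **\<^sub>i g = imat_one)}"

definition P_subgroup :: "'p::prime_card padic block_imat set" where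
  "P_subgroup = {g \<in> GL_2inf. \<forall>ij. blk_c g ij = 0}"

definition det_a_zc :: "'p::prime_card padic block_imat \<Rightarrow> (nat \<times> nat \<Rightarrow> 'p padic) \<Rightarrow> 'p padic" where
  "det_a_zc g z = (THE x. \<forall>\<^sub>F k in sequentially.
     x = Determinant.det (Matrix.mat k k (blk_a g) + Matrix.mat k k z * Matrix.mat k k (blk_c g)))"

definition act_domain :: "'p::prime_card padic block_imat \<Rightarrow> (nat \<times> nat \<Rightarrow> 'p padic) set" where
  "act_domain g = {z. det_a_zc g z \<noteq> 0}"

definition act ::
    "'p::prime_card padic block_imat \<Rightarrow> (nat \<times> nat \<Rightarrow> 'p padic) \<Rightarrow> (nat \<times> nat \<Rightarrow> 'p padic)" where
  "act g z = imat_inv (blk_a g ++\<^sub>i z **\<^sub>i blk_c g) **\<^sub>i (blk_b g ++\<^sub>i z **\<^sub>i blk_d g)"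


section \<open>Quasiinvariance\<close>

text \<open>
  \<open>\<phi>\<close> is a transformation with domain \<open>D\<close>. Since \<open>\<phi>\<close> is an isomorphism of measurable spaces
  from \<open>D\<close> onto \<open>\<phi> ` D\<close>, and both sets have full measure, null sets may be tested on subsets of \<open>D\<close>.
\<close>

definition quasiinvariant_with ::
    "'a measure \<Rightarrow> 'a set \<Rightarrow> ('a \<Rightarrow> 'a) \<Rightarrow> ('a \<Rightarrow> real) \<Rightarrow> bool" where
  "quasiinvariant_with M D \<phi> h \<longleftrightarrow>
     D \<in> sets M \<and> (AE z in M. z \<in> D) \<and>
     \<phi> ` D \<in> sets M \<and> (AE z in M. z \<in> \<phi> ` D) \<and>
     inj_on \<phi> D \<and> \<phi> \<in> measurable (restrict_space M D) M \<and>
     h \<in> borel_measurable (restrict_space M D) \<and> (\<forall>z\<in>D. h z \<ge> 0) \<and>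
     (\<forall>B\<in>sets M. B \<subseteq> D \<longrightarrow>
        \<phi> ` B \<in> sets M \<and>
        (\<phi> ` B \<in> null_sets M \<longleftrightarrow> B \<in> null_sets M) \<and>
        emeasure M (\<phi> ` B) = (\<integral>\<^sup>+z\<in>B. ennreal (h z) \<partial>M))"

definition invariant_under :: "'a measure \<Rightarrow> 'a set \<Rightarrow> ('a \<Rightarrow> 'a) \<Rightarrow> bool" where
  "invariant_under M D \<phi> \<longleftrightarrow> quasiinvariant_with M D \<phi> (\<lambda>_. 1)"

end

theory Submission
  imports Defs
begin

text \<open>
  An element \<open>g\<close> of \<open>GL(2n, O\<^sub>p)\<close> acts on the \<open>n \<times> 2n\<close> matrix \<open>(1 | z)\<close> from the right, and
  \<open>(1 | z) g = A (1 | w)\<close>, where \<open>A = a + zc\<close> and \<open>w\<close> is the image of \<open>z\<close>. The function \<open>\<gamma>(z)\<close> is the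
  largest absolute value of a maximal minor of \<open>(1 | z)\<close>, hence \<open>\<gamma>(z) = |det A| \<gamma>(w)\<close>. The Jacobian of
  \<open>z \<mapsto> w\<close> is \<open>|det A|\<^sup>-\<^sup>2\<^sup>n\<close>, and in the density \<open>\<gamma>\<^sup>-\<^sup>s\<^sup>-\<^sup>2\<^sup>n\<close> the two powers of \<open>|det A|\<close> combine to
  \<open>|det A|\<^sup>s\<close>, whatever \<open>n\<close> is.

  The formula for the Jacobian is stable under composition. By the Smith normal form, \<open>GL(2n, O\<^sub>p)\<close> is
  generated by the elementary matrices, and up to conjugation by transpositions these are of three
  kinds: translations \<open>z \<mapsto> z + t E\<^sub>i\<^sub>j\<close>, multiplications of a row of \<open>z\<close> by a unit, and exchanges of a
  column of \<open>1\<close> with a column of \<open>z\<close>. For an exchange, Fubini's theorem reduces the claim to the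
  inversion \<open>y \<mapsto> y\<^sup>-\<^sup>1\<close> of one entry, whose Jacobian is \<open>|y|\<^sup>-\<^sup>2\<close>.

  For large \<open>n\<close>, passing to the upper left \<open>n \<times> n\<close> corner commutes with the action of \<open>g\<close>, and a finite
  measure on the infinite matrices is determined by its images under the passage to corners.
\<close>

section \<open>The field of p-adic numbers\<close>

text \<open>The measure \<open>vol\<close> and the function \<open>gamma_mat\<close> are given by
  definite descriptions, so each needs an existence and a uniqueness proof before anything can be
  computed. For \<open>vol\<close>, existence comes from random base p digits and uniqueness from
  counting the cosets of small boxes. For \<open>gamma_mat\<close>, existence is the Smith normal
  form and uniqueness is the description by minors. Minors also make the transformation law visible:
  it is not apparent how the exponents of z change under the action, whereas a right factor from
  GL(2n, O_p) leaves the largest minor unchanged, because it and its inverse are integral and the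
  norm is ultrametric, and a left factor A multiplies all minors by det A. The change of variables
  is not derived from a derivative. It is an identity of integrals, proved for generators and
  composed. A product of generators may leave the domain of the action at an intermediate stage, so
  the identity has to be propagated together with the statement that the exceptional set is
  null.\<close>

lemma padic_rational_approx:
  fixes x :: "'p::prime_card padic"
  assumes "e > 0"
  shows "\<exists>q. padic_norm (x - padic_of_rat q) < e"
  using assms unfolding minus_padic_def
proof (transfer fixing: e)
  fix X assume e: "e > 0" and "padic_rel CARD('p) X X"
  hence X: "padic_cauchy CARD('p) X" by (simp add: padic_rel_def)
  then obtain N where N: "\<And>m n. m \<ge> N \<Longrightarrow> n \<ge> N \<Longrightarrow> padic_abs CARD('p) (X m - X n) < e / 2"
    using e unfolding padic_cauchy_def by (meson half_gt_zero)
  have c: "padic_cauchy CARD('p) (\<lambda>n. X n + - X N)"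
    using padic_cauchy_add[OF prime_card X padic_cauchy_const] .
  \<comment> \<open>A limit preserves only weak inequalities; the margin between e / 2 and e
    restores the strict one.\<close>
  have "lim (\<lambda>n. padic_abs CARD('p) (X n + - X N)) \<le> e / 2"
    by (rule LIMSEQ_le_const2[OF padic_norm_tendsto[OF c]]) (use N[of _ N] in \<open>auto intro!: exI[of _ N] less_imp_le\<close>)
  thus "\<exists>q. lim (\<lambda>n. padic_abs CARD('p) (X n + - q)) < e"
    using e by (intro exI[of _ "X N"]) auto
qed

lemma padic_norm_zero [simp]: "padic_norm (0 :: 'p::prime_card padic) = 0"
  by simp

lemma padic_norm_one [simp]: "padic_norm (1 :: 'p::prime_card padic) = 1"
  using padic_norm_mult[of "1 :: 'p padic" 1] padic_norm_eq_0_iff[of "1 :: 'p padic"] by simp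

lemma padic_norm_pos_iff [simp]: "padic_norm (x :: 'p::prime_card padic) > 0 \<longleftrightarrow> x \<noteq> 0"
  using padic_norm_nonneg[of x] padic_norm_eq_0_iff[of x] by linarith

lemma padic_norm_inverse: "padic_norm (inverse (x :: 'p::prime_card padic)) = inverse (padic_norm x)"
proof (cases "x = 0")
  case False
  hence "padic_norm x * padic_norm (inverse x) = 1" by (simp flip: padic_norm_mult)
  thus ?thesis using False by (simp add: field_simps)
qed auto

lemma padic_norm_divide: "padic_norm (x / y :: 'p::prime_card padic) = padic_norm x / padic_norm y"
  by (simp add: divide_inverse padic_norm_mult padic_norm_inverse)

lemma padic_norm_prod: "padic_norm (prod f A :: 'p::prime_card padic) = (\<Prod>a\<in>A. padic_norm (f a))"
  by (induction A rule: infinite_finite_induct) (auto simp: padic_norm_mult)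

lemma padic_norm_diff_ultrametric:
  "padic_norm (x - y :: 'p::prime_card padic) \<le> max (padic_norm x) (padic_norm y)"
  using padic_norm_ultrametric[of x "- y"] by simp

lemma padic_norm_sum_le:
  assumes "\<And>a. a \<in> A \<Longrightarrow> padic_norm (f a :: 'p::prime_card padic) \<le> C" "C \<ge> 0"
  shows "padic_norm (sum f A) \<le> C"
  using assms
proof (induction A rule: infinite_finite_induct)
  case (insert a A)
  have "padic_norm (f a) \<le> C" "padic_norm (sum f A) \<le> C" using insert by auto
  thus ?case using padic_norm_ultrametric[of "f a" "sum f A"] insert.hyps by simp
qed auto

text \<open>In an ultrametric triangle the two longest sides have equal length.\<close>

lemma padic_norm_eqI:
  assumes "padic_norm (x - y :: 'p::prime_card padic) < padic_norm x"
  shows "padic_norm y = padic_norm x"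
  using padic_norm_ultrametric[of "x - y" y] padic_norm_diff_ultrametric[of x "x - y"] assms
  by simp

lemma card_prime_gt_1: "real CARD('p::prime_card) > 1"
  using prime_gt_1_nat[OF prime_card[where 'a='p]] by simp

text \<open>The norm is locally constant away from 0: a rational closer to x than |x| has the same
  norm, and for rationals the norm is a power of p by definition. Completion adds no new
  values.\<close>

lemma padic_norm_value:
  assumes "(x :: 'p::prime_card padic) \<noteq> 0"
  obtains k where "padic_norm x = real CARD('p) powi k"
proof -
  obtain q where q: "padic_norm (x - padic_of_rat q) < padic_norm x"
    using padic_rational_approx[of "padic_norm x" x] assms by auto
  hence "padic_abs CARD('p) q = padic_norm x"
    using padic_norm_eqI[OF q] by (simp add: padic_norm_of_rat)
  moreover have "padic_norm x \<noteq> 0" using assms by simp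
  ultimately show ?thesis using that unfolding padic_abs_def by (metis (full_types))
qed

lemma powi_le_iff:
  assumes "(x :: real) > 1"
  shows "x powi a \<le> x powi b \<longleftrightarrow> a \<le> b"
  using assms power_int_strict_increasing[of b a x] power_int_increasing[of a b x]
  by (cases "a \<le> b") (auto simp: not_le)

lemma padic_norm_power: "padic_norm (x ^ n :: 'p::prime_card padic) = padic_norm x ^ n"
  by (induction n) (auto simp: padic_norm_mult)

lemma padic_norm_powi: "padic_norm (x powi k :: 'p::prime_card padic) = padic_norm x powi k"
  by (cases k) (auto simp: power_int_def padic_norm_power padic_norm_inverse)

lemma padic_norm_prime_powi:
  "padic_norm (of_nat CARD('p) powi k :: 'p::prime_card padic) = real CARD('p) powi (- k)"
  unfolding padic_norm_powi padic_norm_prime using card_prime_gt_1[where 'p='p]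
  by (simp add: power_int_minus power_int_divide_distrib field_simps)

lemma padic_of_nat: "of_nat n = (padic_of_rat (of_nat n) :: 'p::prime_card padic)"
proof (induction n)
  case 0
  show ?case by simp (transfer, simp add: padic_rel_def)
next
  case (Suc n)
  show ?case unfolding of_nat_Suc Suc by transfer (simp add: padic_rel_def)
qed

lemma padic_of_int: "of_int n = (padic_of_rat (of_int n) :: 'p::prime_card padic)"
proof (cases n rule: int_cases2)
  case (nonneg m)
  thus ?thesis using padic_of_nat[of m, where 'p='p] by simp
next
  case (nonpos m)
  have "padic_of_rat (- q) = - (padic_of_rat q :: 'p padic)" for q
    by transfer (simp add: padic_rel_def)
  thus ?thesis using nonpos padic_of_nat[of m, where 'p='p] by simp
qed

text \<open>Turns membership of integers in balls into congruences modulo p^k, the form in which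
  digits can be handled.\<close>

lemma padic_norm_of_int_le_iff:
  "padic_norm (of_int m :: 'p::prime_card padic) \<le> real CARD('p) powi (- int k)
     \<longleftrightarrow> int CARD('p) ^ k dvd m"
proof (cases "m = 0")
  case False
  have p: "\<not> is_unit (int CARD('p))" using prime_card[where 'a='p] by auto
  have "padic_norm (of_int m :: 'p padic) = real CARD('p) powi (- int (multiplicity (int CARD('p)) m))"
    using padic_abs_fraction[OF prime_card[where 'a='p] False, of 1]
    by (simp add: padic_of_int padic_norm_of_rat)
  also have "\<dots> \<le> real CARD('p) powi (- int k) \<longleftrightarrow> k \<le> multiplicity (int CARD('p)) m"
    using card_prime_gt_1[where 'p='p] by (subst powi_le_iff) auto
  also have "\<dots> \<longleftrightarrow> int CARD('p) ^ k dvd m"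
    using False p by (auto simp: power_dvd_iff_le_multiplicity)
  finally show ?thesis .
qed auto

lemma padic_ints_0 [simp]: "0 \<in> padic_ints"
  and padic_ints_1 [simp]: "1 \<in> padic_ints"
  and padic_ints_uminus [simp]: "- x \<in> padic_ints \<longleftrightarrow> x \<in> padic_ints"
  by (auto simp: padic_ints_def)

lemma padic_ints_add: "x \<in> padic_ints \<Longrightarrow> y \<in> padic_ints \<Longrightarrow> x + y \<in> padic_ints"
  using padic_norm_ultrametric[of x y] by (auto simp: padic_ints_def)

lemma padic_ints_mult: "x \<in> padic_ints \<Longrightarrow> y \<in> padic_ints \<Longrightarrow> x * y \<in> padic_ints"
  by (auto simp: padic_ints_def padic_norm_mult mult_le_one)

lemma padic_ints_sum: "(\<And>a. a \<in> A \<Longrightarrow> f a \<in> padic_ints) \<Longrightarrow> sum f A \<in> padic_ints"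
  using padic_norm_sum_le[of A f 1] by (auto simp: padic_ints_def)

lemma padic_ints_of_int [simp]: "of_int m \<in> (padic_ints :: 'p::prime_card padic set)"
  using padic_norm_of_int_le_iff[of m 0, where 'p='p] by (auto simp: padic_ints_def)

text \<open>An approximating rational has norm at most 1, so in lowest terms its denominator is
  prime to p and can be inverted modulo p^k.\<close>

lemma padic_ints_approx:
  assumes "x \<in> padic_ints"
  obtains m where "0 \<le> m" "m < int CARD('p) ^ k"
    "padic_norm (x - of_int m :: 'p::prime_card padic) \<le> real CARD('p) powi (- int k)"
proof -
  let ?p = "int CARD('p)" and ?e = "real CARD('p) powi (- int k)"
  have p1: "real CARD('p) > 1" by (rule card_prime_gt_1)
  have pe: "prime_elem ?p" using prime_card[where 'a='p] by simp
  have e0: "?e > 0" "?e \<le> 1" using p1 by (auto simp: power_int_minus field_simps)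
  obtain q where q: "padic_norm (x - padic_of_rat q) < ?e" using padic_rational_approx e0(1) by blast
  have "padic_norm (padic_of_rat q :: 'p padic) \<le> 1"
    using padic_norm_diff_ultrametric[of x "x - padic_of_rat q"] q e0 assms by (auto simp: padic_ints_def)
  hence q1: "padic_abs CARD('p) q \<le> 1" by (simp add: padic_norm_of_rat)
  obtain a b where ab: "quotient_of q = (a, b)" by (cases "quotient_of q")
  have b: "b > 0" and qab: "q = of_int a / of_int b" and cop: "coprime a b"
    using quotient_of_denom_pos[OF ab] quotient_of_div[OF ab] quotient_of_coprime[OF ab] by auto
  have "\<not> ?p dvd b"
  proof
    assume pb: "?p dvd b"
    hence pa: "\<not> ?p dvd a" using cop pe by (meson coprime_common_divisor prime_elem_not_unit)
    hence a0: "a \<noteq> 0" by auto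
    have "multiplicity ?p a = 0" using pa by (rule not_dvd_imp_multiplicity_0)
    moreover have "multiplicity ?p b > 0"
      using pb b pe by (intro multiplicity_gt_zero_iff[THEN iffD2]) (auto simp: prime_elem_not_unit)
    ultimately have "padic_abs CARD('p) q > 1"
      using a0 b padic_abs_fraction[OF prime_card[where 'a='p] a0, of b] p1
      by (simp add: qab power_int_def one_less_power)
    thus False using q1 by simp
  qed
  hence "coprime b (?p ^ k)" using pe by (metis coprime_commute coprime_power_right_iff prime_elem_imp_coprime)
  then obtain b' where b': "[b * b' = 1] (mod (?p ^ k))" using cong_solve_coprime_int by blast
  \<comment> \<open>The residue of a / b modulo p^k, with b' in the role of the inverse of
    b.\<close>
  define m where "m = (a * b') mod (?p ^ k)"
  have m: "0 \<le> m" "m < ?p ^ k" using p1 by (auto simp: m_def)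
  have "[b * m = b * (a * b')] (mod (?p ^ k))"
    unfolding m_def by (intro cong_scalar_left) (simp add: cong_def)
  also have "b * (a * b') = a * (b * b')" by simp
  also have "[a * (b * b') = a * 1] (mod (?p ^ k))" using b' by (rule cong_scalar_left)
  finally have "?p ^ k dvd a - b * m" by (simp add: cong_iff_dvd_diff dvd_diff_commute)
  hence "padic_norm (of_int (a - b * m) :: 'p padic) \<le> ?e" by (subst padic_norm_of_int_le_iff)
  moreover have "padic_norm (of_int b :: 'p padic) = 1"
    using padic_norm_of_int_le_iff[of b 1, where 'p='p] \<open>\<not> ?p dvd b\<close> padic_ints_of_int[of b, where 'p='p]
  proof -
    have b0: "(of_int b :: 'p padic) \<noteq> 0" using \<open>\<not> ?p dvd b\<close> 
      padic_norm_of_int_le_iff[of b 1, where 'p='p] p1 by auto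
    obtain l where l: "padic_norm (of_int b :: 'p padic) = real CARD('p) powi l"
      using padic_norm_value[OF b0] by blast
    \<comment> \<open>Norms are powers of p, so the bounds |b| \<le> 1 and not |b| \<le> 1/p leave
      only the exponent 0.\<close>
    have "\<not> l \<le> -1" using padic_norm_of_int_le_iff[of b 1, where 'p='p] \<open>\<not> ?p dvd b\<close> l
        powi_le_iff[OF p1, of l "-1"] by auto
    moreover have "l \<le> 0" 
      using padic_norm_of_int_le_iff[of b 0, where 'p='p] l p1 powi_le_iff[of "real CARD('p)" l 0]
      by auto
    ultimately have "l = 0" by linarith
    thus ?thesis using l by simp
  qed
  moreover have "padic_of_rat q = (of_int a / of_int b :: 'p padic)"
  proof -
    have "padic_of_rat (u * v) = (padic_of_rat u * padic_of_rat v :: 'p padic)" for u v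
      by transfer (simp add: padic_rel_def)
    hence "padic_of_rat (q * of_int b) = (padic_of_rat q * of_int b :: 'p padic)" by (simp add: padic_of_int)
    moreover have "q * of_int b = of_int a" using b by (simp add: qab)
    moreover have "(of_int b :: 'p padic) \<noteq> 0" using \<open>padic_norm (of_int b :: 'p padic) = 1\<close> by auto
    ultimately show ?thesis by (simp add: padic_of_int field_simps)
  qed
  ultimately have "padic_norm (padic_of_rat q - of_int m :: 'p padic) \<le> ?e"
  proof -
    assume 1: "padic_norm (of_int (a - b * m) :: 'p padic) \<le> ?e" "padic_norm (of_int b :: 'p padic) = 1"
      "padic_of_rat q = (of_int a / of_int b :: 'p padic)"
    have "(of_int b :: 'p padic) \<noteq> 0" using 1(2) by auto
    hence "(padic_of_rat q - of_int m :: 'p padic) = of_int (a - b * m) / of_int b"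
      by (simp add: 1(3) field_simps)
    thus ?thesis using 1 by (simp add: padic_norm_divide)
  qed
  hence "padic_norm (x - of_int m) \<le> ?e"
    using padic_norm_ultrametric[of "x - padic_of_rat q" "padic_of_rat q - of_int m"] q by auto
  thus ?thesis using m that by blast
qed

section \<open>Ultrametric balls, topology and Borel sets\<close>

lemma dist_padic: "dist x y = padic_norm (x - y)"
  by (simp add: dist_padic_def)

lemma padic_ints_eq_cball: "padic_ints = cball (0 :: 'p::prime_card padic) 1"
  by (auto simp: padic_ints_def dist_padic)

text \<open>Every point of an ultrametric ball is a centre of it. Balls are open for this reason,
  and intersecting balls are nested.\<close>

lemma cball_padic_eq:
  assumes "y \<in> cball (x :: 'p::prime_card padic) r"
  shows "cball y r = cball x r"
proof -
  have "padic_norm (x - z) \<le> r" if "padic_norm (y - z) \<le> r" "padic_norm (x - y) \<le> r" for x y z :: "'p padic"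
    using padic_norm_ultrametric[of "x - y" "y - z"] that by auto
  thus ?thesis using assms by (auto simp: dist_padic padic_norm_minus_commute[of y x])
qed

lemma cball_padic_Int:
  assumes "r \<le> s" "cball (x :: 'p::prime_card padic) r \<inter> cball y s \<noteq> {}"
  shows "cball x r \<subseteq> cball y s"
proof -
  obtain z where z: "z \<in> cball x r" "z \<in> cball y s" using assms(2) by blast
  have "cball z r \<subseteq> cball z s" using assms(1) by auto
  thus ?thesis using cball_padic_eq[OF z(1)] cball_padic_eq[OF z(2)] by simp
qed

text \<open>Balls around rational points suffice, hence there are countably many balls of radius \<open>p\<^sup>-\<^sup>k\<close>.\<close>

lemma countable_padic_cballs: "countable (\<Union>k :: nat. range (\<lambda>x :: 'p::prime_card padic. cball x (real CARD('p) powi (- int k))))"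
proof -
  have "range (\<lambda>x :: 'p padic. cball x (real CARD('p) powi (- int k)))
      \<subseteq> range (\<lambda>q. cball (padic_of_rat q) (real CARD('p) powi (- int k)))" for k
  proof
    fix c assume "c \<in> range (\<lambda>x :: 'p padic. cball x (real CARD('p) powi (- int k)))"
    then obtain x :: "'p padic" where c: "c = cball x (real CARD('p) powi (- int k))" by blast
    have "real CARD('p) powi (- int k) > 0" using card_prime_gt_1[where 'p='p] by (simp add: zero_less_power_int)
    then obtain q where "padic_norm (x - padic_of_rat q) < real CARD('p) powi (- int k)"
      using padic_rational_approx by blast
    hence "padic_of_rat q \<in> cball x (real CARD('p) powi (- int k))" by (simp add: dist_padic)
    from cball_padic_eq[OF this] show "c \<in> range (\<lambda>q. cball (padic_of_rat q) (real CARD('p) powi (- int k)))"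
      using c by blast
  qed
  moreover have "countable (range (\<lambda>q. cball (padic_of_rat q :: 'p padic) (real CARD('p) powi (- int k))))" for k
    by simp
  ultimately show ?thesis by (meson countable_UN countable_subset uncountable_def countableI_type)
qed

abbreviation pball :: "'p::prime_card padic \<Rightarrow> nat \<Rightarrow> 'p padic set" where
  "pball x k \<equiv> cball x (real CARD('p) powi (- int k))"

lemma pball_radius_pos: "real CARD('p::prime_card) powi k > 0"
  using card_prime_gt_1[where 'p='p] by (simp add: zero_less_power_int)

lemma pball_radius_small:
  assumes "e > 0"
  obtains k where "k \<ge> (K :: nat)" "real CARD('p::prime_card) powi (- int k) < e"
proof -
  have "(\<lambda>k. inverse (real CARD('p)) ^ k) \<longlonglongrightarrow> 0"
    using card_prime_gt_1[where 'p='p] by (intro LIMSEQ_realpow_zero) (auto simp: field_simps)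
  hence "eventually (\<lambda>k. inverse (real CARD('p)) ^ k < e) sequentially"
    using assms by (rule order_tendstoD(2))
  hence "eventually (\<lambda>k. k \<ge> K \<and> inverse (real CARD('p)) ^ k < e) sequentially"
    using eventually_ge_at_top[of K] by eventually_elim auto
  then obtain k where "k \<ge> K" "inverse (real CARD('p)) ^ k < e"
    by (auto simp: eventually_sequentially)
  thus ?thesis using that by (auto simp: power_int_minus power_inverse)
qed

lemma open_cball_padic:
  assumes "r > 0"
  shows "open (cball (x :: 'p::prime_card padic) r)"
  unfolding open_contains_cball using assms cball_padic_eq[of _ x r] by blast

text \<open>The exponent k is a natural number, so all these balls have radius at most 1. The bound
  K allows further shrinking where the preimage of a ball would otherwise get a radius above
  1.\<close>

definition pballs_from :: "nat \<Rightarrow> 'p::prime_card padic set set" where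
  "pballs_from K = (\<Union>k\<in>{K..}. range (\<lambda>x. pball x k))"

lemma countable_pballs_from: "countable (pballs_from K)"
  by (rule countable_subset[OF _ countable_padic_cballs]) (auto simp: pballs_from_def)

lemma topological_basis_pballs_from: "topological_basis (pballs_from K :: 'p::prime_card padic set set)"
proof (rule topological_basisI)
  fix O' :: "'p padic set" and x assume "open O'" "x \<in> O'"
  then obtain e where e: "e > 0" "cball x e \<subseteq> O'" by (auto simp: open_contains_cball)
  obtain k where k: "k \<ge> K" "real CARD('p) powi (- int k) < e"
    using pball_radius_small[OF e(1), of K, where 'p='p] by blast
  have "pball x k \<subseteq> cball x e" using k by auto
  moreover have "x \<in> pball x k" using pball_radius_pos[of "- int k", where 'p='p] by simp
  ultimately show "\<exists>B'\<in>pballs_from K. x \<in> B' \<and> B' \<subseteq> O'"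
    using k e by (intro bexI[of _ "pball x k"]) (auto simp: pballs_from_def)
qed (auto simp: pballs_from_def intro!: open_cball_padic pball_radius_pos)

text \<open>Second countability makes the Borel sets of a product those generated by rectangles;
  measurability of sums and products of p-adic functions relies on it.\<close>

instance padic :: (prime_card) second_countable_topology
proof
  show "\<exists>B :: 'a padic set set. countable B \<and> open = generate_topology B"
    using topological_basis_imp_subbasis[OF topological_basis_pballs_from[of 0]] countable_pballs_from[of 0]
    by blast
qed

instance padic :: (prime_card) topological_comm_monoid_add
proof
  fix a b :: "'a padic"
  show "LIM x (nhds a \<times>\<^sub>F nhds b). fst x + snd x :> nhds (a + b)"
    unfolding tendsto_iff
  proof (intro allI impI)
    fix e :: real assume e: "e > 0"
    have 1: "eventually (\<lambda>x. dist x a < e) (nhds a)" "eventually (\<lambda>x. dist x b < e) (nhds b)"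
      using e by (auto simp: eventually_nhds_metric)
    have "dist (fst x + snd x) (a + b) < e" if "dist (fst x) a < e" "dist (snd x) b < e" for x
      using padic_norm_ultrametric[of "fst x - a" "snd x - b"] that
      by (simp add: dist_padic algebra_simps)
    thus "\<forall>\<^sub>F x in nhds a \<times>\<^sub>F nhds b. dist (fst x + snd x) (a + b) < e"
      using 1 unfolding eventually_prod_filter
      by (intro exI[of _ "\<lambda>x. dist x a < e"] exI[of _ "\<lambda>x. dist x b < e"]) auto
  qed
qed

lemma continuous_on_padic_norm: "continuous_on UNIV (padic_norm :: 'p::prime_card padic \<Rightarrow> real)"
proof -
  have "continuous_on UNIV (\<lambda>x :: 'p padic. dist x 0)" by (intro continuous_intros)
  thus ?thesis by (simp add: dist_padic)
qed

lemma padic_tendsto_iff: "(f \<longlongrightarrow> (l :: 'p::prime_card padic)) F \<longleftrightarrow> ((\<lambda>x. padic_norm (f x - l)) \<longlongrightarrow> 0) F"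
  by (subst tendsto_dist_iff) (simp add: dist_padic)

lemma continuous_on_padic_mult:
  "continuous_on UNIV (\<lambda>x :: 'p::prime_card padic \<times> 'p padic. fst x * snd x)"
  unfolding continuous_on_def
proof
  fix x :: "'p padic \<times> 'p padic"
  obtain a b where x: "x = (a, b)" by (cases x)
  have f: "((\<lambda>y. fst y) \<longlongrightarrow> a) (at x)" "((\<lambda>y. snd y) \<longlongrightarrow> b) (at x)"
    using tendsto_fst[OF tendsto_ident_at[of x UNIV]] tendsto_snd[OF tendsto_ident_at[of x UNIV]] x by auto
  have n: "((\<lambda>y. padic_norm (fst y)) \<longlongrightarrow> padic_norm a) (at x)"
    using continuous_on_tendsto_compose[OF continuous_on_padic_norm f(1)] by auto
  have lim: "((\<lambda>y. padic_norm (fst y) * padic_norm (snd y - b) + padic_norm (fst y - a) * padic_norm b)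
          \<longlongrightarrow> padic_norm a * 0 + 0 * padic_norm b) (at x)"
    by (intro tendsto_add tendsto_mult tendsto_const n f[THEN padic_tendsto_iff[THEN iffD1]])
  have le: "padic_norm (fst y * snd y - a * b)
      \<le> padic_norm (fst y) * padic_norm (snd y - b) + padic_norm (fst y - a) * padic_norm b"
    for y :: "'p padic \<times> 'p padic"
  proof -
    have "fst y * snd y - a * b = fst y * (snd y - b) + (fst y - a) * b" by (simp add: algebra_simps)
    also have "padic_norm \<dots> \<le> max (padic_norm (fst y * (snd y - b))) (padic_norm ((fst y - a) * b))"
      by (rule padic_norm_ultrametric)
    also have "\<dots> \<le> padic_norm (fst y * (snd y - b)) + padic_norm ((fst y - a) * b)"
      by (simp add: max_def)
    finally show ?thesis by (simp add: padic_norm_mult)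
  qed
  have "((\<lambda>y. padic_norm (fst y * snd y - a * b)) \<longlongrightarrow> 0) (at x)"
    by (rule Lim_null_comparison[OF always_eventually lim[simplified]]) (use le in simp)
  thus "((\<lambda>x. fst x * snd x) \<longlongrightarrow> fst x * snd x) (at x)"
    unfolding padic_tendsto_iff[of "\<lambda>x. fst x * snd x"] x by simp
qed

lemma continuous_on_padic_inverse:
  "continuous_on (- {0}) (inverse :: 'p::prime_card padic \<Rightarrow> 'p padic)"
  unfolding continuous_on_def
proof
  fix x :: "'p padic" assume x: "x \<in> - {0}"
  have id: "((\<lambda>y. y) \<longlongrightarrow> x) (at x within - {0})" by (rule tendsto_ident_at)
  have "((\<lambda>y. padic_norm (y - x) * inverse (padic_norm y) * inverse (padic_norm x))
      \<longlongrightarrow> 0 * inverse (padic_norm x) * inverse (padic_norm x)) (at x within - {0})"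
    using x by (intro tendsto_intros id[THEN padic_tendsto_iff[THEN iffD1]]
        continuous_on_tendsto_compose[OF continuous_on_padic_norm id]) auto
  moreover have "eventually (\<lambda>y. padic_norm (y - x) * inverse (padic_norm y) * inverse (padic_norm x)
      = padic_norm (inverse y - inverse x)) (at x within - {0})"
    unfolding eventually_at_filter
  proof (rule always_eventually, intro allI impI)
    fix y :: "'p padic" assume "y \<in> - {0}"
    hence "inverse y - inverse x = - ((y - x) * inverse y * inverse x)"
      using x by (simp add: field_simps)
    thus "padic_norm (y - x) * inverse (padic_norm y) * inverse (padic_norm x)
      = padic_norm (inverse y - inverse x)"
      by (simp add: padic_norm_mult padic_norm_inverse)
  qed
  ultimately show "(inverse \<longlongrightarrow> inverse x) (at x within - {0})"
    unfolding padic_tendsto_iff mult_zero_left by (rule Lim_transform_eventually)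
qed

lemma padic_norm_measurable [measurable]: "padic_norm \<in> borel_measurable (borel :: 'p::prime_card padic measure)"
  by (rule borel_measurable_continuous_onI[OF continuous_on_padic_norm])

lemma padic_times_measurable [measurable (raw)]:
  fixes f g :: "'a \<Rightarrow> 'p::prime_card padic"
  shows "f \<in> borel_measurable M \<Longrightarrow> g \<in> borel_measurable M \<Longrightarrow> (\<lambda>x. f x * g x) \<in> borel_measurable M"
  by (rule borel_measurable_continuous_Pair[OF _ _ continuous_on_padic_mult])

lemma padic_uminus_measurable [measurable (raw)]:
  fixes f :: "'a \<Rightarrow> 'p::prime_card padic"
  shows "f \<in> borel_measurable M \<Longrightarrow> (\<lambda>x. - f x) \<in> borel_measurable M"
  using padic_times_measurable[of "\<lambda>_. -1" M f] by simp

lemma padic_prod_measurable [measurable (raw)]: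
  fixes f :: "'b \<Rightarrow> 'a \<Rightarrow> 'p::prime_card padic"
  assumes "\<And>i. i \<in> I \<Longrightarrow> f i \<in> borel_measurable M"
  shows "(\<lambda>x. \<Prod>i\<in>I. f i x) \<in> borel_measurable M"
  using assms by (induction I rule: infinite_finite_induct) (simp_all add: padic_times_measurable)

lemma padic_inverse_measurable [measurable (raw)]:
  fixes f :: "'a \<Rightarrow> 'p::prime_card padic"
  shows "f \<in> borel_measurable M \<Longrightarrow> (\<lambda>x. inverse (f x)) \<in> borel_measurable M"
  by (rule measurable_compose[OF _ borel_measurable_continuous_countable_exceptions[OF _ continuous_on_padic_inverse]])
     simp_all

lemma borel_padic_eq: "borel = sigma UNIV (pballs_from K :: 'p::prime_card padic set set)"
  by (rule borel_eq_countable_basis[OF countable_pballs_from topological_basis_pballs_from])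

text \<open>Two balls are nested or disjoint.\<close>

lemma Int_stable_pballs: "Int_stable (insert {} (pballs_from K :: 'p::prime_card padic set set))"
proof (rule Int_stableI)
  have *: "cball x r \<inter> cball y s \<in> {{}, cball x r, cball y s}" for x y :: "'p padic" and r s
    using cball_padic_Int[of r s x y] cball_padic_Int[of s r y x] by (cases "r \<le> s") auto
  fix a b :: "'p padic set" assume "a \<in> insert {} (pballs_from K)" "b \<in> insert {} (pballs_from K)"
  moreover have "a \<inter> b \<in> {{}, a, b}"
  proof (cases "a = {} \<or> b = {}")
    case False
    then obtain x y k l where "a = pball x k" "b = pball y l"
      using calculation by (auto simp: pballs_from_def)
    thus ?thesis using * by simp
  qed auto
  ultimately show "a \<inter> b \<in> insert {} (pballs_from K)" by auto
qed

lemma sigma_sets_insert_empty: "sigma_sets A (insert {} E) = sigma_sets A E"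
  by (rule sigma_sets_eqI) (auto intro: sigma_sets.Empty sigma_sets.Basic)

text \<open>Together with the empty set the balls form an intersection-stable generator, and
  countably many of them, all of finite measure, cover the space.\<close>

lemma padic_measure_eqI:
  fixes M N :: "'p::prime_card padic measure"
  assumes M: "sets M = sets borel" and N: "sets N = sets borel"
    and eq: "\<And>x k. k \<ge> K \<Longrightarrow> emeasure M (pball x k) = emeasure N (pball x k)"
    and fin: "\<And>x k. k \<ge> K \<Longrightarrow> emeasure M (pball x k) \<noteq> \<infinity>"
  shows "M = N"
proof (rule measure_eqI_generator_eq_countable)
  show "Int_stable (insert {} (pballs_from K :: 'p padic set set))" by (rule Int_stable_pballs)
  show "sets M = sigma_sets UNIV (insert {} (pballs_from K))" "sets N = sigma_sets UNIV (insert {} (pballs_from K))"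
    unfolding sigma_sets_insert_empty M N by (simp_all add: borel_padic_eq[of K])
  show "countable (pballs_from K :: 'p padic set set)" by (rule countable_pballs_from)
  have "x \<in> \<Union> (pballs_from K)" for x :: "'p padic"
    using pball_radius_pos[of "- int K", where 'p='p] by (auto simp: pballs_from_def intro!: bexI[of _ K] exI[of _ x])
  thus "\<Union> (pballs_from K) = (UNIV :: 'p padic set)" by blast
  show "emeasure M X = emeasure N X" if "X \<in> insert {} (pballs_from K)" for X
    using that eq by (auto simp: pballs_from_def)
  show "emeasure M X \<noteq> \<infinity>" if "X \<in> pballs_from K" for X
    using that fin by (auto simp: pballs_from_def)
qed auto

section \<open>Haar measure on the p-adic numbers\<close>

text \<open>The uniform distribution on the p-adic integers is that of a sequence of independent digits.\<close>

definition digit_measure :: "'p::prime_card itself \<Rightarrow> (nat \<Rightarrow> nat) measure" where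
  "digit_measure _ = (\<Pi>\<^sub>M i\<in>UNIV. uniform_count_measure {..<CARD('p)})"

definition digit_sum :: "'p::prime_card itself \<Rightarrow> (nat \<Rightarrow> nat) \<Rightarrow> nat \<Rightarrow> nat" where
  "digit_sum _ d k = (\<Sum>i<k. d i * CARD('p) ^ i)"

definition of_digits :: "(nat \<Rightarrow> nat) \<Rightarrow> 'p::prime_card padic" where
  "of_digits d = padic_of (\<lambda>n. of_nat (digit_sum TYPE('p) d n))"

lemma digit_sum_diff:
  assumes "k \<le> m"
  shows "padic_abs CARD('p) (of_nat (digit_sum TYPE('p::prime_card) d m) - of_nat (digit_sum TYPE('p) d k))
           \<le> real CARD('p) powi (- int k)"
proof -
  have "digit_sum TYPE('p) d m = digit_sum TYPE('p) d k + (\<Sum>i\<in>{k..<m}. d i * CARD('p) ^ i)"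
    using assms by (simp add: digit_sum_def lessThan_atLeast0 sum.atLeastLessThan_concat)
  moreover have "CARD('p) ^ k dvd (\<Sum>i\<in>{k..<m}. d i * CARD('p) ^ i)"
    by (intro dvd_sum dvd_mult) (simp add: le_imp_power_dvd)
  then obtain c where "(\<Sum>i\<in>{k..<m}. d i * CARD('p) ^ i) = CARD('p) ^ k * c" by blast
  ultimately have "(of_nat (digit_sum TYPE('p) d m) - of_nat (digit_sum TYPE('p) d k) :: rat)
      = of_int (int CARD('p) ^ k * int c)" by simp
  moreover have "padic_abs CARD('p) (of_int (int CARD('p) ^ k * int c)) \<le> real CARD('p) powi (- int k)"
    using padic_norm_of_int_le_iff[of "int CARD('p) ^ k * int c" k, where 'p='p]
    unfolding padic_of_int padic_norm_of_rat by simp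
  ultimately show ?thesis by simp
qed

lemma digit_sum_cauchy: "padic_cauchy CARD('p) (\<lambda>n. of_nat (digit_sum TYPE('p::prime_card) d n))"
  unfolding padic_cauchy_def
proof (intro allI impI)
  fix e :: real assume "e > 0"
  then obtain k where k: "real CARD('p) powi (- int k) < e" using pball_radius_small by blast
  have "padic_abs CARD('p) (of_nat (digit_sum TYPE('p) d m) - of_nat (digit_sum TYPE('p) d n)) < e"
    if "m \<ge> k" "n \<ge> k" for m n
  proof -
    let ?s = "\<lambda>n. of_nat (digit_sum TYPE('p) d n) :: rat"
    have "padic_abs CARD('p) (?s m - ?s n) = padic_abs CARD('p) ((?s m - ?s k) + (?s k - ?s n))" by simp
    also have "\<dots> \<le> max (padic_abs CARD('p) (?s m - ?s k)) (padic_abs CARD('p) (?s k - ?s n))"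
      by (rule padic_abs_ultrametric[OF prime_card])
    also have "\<dots> < e"
      using digit_sum_diff[OF that(1), of d, where 'p='p] digit_sum_diff[OF that(2), of d, where 'p='p] k
      by (simp add: padic_abs_minus_commute[OF prime_card, of "?s k"])
    finally show ?thesis .
  qed
  thus "\<exists>N. \<forall>m\<ge>N. \<forall>n\<ge>N. padic_abs CARD('p)
      (of_nat (digit_sum TYPE('p) d m) - of_nat (digit_sum TYPE('p) d n)) < e" by blast
qed

lemma of_digits_approx:
  "padic_norm (of_digits d - of_nat (digit_sum TYPE('p::prime_card) d k) :: 'p padic) \<le> real CARD('p) powi (- int k)"
proof -
  let ?s = "\<lambda>n. of_nat (digit_sum TYPE('p) d n) :: rat"
  have c: "padic_cauchy CARD('p) ?s" "padic_cauchy CARD('p) (\<lambda>n. ?s n + - ?s k)"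
    using digit_sum_cauchy[of d, where 'p='p] padic_cauchy_add[OF prime_card digit_sum_cauchy[of d, where 'p='p] padic_cauchy_const[of "CARD('p)" "- ?s k"]] by auto
  have "of_digits d - of_nat (digit_sum TYPE('p) d k) = (padic_of (\<lambda>n. ?s n + - ?s k) :: 'p padic)"
    unfolding of_digits_def minus_padic_def padic_of_nat padic_of_rat.abs_eq
    using c(1) by (simp add: plus_padic.abs_eq uminus_padic.abs_eq eq_onp_def padic_rel_def)
  hence "padic_norm (of_digits d - of_nat (digit_sum TYPE('p) d k) :: 'p padic)
      = lim (\<lambda>n. padic_abs CARD('p) (?s n + - ?s k))"
    using c(2) by (simp add: padic_norm.abs_eq padic_rel_def)
  also have "\<dots> \<le> real CARD('p) powi (- int k)"
    by (rule LIMSEQ_le_const2[OF padic_norm_tendsto[OF c(2)]])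
       (use digit_sum_diff[of k _ d, where 'p='p] in auto)
  finally show ?thesis .
qed

lemma digit_sum_less:
  assumes "\<And>i. i < k \<Longrightarrow> d i < CARD('p::prime_card)"
  shows "digit_sum TYPE('p) d k < CARD('p) ^ k"
  using assms
proof (induction k)
  case (Suc k)
  have "d k + 1 \<le> CARD('p)" using Suc.prems[of k] by simp
  hence "(d k + 1) * CARD('p) ^ k \<le> CARD('p) * CARD('p) ^ k" by (rule mult_right_mono) simp
  thus ?case using Suc by (simp add: digit_sum_def)
qed (simp add: digit_sum_def)

text \<open>Existence and uniqueness of base p expansions of length k. The digits e are chosen
  before d, since the event that the partial sum equals a has to become a cylinder set with fixed
  first k coordinates.\<close>

lemma digit_sum_eq_iff:
  assumes "a < CARD('p::prime_card) ^ k"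
  shows "\<exists>e. (\<forall>i<k. e i < CARD('p)) \<and>
           (\<forall>d. (\<forall>i<k. d i < CARD('p)) \<longrightarrow> (digit_sum TYPE('p) d k = a \<longleftrightarrow> (\<forall>i<k. d i = e i)))"
  using assms
proof (induction k arbitrary: a)
  case 0
  thus ?case by (simp add: digit_sum_def)
next
  case (Suc k)
  let ?q = "CARD('p) ^ k"
  have q: "?q > 0" by simp
  obtain e where e: "\<forall>i<k. e i < CARD('p)"
    "\<And>d. (\<forall>i<k. d i < CARD('p)) \<Longrightarrow> digit_sum TYPE('p) d k = a mod ?q \<longleftrightarrow> (\<forall>i<k. d i = e i)"
    using Suc.IH[OF mod_less_divisor[OF q, of a]] by blast
  \<comment> \<open>The lower digits expand the remainder of a modulo p^k, and the quotient is the
    leading digit.\<close>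
  define e' where "e' = e(k := a div ?q)"
  have "a div ?q < CARD('p)" using Suc.prems by (simp add: less_mult_imp_div_less)
  hence "\<forall>i<Suc k. e' i < CARD('p)" using e(1) by (simp add: All_less_Suc e'_def)
  moreover have "digit_sum TYPE('p) d (Suc k) = a \<longleftrightarrow> (\<forall>i<Suc k. d i = e' i)"
    if d: "\<forall>i<Suc k. d i < CARD('p)" for d
  proof -
    have s: "digit_sum TYPE('p) d (Suc k) = digit_sum TYPE('p) d k + d k * ?q" by (simp add: digit_sum_def)
    have l: "digit_sum TYPE('p) d k < ?q" using d by (intro digit_sum_less) simp
    have "digit_sum TYPE('p) d (Suc k) = a \<longleftrightarrow> digit_sum TYPE('p) d k = a mod ?q \<and> d k = a div ?q"
    proof
      assume "digit_sum TYPE('p) d (Suc k) = a"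
      hence "a = digit_sum TYPE('p) d k + d k * ?q" using s by simp
      thus "digit_sum TYPE('p) d k = a mod ?q \<and> d k = a div ?q" using l by simp
    next
      assume "digit_sum TYPE('p) d k = a mod ?q \<and> d k = a div ?q"
      thus "digit_sum TYPE('p) d (Suc k) = a" using s by (simp only: mod_mult_div_eq mod_div_mult_eq)
    qed
    also have "\<dots> \<longleftrightarrow> (\<forall>i<Suc k. d i = e' i)"
      using e(2)[of d] d by (simp add: All_less_Suc e'_def conj_commute)
    finally show ?thesis .
  qed
  ultimately show ?case by (intro exI[of _ e'] conjI) simp_all
qed

text \<open>The event prescribes k independent digits, each of probability 1/p.\<close>

lemma emeasure_digit_sum:
  assumes "a < CARD('p::prime_card) ^ k"
  defines "A \<equiv> {d \<in> space (digit_measure TYPE('p)). digit_sum TYPE('p) d k = a}"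
  shows "A \<in> sets (digit_measure TYPE('p))"
    and "emeasure (digit_measure TYPE('p)) A = ennreal (real CARD('p) powi (- int k))"
proof -
  let ?U = "uniform_count_measure {..<CARD('p)}"
  have p0: "{..<CARD('p)} \<noteq> {}" using card_prime_gt_1[where 'p='p] by (auto simp: lessThan_empty_iff)
  interpret U: prob_space ?U by (rule prob_space_uniform_count_measure) (use p0 in auto)
  have "\<exists>e. (\<forall>i<k. e i < CARD('p)) \<and>
      (\<forall>d. (\<forall>i<k. d i < CARD('p)) \<longrightarrow> (digit_sum TYPE('p) d k = a \<longleftrightarrow> (\<forall>i<k. d i = e i)))"
    by (rule digit_sum_eq_iff[OF assms(1)])
  then obtain e where "(\<forall>i<k. e i < CARD('p)) \<and>
      (\<forall>d. (\<forall>i<k. d i < CARD('p)) \<longrightarrow> (digit_sum TYPE('p) d k = a \<longleftrightarrow> (\<forall>i<k. d i = e i)))"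
    by (rule exE)
  note e = conjunct1[OF this] conjunct2[OF this]
  have A: "A = prod_emb UNIV (\<lambda>_. ?U) {..<k} (\<Pi>\<^sub>E i\<in>{..<k}. {e i})"
  proof (rule Set.set_eqI)
    fix d
    have "d \<in> A \<longleftrightarrow> (\<forall>i. d i < CARD('p)) \<and> digit_sum TYPE('p) d k = a"
      by (simp add: A_def digit_measure_def space_PiM PiE_iff space_uniform_count_measure)
    also have "\<dots> \<longleftrightarrow> (\<forall>i. d i < CARD('p)) \<and> (\<forall>i<k. d i = e i)"
    proof (rule conj_cong[OF refl])
      assume "\<forall>i. d i < CARD('p)"
      thus "digit_sum TYPE('p) d k = a \<longleftrightarrow> (\<forall>i<k. d i = e i)" using e(2)[rule_format, of d] by simp
    qed
    also have "\<dots> \<longleftrightarrow> d \<in> prod_emb UNIV (\<lambda>_. ?U) {..<k} (\<Pi>\<^sub>E i\<in>{..<k}. {e i})"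
      by (auto simp: prod_emb_def PiE_iff space_uniform_count_measure)
    finally show "d \<in> A \<longleftrightarrow> d \<in> prod_emb UNIV (\<lambda>_. ?U) {..<k} (\<Pi>\<^sub>E i\<in>{..<k}. {e i})" .
  qed
  have sets: "{e i} \<in> sets ?U" if "i \<in> {..<k}" for i
    using e(1) that by (simp add: sets_uniform_count_measure)
  show "A \<in> sets (digit_measure TYPE('p))"
    unfolding A digit_measure_def by (rule sets_PiM_I) (use sets in auto)
  have "emeasure (digit_measure TYPE('p)) A = (\<Prod>i\<in>{..<k}. emeasure ?U {e i})"
    unfolding A digit_measure_def
    by (rule emeasure_PiM_emb) (use sets U.prob_space_axioms in auto)
  also have "\<dots> = (\<Prod>i\<in>{..<k}. ennreal (1 / real CARD('p)))"
  proof (rule prod.cong[OF refl])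
    fix i assume "i \<in> {..<k}"
    hence "e i < CARD('p)" using e(1) by simp
    thus "emeasure ?U {e i} = ennreal (1 / real CARD('p))"
      by (simp add: emeasure_uniform_count_measure)
  qed
  also have "\<dots> = ennreal ((1 / real CARD('p)) ^ k)" by (simp add: ennreal_power)
  also have "(1 / real CARD('p)) ^ k = real CARD('p) powi (- int k)"
    by (simp add: power_int_minus power_divide inverse_eq_divide)
  finally show "emeasure (digit_measure TYPE('p)) A = ennreal (real CARD('p) powi (- int k))" .
qed

lemma digit_measure_space: "d \<in> space (digit_measure TYPE('p::prime_card)) \<longleftrightarrow> (\<forall>i. d i < CARD('p))"
  by (auto simp: digit_measure_def space_PiM space_uniform_count_measure PiE_iff)

lemma of_digits_padic_ints: "of_digits d \<in> padic_ints"
  using of_digits_approx[of d 0] by (simp add: padic_ints_def digit_sum_def)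

text \<open>Inside the p-adic integers a ball of radius p^-k is a residue class modulo p^k, that is,
  a prescription of the first k digits, which has probability p^-k.\<close>

lemma of_digits_vimage_pball:
  fixes x :: "'p::prime_card padic" and k :: nat
  defines "A \<equiv> of_digits -` pball x k \<inter> space (digit_measure TYPE('p))"
  shows "A \<in> sets (digit_measure TYPE('p))"
    and "emeasure (digit_measure TYPE('p)) A = (if x \<in> padic_ints then ennreal (real CARD('p) powi (- int k)) else 0)"
proof -
  have "A \<in> sets (digit_measure TYPE('p)) \<and>
    emeasure (digit_measure TYPE('p)) A = (if x \<in> padic_ints then ennreal (real CARD('p) powi (- int k)) else 0)"
  proof (cases "x \<in> padic_ints")
    case True
    then obtain m where m: "0 \<le> m" "m < int CARD('p) ^ k"
      "padic_norm (x - of_int m) \<le> real CARD('p) powi (- int k)"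
      by (rule padic_ints_approx)
    define a where "a = nat m"
    have a: "m = int a" "a < CARD('p) ^ k" using m by (auto simp: a_def nat_less_iff)
    have ball: "pball x k = pball (of_nat a) k"
      using m a by (intro cball_padic_eq[symmetric]) (simp add: dist_padic)
    have "A = {d \<in> space (digit_measure TYPE('p)). digit_sum TYPE('p) d k = a}"
    proof -
      have "of_digits d \<in> pball (of_nat a :: 'p padic) k \<longleftrightarrow> digit_sum TYPE('p) d k = a"
        if d: "d \<in> space (digit_measure TYPE('p))" for d
      proof -
        have "of_digits d \<in> pball (of_nat (digit_sum TYPE('p) d k) :: 'p padic) k"
          using of_digits_approx[of d k, where 'p='p] by (simp add: dist_padic padic_norm_minus_commute)
        hence eq: "pball (of_digits d :: 'p padic) k = pball (of_nat (digit_sum TYPE('p) d k)) k"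
          by (rule cball_padic_eq)
        have "of_digits d \<in> pball (of_nat a :: 'p padic) k \<longleftrightarrow> of_nat a \<in> pball (of_digits d :: 'p padic) k"
          by (simp add: dist_commute)
        also have "\<dots> \<longleftrightarrow> padic_norm (of_int (int (digit_sum TYPE('p) d k) - int a) :: 'p padic) \<le> real CARD('p) powi (- int k)"
          unfolding eq by (simp add: dist_padic)
        also have "\<dots> \<longleftrightarrow> int CARD('p) ^ k dvd int (digit_sum TYPE('p) d k) - int a"
          by (rule padic_norm_of_int_le_iff)
        also have "\<dots> \<longleftrightarrow> int (digit_sum TYPE('p) d k) mod int CARD('p) ^ k = int a mod int CARD('p) ^ k"
          by (simp add: mod_eq_dvd_iff)
        also have "\<dots> \<longleftrightarrow> digit_sum TYPE('p) d k mod CARD('p) ^ k = a mod CARD('p) ^ k"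
          by (metis of_nat_eq_iff of_nat_mod of_nat_power)
        also have "\<dots> \<longleftrightarrow> digit_sum TYPE('p) d k = a"
          using a(2) digit_sum_less[of k d, where 'p='p] d by (auto simp: digit_measure_space)
        finally show ?thesis .
      qed
      thus ?thesis unfolding A_def ball by auto
    qed
    thus ?thesis using emeasure_digit_sum[OF a(2)] True by simp
  next
    case False
    \<comment> \<open>As the radius is at most 1, a ball that meets the p-adic integers has its
      centre there; for other centres the preimage is empty.\<close>
    have "x \<in> padic_ints" if "y \<in> padic_ints" "y \<in> pball x k" for y
    proof -
      have "pball x k \<subseteq> cball x 1"
        using powi_le_iff[OF card_prime_gt_1[where 'p='p], of "- int k" 0] by auto
      hence "y \<in> cball x 1" using that by blast
      thus ?thesis using cball_padic_eq[of y x 1] cball_padic_eq[of y 0 1] that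
        by (metis centre_in_cball padic_ints_eq_cball zero_le_one)
    qed
    hence "A = {}" using False of_digits_padic_ints unfolding A_def by blast
    thus ?thesis using False by simp
  qed
  thus "A \<in> sets (digit_measure TYPE('p))"
    and "emeasure (digit_measure TYPE('p)) A = (if x \<in> padic_ints then ennreal (real CARD('p) powi (- int k)) else 0)"
    by auto
qed

lemma of_digits_measurable: "(of_digits :: _ \<Rightarrow> 'p::prime_card padic) \<in> digit_measure TYPE('p) \<rightarrow>\<^sub>M borel"
  unfolding borel_padic_eq[of 0]
proof (rule measurable_measure_of)
  fix B :: "'p padic set" assume "B \<in> pballs_from 0"
  then obtain x k where "B = pball x k" by (auto simp: pballs_from_def)
  thus "of_digits -` B \<inter> space (digit_measure TYPE('p)) \<in> sets (digit_measure TYPE('p))"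
    by (auto intro: of_digits_vimage_pball(1))
next
  show "pballs_from 0 \<subseteq> Pow (UNIV :: 'p padic set)" by blast
next
  show "of_digits \<in> space (digit_measure TYPE('p)) \<rightarrow> (UNIV :: 'p padic set)" by blast
qed

definition haar_unit :: "'p::prime_card padic measure" where
  "haar_unit = distr (digit_measure TYPE('p)) borel of_digits"

lemma sets_haar_unit [simp, measurable_cong]: "sets haar_unit = sets borel"
  by (simp add: haar_unit_def)

lemma emeasure_haar_unit_pball:
  "emeasure haar_unit (pball (x :: 'p::prime_card padic) k)
     = (if x \<in> padic_ints then ennreal (real CARD('p) powi (- int k)) else 0)"
  unfolding haar_unit_def
  by (subst emeasure_distr[OF of_digits_measurable]) (simp, rule of_digits_vimage_pball)

lemma prob_space_haar_unit: "prob_space (haar_unit :: 'p::prime_card padic measure)"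
proof -
  have p0: "{..<CARD('p)} \<noteq> {}" using card_prime_gt_1[where 'p='p] by (auto simp: lessThan_empty_iff)
  have "prob_space (digit_measure TYPE('p))"
    unfolding digit_measure_def
    by (intro prob_space_PiM prob_space_uniform_count_measure) (use p0 in auto)
  thus ?thesis unfolding haar_unit_def using of_digits_measurable
    by (rule prob_space.prob_space_distr)
qed

text \<open>The cosets of the p-adic integers are the balls of radius 1.\<close>

definition unit_cosets :: "'p::prime_card padic set set" where
  "unit_cosets = range (\<lambda>x. cball x 1)"

definition coset_rep :: "'p::prime_card padic set \<Rightarrow> 'p padic" where
  "coset_rep c = (SOME x. c = cball x 1)"

text \<open>One translated copy of \<open>haar_unit\<close> for every coset, summed by the counting
  measure; a pushforward of a product expresses this sum of measures.\<close>

definition haar :: "'p::prime_card padic measure" where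
  "haar = distr (count_space unit_cosets \<Otimes>\<^sub>M haar_unit) borel (\<lambda>(c, x). coset_rep c + x)"

lemma countable_unit_cosets: "countable (unit_cosets :: 'p::prime_card padic set set)"
proof (rule countable_subset[OF _ countable_pballs_from[of 0]])
  show "unit_cosets \<subseteq> (pballs_from 0 :: 'p padic set set)"
  proof
    fix c :: "'p padic set" assume "c \<in> unit_cosets"
    then obtain x where "c = pball x 0" by (auto simp: unit_cosets_def)
    thus "c \<in> pballs_from 0" unfolding pballs_from_def by blast
  qed
qed

lemma coset_rep: "c \<in> unit_cosets \<Longrightarrow> c = cball (coset_rep c) 1"
  unfolding coset_rep_def unit_cosets_def by (rule someI_ex) blast

lemma sets_haar [simp, measurable_cong]: "sets haar = sets borel"
  by (simp add: haar_def)

lemma space_haar [simp]: "space haar = UNIV"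
  by (simp add: haar_def)

lemma padic_cball_translate: "(\<lambda>y :: 'p::prime_card padic. w + y) -` cball x r = cball (x - w) r"
  by (auto simp: dist_padic algebra_simps)

text \<open>A ball of radius at most 1 lies in exactly one coset, so a single copy of
  \<open>haar_unit\<close> contributes.\<close>

lemma emeasure_haar_pball:
  "emeasure haar (pball (x :: 'p::prime_card padic) k) = ennreal (real CARD('p) powi (- int k))"
proof -
  interpret U: prob_space "haar_unit :: 'p padic measure" by (rule prob_space_haar_unit)
  let ?f = "\<lambda>(c, y). coset_rep c + y :: 'p padic"
  have f: "?f \<in> count_space unit_cosets \<Otimes>\<^sub>M haar_unit \<rightarrow>\<^sub>M borel"
    by (rule measurable_pair_measure_countable1[OF countable_unit_cosets]) simp
  have sub: "pball x k \<subseteq> cball x 1"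
    using powi_le_iff[OF card_prime_gt_1[where 'p='p], of "- int k" 0] by auto
  have fib: "emeasure haar_unit (Pair c -` (?f -` pball x k \<inter> space (count_space unit_cosets \<Otimes>\<^sub>M haar_unit)))
      = ennreal (real CARD('p) powi (- int k)) * indicator {cball x 1} c" if c: "c \<in> unit_cosets" for c
  proof -
    have "Pair c -` (?f -` pball x k \<inter> space (count_space unit_cosets \<Otimes>\<^sub>M haar_unit))
        = pball (x - coset_rep c) k"
      using c sets_eq_imp_space_eq[OF sets_haar_unit[where 'a='p]]
      by (auto simp: space_pair_measure dist_padic algebra_simps)
    moreover have "x - coset_rep c \<in> padic_ints \<longleftrightarrow> c = cball x 1"
    proof -
      have "x - coset_rep c \<in> padic_ints \<longleftrightarrow> x \<in> cball (coset_rep c) 1"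
        by (simp add: padic_ints_def dist_padic padic_norm_minus_commute)
      also have "\<dots> \<longleftrightarrow> c = cball x 1" using coset_rep[OF c] cball_padic_eq[of x "coset_rep c" 1]
        by (metis centre_in_cball zero_le_one)
      finally show ?thesis .
    qed
    ultimately show ?thesis by (simp add: emeasure_haar_unit_pball)
  qed
  have "emeasure haar (pball x k)
      = emeasure (count_space unit_cosets \<Otimes>\<^sub>M haar_unit)
          (?f -` pball x k \<inter> space (count_space unit_cosets \<Otimes>\<^sub>M haar_unit))"
    unfolding haar_def by (rule emeasure_distr[OF f]) simp
  also have "\<dots> = (\<integral>\<^sup>+c. emeasure haar_unit (Pair c -` (?f -` pball x k \<inter> space (count_space unit_cosets \<Otimes>\<^sub>M haar_unit)))
      \<partial>count_space unit_cosets)"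
    by (rule U.emeasure_pair_measure_alt) (rule measurable_sets[OF f], simp)
  also have "\<dots> = (\<integral>\<^sup>+c. ennreal (real CARD('p) powi (- int k)) * indicator {cball x 1} c \<partial>count_space unit_cosets)"
    by (intro nn_integral_cong) (use fib in auto)
  also have "\<dots> = ennreal (real CARD('p) powi (- int k))"
    by (subst nn_integral_cmult_indicator) (auto simp: unit_cosets_def)
  finally show ?thesis .
qed

lemma emeasure_haar_padic_ints [simp]: "emeasure haar (padic_ints :: 'p::prime_card padic set) = 1"
  using emeasure_haar_pball[of "0 :: 'p padic" 0] by (simp add: padic_ints_eq_cball)

lemma sigma_finite_haar: "sigma_finite_measure (haar :: 'p::prime_card padic measure)"
proof
  have "x \<in> \<Union> (pballs_from 0)" for x :: "'p padic"
    using pball_radius_pos[of "- int 0", where 'p='p] by (auto simp: pballs_from_def intro!: bexI[of _ 0] exI[of _ x])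
  hence "\<Union> (pballs_from 0) = (UNIV :: 'p padic set)" by blast
  thus "\<exists>A. countable A \<and> A \<subseteq> sets haar \<and> \<Union> A = space (haar :: 'p padic measure) \<and> (\<forall>a\<in>A. emeasure haar a \<noteq> \<infinity>)"
    using countable_pballs_from[of 0, where 'a='p]
    by (intro exI[of _ "pballs_from 0"]) (auto simp: pballs_from_def emeasure_haar_pball)
qed

text \<open>Translates of balls are balls of the same radius, and the measure of a ball depends on
  its radius only.\<close>

lemma distr_haar_translate: "distr haar haar (\<lambda>x. x + w) = (haar :: 'p::prime_card padic measure)"
proof (rule padic_measure_eqI[of _ _ 0])
  fix x :: "'p padic" and k
  have "(\<lambda>y. y + w) = (\<lambda>y. w + y)" by (simp add: fun_eq_iff add.commute)
  hence "emeasure (distr haar haar (\<lambda>x. x + w)) (pball x k) = emeasure haar ((\<lambda>y. w + y) -` pball x k)"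
    by (subst emeasure_distr) auto
  thus 1: "emeasure (distr haar haar (\<lambda>x. x + w)) (pball x k) = emeasure haar (pball x k)"
    by (simp add: padic_cball_translate emeasure_haar_pball)
  show "emeasure (distr haar haar (\<lambda>x. x + w)) (pball x k) \<noteq> \<infinity>"
    unfolding 1 by (simp add: emeasure_haar_pball)
qed auto

text \<open>The balls considered are so small that multiplication by \<open>y\<close> maps them to balls of radius at most 1.\<close>

lemma distr_haar_mult:
  assumes y: "(y :: 'p::prime_card padic) \<noteq> 0"
  shows "scale_measure (ennreal (padic_norm y)) (distr haar haar (\<lambda>x. y * x)) = haar"
proof -
  obtain m where m: "padic_norm y = real CARD('p) powi m" using padic_norm_value[OF y] by blast
  have eq: "emeasure (scale_measure (ennreal (padic_norm y)) (distr haar haar (\<lambda>x. y * x))) (pball x k)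
      = emeasure haar (pball x k)" if k: "k \<ge> nat \<bar>m\<bar>" for x :: "'p padic" and k
  proof -
    have r: "real CARD('p) powi (- int k) = real CARD('p) powi m * real CARD('p) powi (- int (nat (int k + m)))"
      using k by (subst power_int_add[symmetric]) auto
    have "(\<lambda>x. y * x) -` pball x k = pball (x / y) (nat (int k + m))"
    proof -
      have "padic_norm (x - y * z) \<le> real CARD('p) powi (- int k)
          \<longleftrightarrow> padic_norm (x / y - z) \<le> real CARD('p) powi (- int (nat (int k + m)))" for z
      proof -
        have "x - y * z = y * (x / y - z)" using y by (simp add: field_simps)
        hence "padic_norm (x - y * z) = real CARD('p) powi m * padic_norm (x / y - z)"
          by (simp add: padic_norm_mult m)
        thus ?thesis unfolding r using pball_radius_pos[of m, where 'p='p] by simp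
      qed
      thus ?thesis by (auto simp: dist_padic)
    qed
    hence "emeasure (distr haar haar (\<lambda>x. y * x)) (pball x k) = emeasure haar (pball (x / y) (nat (int k + m)))"
      by (subst emeasure_distr) auto
    hence "emeasure (scale_measure (ennreal (padic_norm y)) (distr haar haar (\<lambda>x. y * x))) (pball x k)
        = ennreal (real CARD('p) powi m) * ennreal (real CARD('p) powi (- int (nat (int k + m))))"
      unfolding emeasure_scale_measure m emeasure_haar_pball by simp
    also have "\<dots> = ennreal (real CARD('p) powi (- int k))"
      unfolding r by (rule ennreal_mult[symmetric]) simp_all
    finally show ?thesis by (simp add: emeasure_haar_pball)
  qed
  show ?thesis
    by (rule padic_measure_eqI[of _ _ "nat \<bar>m\<bar>"]) (auto simp: eq emeasure_haar_pball simp del: emeasure_scale_measure)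
qed

lemma emeasure_haar_singleton: "emeasure haar {x :: 'p::prime_card padic} = 0"
proof (rule ccontr)
  assume "emeasure haar {x} \<noteq> 0"
  moreover have le: "emeasure haar {x} \<le> ennreal (real CARD('p) powi (- int k))" for k
    using emeasure_mono[of "{x}" "pball x k" haar] pball_radius_pos[of "- int k", where 'p='p]
    by (simp add: emeasure_haar_pball)
  moreover have "emeasure haar {x} < \<infinity>" using le[of 0] by (auto simp: less_top[symmetric] top_unique)
  ultimately obtain e where e: "e > 0" "emeasure haar {x} = ennreal e"
    by (metis ennreal_cases ennreal_0 ennreal_neg infinity_ennreal_def less_irrefl linorder_not_less)
  obtain k where "real CARD('p) powi (- int k) < e" using pball_radius_small[OF e(1)] by blast
  thus False using le[of k] e by (simp add: ennreal_le_iff2)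
qed

lemma padic_norm_powi_measurable [measurable]:
  "(\<lambda>x :: 'p::prime_card padic. padic_norm x powi k) \<in> borel_measurable borel"
  by (cases k) (auto simp: power_int_def)

text \<open>Balls that do not contain 0 and whose image under inversion has radius at most 1.\<close>

definition inv_pballs :: "'p::prime_card padic set set" where
  "inv_pballs = {pball x k | x k. real CARD('p) powi (- int k) < padic_norm x
                   \<and> real CARD('p) powi (- int k) \<le> padic_norm x ^ 2}"

lemma inv_pballs_subset: "inv_pballs \<subseteq> pballs_from 0"
  by (auto simp: inv_pballs_def pballs_from_def)

text \<open>The point 0 enters as a singleton: inversion is not continuous there, and no ball of the
  family contains it.\<close>

lemma Int_stable_inv_pballs: "Int_stable (insert {} (insert {0} inv_pballs) :: 'p::prime_card padic set set)"
proof (rule Int_stableI)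
  let ?E = "insert {} (insert {0} inv_pballs) :: 'p padic set set"
  fix a b :: "'p padic set" assume ab: "a \<in> ?E" "b \<in> ?E"
  show "a \<inter> b \<in> ?E"
  proof (cases "a \<in> inv_pballs \<and> b \<in> inv_pballs")
    case True
    then obtain x y k l where "a = pball x k" "b = pball y l" by (auto simp: inv_pballs_def)
    hence "a \<inter> b \<in> {{}, a, b}"
      using cball_padic_Int[of "real CARD('p) powi (- int k)" "real CARD('p) powi (- int l)" x y]
        cball_padic_Int[of "real CARD('p) powi (- int l)" "real CARD('p) powi (- int k)" y x]
      by (cases "real CARD('p) powi (- int k) \<le> real CARD('p) powi (- int l)") auto
    hence "a \<inter> b = {} \<or> a \<inter> b = a \<or> a \<inter> b = b" by simp
    thus ?thesis using ab by (elim disjE) (simp_all only: insert_iff simp_thms)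
  next
    case False
    hence "a = {} \<or> a = {0} \<or> b = {} \<or> b = {0}" using ab by auto
    thus ?thesis by auto
  qed
qed

text \<open>Around a nonzero point of an open set all sufficiently small balls belong to the family,
  so an open set is a union of generators, and there are only countably many generators.\<close>

lemma sigma_sets_inv_pballs:
  "sets borel = sigma_sets UNIV (insert {} (insert {0} inv_pballs) :: 'p::prime_card padic set set)"
proof (rule antisym)
  let ?E = "insert {} (insert {0} inv_pballs) :: 'p padic set set"
  have cE: "countable ?E"
    using countable_subset[OF inv_pballs_subset countable_pballs_from] by simp
  show "sets borel \<subseteq> sigma_sets UNIV ?E"
    unfolding borel_def sets_measure_of[OF subset_UNIV[of "Collect open", folded Pow_UNIV]]
  proof (rule sigma_sets_mono, rule subsetI)
    fix U :: "'p padic set" assume "U \<in> Collect open"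
    hence U: "open U" by simp
    have "\<exists>e\<in>?E. x \<in> e \<and> e \<subseteq> U" if x: "x \<in> U" for x
    proof (cases "x = 0")
      case False
      obtain e where e: "e > 0" "cball x e \<subseteq> U" using U x by (auto simp: open_contains_cball)
      obtain k where k: "real CARD('p) powi (- int k) < min e (min (padic_norm x) (padic_norm x ^ 2))"
        using pball_radius_small[of "min e (min (padic_norm x) (padic_norm x ^ 2))" 0, where 'p='p] e(1) False
        by auto
      have "pball x k \<in> inv_pballs" using k by (auto simp: inv_pballs_def intro!: exI[of _ x] exI[of _ k])
      moreover have "pball x k \<subseteq> cball x e" using k by auto
      moreover have "x \<in> pball x k" using pball_radius_pos[of "- int k", where 'p='p] by simp
      ultimately show ?thesis using e(2) by blast
    qed (use x in auto)
    hence "U = \<Union> {e \<in> ?E. e \<subseteq> U}" by blast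
    moreover have "\<Union> {e \<in> ?E. e \<subseteq> U} \<in> sigma_sets UNIV ?E"
      using cE by (intro sigma_algebra.countable_Union[OF sigma_algebra_sigma_sets])
        (auto intro: countable_subset[of _ ?E] sigma_sets.Basic)
    ultimately show "U \<in> sigma_sets UNIV ?E" by simp
  qed
  have "e \<in> sets borel" if "e \<in> ?E" for e
    using that by (auto simp: inv_pballs_def)
  thus "sigma_sets UNIV ?E \<subseteq> sets borel"
    using sets.sigma_sets_subset[of ?E borel] by auto
qed

text \<open>A ball around x of radius below |x| has constant norm. The identity x - 1/y = -(1/x - y)
  x / y then shows that inversion scales the distance to the centre by |x|^2.\<close>

lemma inverse_vimage_cball:
  assumes "r < padic_norm (x :: 'p::prime_card padic)" "r > 0"
  shows "inverse -` cball x r = cball (inverse x) (r / padic_norm x ^ 2)"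
proof -
  have x0: "x \<noteq> 0" using assms by auto
  hence n0: "padic_norm x > 0" by simp
  have iff: "padic_norm (x - inverse y) \<le> r \<longleftrightarrow> padic_norm (inverse x - y) \<le> r / padic_norm x ^ 2"
    if "y \<noteq> 0" "padic_norm y = inverse (padic_norm x)" for y
  proof -
    have "x - inverse y = - ((inverse x - y) * x * inverse y)" using that(1) x0 by (simp add: field_simps)
    hence "padic_norm (x - inverse y) = padic_norm (inverse x - y) * padic_norm x ^ 2"
      using that n0 by (simp add: padic_norm_mult padic_norm_inverse power2_eq_square)
    thus ?thesis using n0 by (simp add: field_simps)
  qed
  show ?thesis
  proof (rule Set.set_eqI, rule iffI)
    fix y assume "y \<in> inverse -` cball x r"
    hence y: "padic_norm (x - inverse y) \<le> r" by (simp add: dist_padic)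
    hence n: "padic_norm (inverse y) = padic_norm x" using assms padic_norm_eqI[of x "inverse y"] by simp
    have "y \<noteq> 0" using n n0 by auto
    moreover have "padic_norm y = inverse (padic_norm x)"
      using n by (metis inverse_inverse_eq padic_norm_inverse)
    ultimately show "y \<in> cball (inverse x) (r / padic_norm x ^ 2)"
      using iff[of y] y by (simp add: dist_padic)
  next
    fix y assume "y \<in> cball (inverse x) (r / padic_norm x ^ 2)"
    hence y: "padic_norm (inverse x - y) \<le> r / padic_norm x ^ 2" by (simp add: dist_padic)
    have "r / padic_norm x ^ 2 < padic_norm (inverse x)"
    proof -
      have "r / padic_norm x ^ 2 < padic_norm x / padic_norm x ^ 2"
        using assms n0 by (intro divide_strict_right_mono) simp_all
      thus ?thesis using n0 by (simp add: padic_norm_inverse power2_eq_square divide_inverse)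
    qed
    hence n: "padic_norm y = inverse (padic_norm x)"
      using padic_norm_eqI[of "inverse x" y] y by (simp add: padic_norm_inverse)
    moreover have "y \<noteq> 0" using n n0 by auto
    ultimately show "y \<in> inverse -` cball x r" using iff[of y] y by (simp add: dist_padic)
  qed
qed

text \<open>The weight |y|^-2 is constantly |x|^2 on the preimage of a ball around x, and this
  factor undoes the change of the radius by |x|^-2.\<close>

lemma distr_haar_inverse:
  "distr (density haar (\<lambda>y. ennreal (padic_norm y powi (-2)))) haar inverse = (haar :: 'p::prime_card padic measure)"
proof -
  let ?D = "density haar (\<lambda>y. ennreal (padic_norm y powi (-2))) :: 'p padic measure"
  let ?M = "distr ?D haar inverse :: 'p padic measure"
  have ball: "emeasure ?M (pball x k) = emeasure haar (pball x k)"
    if x: "real CARD('p) powi (- int k) < padic_norm x" "real CARD('p) powi (- int k) \<le> padic_norm x ^ 2"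
    for x :: "'p padic" and k
  proof -
    have "padic_norm x > 0" using x(1) pball_radius_pos[of "- int k", where 'p='p] by linarith
    hence x0: "x \<noteq> 0" by simp
    obtain m where m: "padic_norm x = real CARD('p) powi m" using padic_norm_value[OF x0] by blast
    have m2: "padic_norm x ^ 2 = real CARD('p) powi (2 * m)"
      unfolding m by (simp add: power_int_mult[symmetric] power_int_power' mult.commute)
    have km: "- int k \<le> 2 * m"
      using x(2) unfolding m2 powi_le_iff[OF card_prime_gt_1] .
    have r: "real CARD('p) powi (- int k) / padic_norm x ^ 2 = real CARD('p) powi (- int (nat (int k + 2 * m)))"
      unfolding m2 using km card_prime_gt_1[where 'p='p] by (subst power_int_diff[symmetric]) auto
    have v: "inverse -` pball x k = pball (inverse x) (nat (int k + 2 * m))"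
      using inverse_vimage_cball[OF x(1) pball_radius_pos] unfolding r .
    have nrm: "padic_norm y = inverse (padic_norm x)" if "y \<in> inverse -` pball x k" for y
    proof -
      have "padic_norm (x - inverse y) < padic_norm x" using that x(1) by (simp add: dist_padic)
      hence "padic_norm (inverse y) = padic_norm x" by (rule padic_norm_eqI)
      thus ?thesis by (metis inverse_inverse_eq padic_norm_inverse)
    qed
    have "emeasure ?M (pball x k) = emeasure ?D (inverse -` pball x k)"
      by (subst emeasure_distr) auto
    also have "\<dots> = (\<integral>\<^sup>+y. ennreal (padic_norm y powi (-2)) * indicator (inverse -` pball x k) y \<partial>haar)"
      by (rule emeasure_density) (auto simp: v)
    also have "\<dots> = (\<integral>\<^sup>+y. ennreal (padic_norm x ^ 2) * indicator (inverse -` pball x k) y \<partial>haar)"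
      by (intro nn_integral_cong) (auto simp: nrm power_int_minus power_inverse split: split_indicator)
    also have "\<dots> = ennreal (padic_norm x ^ 2) * emeasure haar (inverse -` pball x k)"
      by (rule nn_integral_cmult_indicator) (auto simp: v)
    also have "\<dots> = ennreal (real CARD('p) powi (- int k))"
    proof -
      have "padic_norm x ^ 2 * real CARD('p) powi (- int (nat (int k + 2 * m))) = real CARD('p) powi (- int k)"
        unfolding r[symmetric] using x0 by simp
      thus ?thesis unfolding v emeasure_haar_pball by (subst ennreal_mult[symmetric]) simp_all
    qed
    finally show ?thesis by (simp only: emeasure_haar_pball)
  qed
  \<comment> \<open>Since \<open>inverse 0 = 0\<close>, the preimage of 0 consists of 0 alone and is
    a null set.\<close>
  have zero: "emeasure ?M {0} = 0"
  proof -
    have "inverse -` {0 :: 'p padic} = {0}" by auto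
    hence "emeasure ?M {0} = emeasure ?D {0}" by (subst emeasure_distr) auto
    also have "\<dots> = 0"
      using emeasure_haar_singleton[of "0 :: 'p padic"] by (subst emeasure_density) (auto simp: null_setsI)
    finally show ?thesis .
  qed
  let ?E = "insert {} (insert {0} inv_pballs) :: 'p padic set set"
  show ?thesis
  proof (rule measure_eqI_generator_eq_countable[OF Int_stable_inv_pballs])
    show "emeasure ?M X = emeasure haar X" if "X \<in> ?E" for X
      using that ball zero emeasure_haar_singleton[of "0 :: 'p padic"] by (auto simp: inv_pballs_def)
    show "sets ?M = sigma_sets UNIV ?E" "sets (haar :: 'p padic measure) = sigma_sets UNIV ?E"
      using sigma_sets_inv_pballs[where 'p='p] by auto
    show "countable ?E"
      using countable_subset[OF inv_pballs_subset countable_pballs_from] by simp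
    have "x \<in> \<Union> ?E" for x :: "'p padic"
    proof (cases "x = 0")
      case False
      then obtain k where k: "real CARD('p) powi (- int k) < min (padic_norm x) (padic_norm x ^ 2)"
        using pball_radius_small[of "min (padic_norm x) (padic_norm x ^ 2)" 0, where 'p='p] by auto
      have "pball x k \<in> inv_pballs" using k by (auto simp: inv_pballs_def intro!: exI[of _ x] exI[of _ k])
      moreover have "x \<in> pball x k" using pball_radius_pos[of "- int k", where 'p='p] by simp
      ultimately show ?thesis by blast
    qed auto
    thus "\<Union> ?E = UNIV" by blast
    show "emeasure ?M X \<noteq> \<infinity>" if "X \<in> ?E" for X
      using that ball zero by (auto simp: inv_pballs_def emeasure_haar_pball)
  qed auto
qed

lemma nn_integral_haar_inverse:
  assumes [measurable]: "f \<in> borel_measurable (borel :: 'p::prime_card padic measure)"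
  shows "(\<integral>\<^sup>+y. ennreal (padic_norm y powi (-2)) * f (inverse y) \<partial>haar) = (\<integral>\<^sup>+y. f y \<partial>haar)"
proof -
  have "(\<integral>\<^sup>+y. f y \<partial>haar) = (\<integral>\<^sup>+y. f y \<partial>distr (density haar (\<lambda>y. ennreal (padic_norm y powi (-2)))) haar inverse)"
    by (simp only: distr_haar_inverse)
  also have "\<dots> = (\<integral>\<^sup>+y. f (inverse y) \<partial>density haar (\<lambda>y. ennreal (padic_norm y powi (-2))))"
    by (rule nn_integral_distr) measurable
  also have "\<dots> = (\<integral>\<^sup>+y. ennreal (padic_norm y powi (-2)) * f (inverse y) \<partial>haar)"
    by (rule nn_integral_density) measurable
  finally show ?thesis ..
qed

lemma emeasure_haar_affine:
  assumes c: "(c :: 'p::prime_card padic) \<noteq> 0" and A: "A \<in> sets borel"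
  shows "ennreal (padic_norm c) * emeasure haar {x. c * x + w \<in> A} = emeasure haar A"
proof -
  have B: "{x. x + w \<in> A} \<in> sets (borel :: 'p padic measure)"
    using measurable_sets[of "\<lambda>x. x + w" borel borel A] A by (simp add: vimage_def)
  have "emeasure haar {x. x + w \<in> A} = emeasure (distr haar haar (\<lambda>x. x + w)) A"
    using A by (subst emeasure_distr) (auto simp: vimage_def)
  hence "emeasure haar A = emeasure haar {x. x + w \<in> A}" by (simp add: distr_haar_translate)
  also have "\<dots> = emeasure (scale_measure (ennreal (padic_norm c)) (distr haar haar (\<lambda>x. c * x))) {x. x + w \<in> A}"
    by (simp only: distr_haar_mult[OF c])
  also have "\<dots> = ennreal (padic_norm c) * emeasure haar {x. c * x + w \<in> A}"
    using B by (simp add: emeasure_distr vimage_def)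
  finally show ?thesis ..
qed

section \<open>Products of Haar measure\<close>

interpretation haar_product: product_sigma_finite "\<lambda>_. haar"
  by (rule product_sigma_finite.intro) (rule sigma_finite_haar)

abbreviation haar_PiM :: "'i set \<Rightarrow> ('i \<Rightarrow> 'p::prime_card padic) measure" where
  "haar_PiM I \<equiv> PiM I (\<lambda>_. haar)"

lemma sets_haar_PiM: "sets (haar_PiM I) = sets (PiM I (\<lambda>_. borel))"
  by (rule sets_PiM_cong) auto

lemma affine_measurable_PiM:
  fixes c w :: "'i \<Rightarrow> 'p::prime_card padic" and I :: "'i set"
  shows
  "(\<lambda>z. \<lambda>i\<in>I. c i * z i + w i) \<in> PiM I (\<lambda>_. borel) \<rightarrow>\<^sub>M PiM I (\<lambda>_. borel :: 'p::prime_card padic measure)"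
  by (rule measurable_restrict) measurable

text \<open>Boxes determine the product measure, and on a box the claim splits into one-dimensional
  ones.\<close>

lemma haar_PiM_affine:
  fixes c w :: "'i \<Rightarrow> 'p::prime_card padic"
  assumes I: "finite I" and c: "\<And>i. i \<in> I \<Longrightarrow> c i \<noteq> 0"
  shows "scale_measure (ennreal (\<Prod>i\<in>I. padic_norm (c i)))
           (distr (haar_PiM I) (haar_PiM I) (\<lambda>z. \<lambda>i\<in>I. c i * z i + w i)) = haar_PiM I"
proof (rule haar_product.PiM_eqI[OF I])
  fix A :: "'i \<Rightarrow> 'p padic set" assume A: "\<And>i. i \<in> I \<Longrightarrow> A i \<in> sets haar"
  let ?T = "\<lambda>z. \<lambda>i\<in>I. c i * z i + w i"
  have T: "?T \<in> haar_PiM I \<rightarrow>\<^sub>M haar_PiM I"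
    using affine_measurable_PiM[of c w I] measurable_cong_sets[OF sets_haar_PiM sets_haar_PiM, of I I] by simp
  have pre: "{x. c i * x + w i \<in> A i} \<in> sets haar" if "i \<in> I" for i
  proof -
    have "(\<lambda>x. c i * x + w i) -` A i \<inter> space borel \<in> sets borel"
      using A[OF that] by (intro measurable_sets[of _ borel borel]) auto
    thus ?thesis by (simp add: vimage_def)
  qed
  have "emeasure (scale_measure (ennreal (\<Prod>i\<in>I. padic_norm (c i))) (distr (haar_PiM I) (haar_PiM I) ?T)) (PiE I A)
      = ennreal (\<Prod>i\<in>I. padic_norm (c i)) * emeasure (haar_PiM I) (?T -` PiE I A \<inter> space (haar_PiM I))"
    using A I by (simp add: emeasure_distr[OF T] sets_PiM_I_finite)
  also have "?T -` PiE I A \<inter> space (haar_PiM I) = (\<Pi>\<^sub>E i\<in>I. {x. c i * x + w i \<in> A i})"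
    by (auto simp: space_PiM PiE_iff extensional_def)
  also have "ennreal (\<Prod>i\<in>I. padic_norm (c i)) * emeasure (haar_PiM I) (\<Pi>\<^sub>E i\<in>I. {x. c i * x + w i \<in> A i})
      = (\<Prod>i\<in>I. ennreal (padic_norm (c i)) * emeasure haar {x. c i * x + w i \<in> A i})"
    unfolding prod.distrib using pre by (subst haar_product.emeasure_PiM[OF I]) (simp_all add: prod_ennreal)
  also have "\<dots> = (\<Prod>i\<in>I. emeasure haar (A i))"
    using A c by (intro prod.cong refl emeasure_haar_affine) auto
  finally show "emeasure (scale_measure (ennreal (\<Prod>i\<in>I. padic_norm (c i))) (distr (haar_PiM I) (haar_PiM I) ?T)) (PiE I A)
      = (\<Prod>i\<in>I. emeasure haar (A i))" .
qed simp

lemma nn_integral_haar_PiM_affine: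
  fixes c w :: "'i \<Rightarrow> 'p::prime_card padic"
  assumes I: "finite I" and c: "\<And>i. i \<in> I \<Longrightarrow> c i \<noteq> 0"
    and f: "f \<in> borel_measurable (PiM I (\<lambda>_. borel))"
  shows "ennreal (\<Prod>i\<in>I. padic_norm (c i)) * (\<integral>\<^sup>+z. f (\<lambda>i\<in>I. c i * z i + w i) \<partial>haar_PiM I) = (\<integral>\<^sup>+z. f z \<partial>haar_PiM I)"
proof -
  let ?T = "\<lambda>z. \<lambda>i\<in>I. c i * z i + w i"
  have T: "?T \<in> haar_PiM I \<rightarrow>\<^sub>M haar_PiM I"
    using affine_measurable_PiM[of c w I] measurable_cong_sets[OF sets_haar_PiM sets_haar_PiM, of I I] by simp
  have f': "f \<in> borel_measurable (haar_PiM I)"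
    using f measurable_cong_sets[OF sets_haar_PiM refl, of I] by blast
  have "(\<integral>\<^sup>+z. f z \<partial>haar_PiM I)
      = (\<integral>\<^sup>+z. f z \<partial>scale_measure (ennreal (\<Prod>i\<in>I. padic_norm (c i))) (distr (haar_PiM I) (haar_PiM I) ?T))"
    by (simp only: haar_PiM_affine[OF I c])
  also have "\<dots> = ennreal (\<Prod>i\<in>I. padic_norm (c i)) * (\<integral>\<^sup>+z. f (?T z) \<partial>haar_PiM I)"
    using f' by (simp add: nn_integral_scale_measure nn_integral_distr[OF T])
  finally show ?thesis ..
qed

section \<open>Uniqueness of the translation invariant measure\<close>

lemma pballs_from_iff: "c \<in> pballs_from K \<longleftrightarrow> (\<exists>x k. k \<ge> K \<and> c = pball x k)"
  unfolding pballs_from_def by blast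

definition translate_on :: "'i set \<Rightarrow> ('i \<Rightarrow> 'p::prime_card padic) \<Rightarrow> ('i \<Rightarrow> 'p padic) \<Rightarrow> ('i \<Rightarrow> 'p padic)" where
  "translate_on I w z = (\<lambda>i\<in>I. z i + w i)"

lemma translate_on_measurable:
  "translate_on I w \<in> PiM I (\<lambda>_. borel) \<rightarrow>\<^sub>M PiM I (\<lambda>_. borel :: 'p::prime_card padic measure)"
  unfolding translate_on_def by (rule measurable_restrict) measurable

lemma haar_PiM_translate:
  "finite I \<Longrightarrow> distr (haar_PiM I) (haar_PiM I) (translate_on I w) = (haar_PiM I :: ('i \<Rightarrow> 'p::prime_card padic) measure)"
  using haar_PiM_affine[of I "\<lambda>_. 1" w] by (simp add: translate_on_def[abs_def])

definition pbox :: "'i set \<Rightarrow> ('i \<Rightarrow> 'p::prime_card padic) \<Rightarrow> ('i \<Rightarrow> nat) \<Rightarrow> ('i \<Rightarrow> 'p padic) set" where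
  "pbox I x k = (\<Pi>\<^sub>E i\<in>I. pball (x i) (k i))"

lemma box_sets: "finite I \<Longrightarrow> pbox I x k \<in> sets (PiM I (\<lambda>_. borel))"
  unfolding pbox_def by (rule sets_PiM_I_finite) auto

text \<open>
  The cosets of a small box partition the unit box into countably many pieces of equal measure. The
  number of the pieces does not depend on the measure.
\<close>

lemma translation_invariant_box_eq:
  fixes M N :: "('i \<Rightarrow> 'p::prime_card padic) measure"
  assumes I: "finite I"
    and M: "sets M = sets (PiM I (\<lambda>_. borel))" "\<And>w. w \<in> space M \<Longrightarrow> distr M M (translate_on I w) = M"
      "emeasure M (\<Pi>\<^sub>E i\<in>I. padic_ints) = 1"
    and N: "sets N = sets (PiM I (\<lambda>_. borel))" "\<And>w. w \<in> space N \<Longrightarrow> distr N N (translate_on I w) = N"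
      "emeasure N (\<Pi>\<^sub>E i\<in>I. padic_ints) = 1"
  shows "emeasure M (pbox I x k) = emeasure N (pbox I x k)" and "emeasure M (pbox I x k) \<noteq> \<infinity>"
proof -
  let ?G = "\<Pi>\<^sub>E i\<in>I. (padic_ints :: 'p padic set)"
  define C where "C = {pbox I y k | y. y \<in> ?G}"
  have cC: "countable C"
  proof (rule countable_subset)
    \<comment> \<open>Many centres give the same box, so countability is drawn from the balls in the
      single coordinates.\<close>
    show "C \<subseteq> (\<lambda>c. PiE I c) ` (\<Pi>\<^sub>E i\<in>I. pballs_from 0)"
    proof
      fix b assume "b \<in> C"
      then obtain y where b: "b = pbox I y k" by (auto simp: C_def)
      have "(\<lambda>i\<in>I. pball (y i) (k i)) \<in> (\<Pi>\<^sub>E i\<in>I. pballs_from 0)" by (auto simp: pballs_from_def)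
      moreover have "b = PiE I (\<lambda>i\<in>I. pball (y i) (k i))" unfolding b pbox_def by (rule PiE_cong) simp
      ultimately show "b \<in> (\<lambda>c. PiE I c) ` (\<Pi>\<^sub>E i\<in>I. pballs_from 0)" by blast
    qed
    show "countable ((\<lambda>c. PiE I c) ` (\<Pi>\<^sub>E i\<in>I. pballs_from 0 :: 'p padic set set))"
      by (intro countable_image countable_PiE I countable_pballs_from)
  qed
  have box_eq: "pbox I y k = pbox I z k" if "z \<in> pbox I y k" for y z
    unfolding pbox_def using that by (intro PiE_cong cball_padic_eq[symmetric]) (auto simp: pbox_def)
  have mem: "y \<in> pbox I y k" if "y \<in> extensional I" for y
    using that pball_radius_pos[where 'p='p] by (auto simp: pbox_def PiE_iff less_imp_le)
  have disj: "disjoint_family_on (\<lambda>c. c) C"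
    unfolding disjoint_family_on_def
  proof (intro ballI impI)
    fix a b assume ab: "a \<in> C" "b \<in> C" "a \<noteq> b"
    then obtain y z where yz: "a = pbox I y k" "b = pbox I z k" by (auto simp: C_def)
    show "a \<inter> b = {}"
    proof (rule ccontr)
      assume "a \<inter> b \<noteq> {}"
      then obtain v where "v \<in> pbox I y k" "v \<in> pbox I z k" using yz by blast
      hence "a = b" unfolding yz by (metis box_eq)
      thus False using ab(3) by simp
    qed
  qed
  have sub: "pball y l \<subseteq> padic_ints" if "y \<in> padic_ints" for y :: "'p padic" and l
  proof -
    have "pball y l \<subseteq> cball y 1"
      using powi_le_iff[OF card_prime_gt_1[where 'p='p], of "- int l" 0] by auto
    also have "cball y 1 = padic_ints"
      using that unfolding padic_ints_eq_cball by (rule cball_padic_eq)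
    finally show ?thesis .
  qed
  have G: "?G = (\<Union>c\<in>C. c)"
  proof (rule Set.set_eqI, rule iffI)
    fix y assume y: "y \<in> ?G"
    hence "pbox I y k \<in> C" "y \<in> pbox I y k" using mem[of y] by (auto simp: C_def PiE_iff)
    thus "y \<in> (\<Union>c\<in>C. c)" by blast
  next
    fix v assume "v \<in> (\<Union>c\<in>C. c)"
    then obtain y where y: "y \<in> ?G" "v \<in> pbox I y k" by (auto simp: C_def)
    thus "v \<in> ?G" using sub unfolding pbox_def PiE_iff by blast
  qed
  have C_sets: "c \<in> sets (PiM I (\<lambda>_. borel))" if "c \<in> C" for c
    using that box_sets[OF I] by (auto simp: C_def)
  have shift: "emeasure L (pbox I y k) = emeasure L (pbox I x k)"
    if L: "sets L = sets (PiM I (\<lambda>_. borel))" "\<And>w. w \<in> space L \<Longrightarrow> distr L L (translate_on I w) = L" for L y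
  proof -
    let ?w = "\<lambda>i\<in>I. y i - x i"
    have sp: "space L = PiE I (\<lambda>_. UNIV)" using sets_eq_imp_space_eq[OF L(1)] by (simp add: space_PiM)
    have m: "translate_on I ?w \<in> L \<rightarrow>\<^sub>M L"
      using translate_on_measurable measurable_cong_sets[OF L(1) L(1)] by blast
    have "emeasure L (pbox I y k) = emeasure (distr L L (translate_on I ?w)) (pbox I y k)"
      using L(2)[of ?w] by (simp add: sp)
    also have "\<dots> = emeasure L (translate_on I ?w -` pbox I y k \<inter> space L)"
      by (rule emeasure_distr[OF m]) (simp add: L(1) box_sets[OF I])
    also have "translate_on I ?w -` pbox I y k \<inter> space L = pbox I x k"
      by (auto simp: sp translate_on_def pbox_def PiE_iff dist_padic algebra_simps)
    finally show ?thesis .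
  qed
  have key: "1 = emeasure L (pbox I x k) * emeasure (count_space C) C"
    if L: "sets L = sets (PiM I (\<lambda>_. borel))" "\<And>w. w \<in> space L \<Longrightarrow> distr L L (translate_on I w) = L"
      "emeasure L ?G = 1" for L
  proof -
    have "1 = emeasure L (\<Union>c\<in>C. c)" using L(3) G by simp
    also have "\<dots> = (\<integral>\<^sup>+c. emeasure L c \<partial>count_space C)"
      by (rule emeasure_UN_countable[OF _ cC disj]) (simp add: L(1) C_sets)
    also have "\<dots> = (\<integral>\<^sup>+c. emeasure L (pbox I x k) \<partial>count_space C)"
    proof (rule nn_integral_cong)
      fix c assume "c \<in> space (count_space C)"
      then obtain y where "c = pbox I y k" by (auto simp: C_def)
      thus "emeasure L c = emeasure L (pbox I x k)" by (simp only: shift[OF L(1,2), of y])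
    qed
    also have "\<dots> = emeasure L (pbox I x k) * emeasure (count_space C) C" by simp
    finally show ?thesis .
  qed
  let ?\<kappa> = "emeasure (count_space C) C"
  \<comment> \<open>The product of the measure of the box and \<open>?\<kappa>\<close> is 1, so both
    factors are nonzero and finite, and \<open>?\<kappa>\<close> may be cancelled.\<close>
  have "?\<kappa> \<noteq> 0" using key[OF M] by auto
  moreover have "?\<kappa> \<noteq> \<infinity>"
    using key[OF M] by (auto simp: ennreal_mult_top split: if_splits)
  moreover have "emeasure M (pbox I x k) * ?\<kappa> = emeasure N (pbox I x k) * ?\<kappa>"
    using key[OF M] key[OF N] by simp
  ultimately show "emeasure M (pbox I x k) = emeasure N (pbox I x k)"
    by (simp add: mult.commute[of _ ?\<kappa>] ennreal_mult_cancel_left)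
  show "emeasure M (pbox I x k) \<noteq> \<infinity>"
    using key[OF M] \<open>?\<kappa> \<noteq> 0\<close> by (auto simp: ennreal_top_mult)
qed

text \<open>Coordinatewise nestedness makes the intersection of two boxes a box or empty, so the
  boxes give an intersection-stable generator, on which \<open>translation_invariant_box_eq\<close>
  forces agreement.\<close>

lemma translation_invariant_unique:
  fixes M N :: "('i \<Rightarrow> 'p::prime_card padic) measure"
  assumes I: "finite I"
    and M: "sets M = sets (PiM I (\<lambda>_. borel))" "\<And>w. w \<in> space M \<Longrightarrow> distr M M (translate_on I w) = M"
      "emeasure M (\<Pi>\<^sub>E i\<in>I. padic_ints) = 1"
    and N: "sets N = sets (PiM I (\<lambda>_. borel))" "\<And>w. w \<in> space N \<Longrightarrow> distr N N (translate_on I w) = N"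
      "emeasure N (\<Pi>\<^sub>E i\<in>I. padic_ints) = 1"
  shows "M = N"
proof -
  \<comment> \<open>The generator in the shape that \<open>sets_PiM_sigma\<close> produces, with the
    finite set I covered by itself.\<close>
  let ?B = "{{f \<in> \<Pi>\<^sub>E i\<in>I. UNIV. \<forall>i\<in>j. f i \<in> A i} | A j. j \<in> {I} \<and> A \<in> Pi j (\<lambda>_. pballs_from 0 :: 'p padic set set)}"
  let ?E = "insert {} (range (\<lambda>(x, k). pbox I x k)) :: ('i \<Rightarrow> 'p padic) set set"
  have cov: "\<Union> (pballs_from 0) = (UNIV :: 'p padic set)"
  proof -
    have "x \<in> \<Union> (pballs_from 0)" for x :: "'p padic"
      using pball_radius_pos[of "- int 0", where 'p='p] by (auto simp: pballs_from_def intro!: bexI[of _ 0] exI[of _ x])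
    thus ?thesis by blast
  qed
  have B: "?B = range (\<lambda>(x, k). pbox I x k)"
  proof (rule antisym; rule subsetI)
    fix b assume "b \<in> ?B"
    then obtain A where A: "A \<in> Pi I (\<lambda>_. pballs_from 0)" "b = {f \<in> \<Pi>\<^sub>E i\<in>I. UNIV. \<forall>i\<in>I. f i \<in> A i}"
      by blast
    have "\<forall>i\<in>I. \<exists>x k. A i = pball x k" using A(1) unfolding Pi_iff pballs_from_iff by blast
    then obtain x k where xk: "\<And>i. i \<in> I \<Longrightarrow> A i = pball (x i) (k i)" by metis
    have "b = pbox I x k" unfolding A(2) pbox_def using xk by (auto simp: PiE_iff extensional_def)
    thus "b \<in> range (\<lambda>(x, k). pbox I x k)" by blast
  next
    fix b :: "('i \<Rightarrow> 'p padic) set" assume "b \<in> range (\<lambda>(x, k). pbox I x k)"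
    then obtain x k where b: "b = pbox I x k" by auto
    have "b = {f \<in> \<Pi>\<^sub>E i\<in>I. UNIV. \<forall>i\<in>I. f i \<in> pball (x i) (k i)}"
      unfolding b pbox_def by (auto simp: PiE_iff extensional_def)
    moreover have "(\<lambda>i. pball (x i) (k i)) \<in> Pi I (\<lambda>_. pballs_from 0)"
      unfolding pballs_from_def by blast
    ultimately show "b \<in> ?B"
      by (intro CollectI exI[of _ "\<lambda>i. pball (x i) (k i)"] exI[of _ I] conjI) simp_all
  qed
  have "sets (PiM I (\<lambda>_. borel :: 'p padic measure)) = sets (PiM I (\<lambda>_. sigma UNIV (pballs_from 0 :: 'p padic set set)))"
    by (simp only: borel_padic_eq[of 0, symmetric])
  also have "\<dots> = sets (sigma (\<Pi>\<^sub>E i\<in>I. UNIV) ?B)"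
  proof (rule sets_PiM_sigma)
    show "\<exists>S\<subseteq>pballs_from 0 :: 'p padic set set. countable S \<and> UNIV = \<Union> S" if "i \<in> I" for i
      using cov countable_pballs_from[of 0, where 'a='p] by (intro exI[of _ "pballs_from 0"]) auto
  qed (use I in auto)
  also have "\<dots> = sigma_sets (\<Pi>\<^sub>E i\<in>I. UNIV) ?E"
    unfolding B sigma_sets_insert_empty by (rule sets_measure_of) (auto simp: pbox_def PiE_iff extensional_def)
  finally have gen: "sets (PiM I (\<lambda>_. borel :: 'p padic measure)) = sigma_sets (\<Pi>\<^sub>E i\<in>I. UNIV) ?E" .
  have eq1: "emeasure M (pbox I x k) = emeasure N (pbox I x k)" for x k
    by (rule translation_invariant_box_eq(1)[OF I M(1) _ M(3) N(1) _ N(3)]) (simp_all add: M(2) N(2))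
  have eq2: "emeasure M (pbox I x k) \<noteq> \<infinity>" for x k
    by (rule translation_invariant_box_eq(2)[OF I M(1) _ M(3) N(1) _ N(3)]) (simp_all add: M(2) N(2))
  note eq = eq1 eq2
  show ?thesis
  proof (rule measure_eqI_generator_eq_countable)
    show "Int_stable ?E"
    proof (rule Int_stableI)
      fix a b assume "a \<in> ?E" "b \<in> ?E"
      then consider "a \<inter> b = {}" | x y k l where "a = pbox I x k" "b = pbox I y l" by auto
      thus "a \<inter> b \<in> ?E"
      proof cases
        case 2
        show ?thesis
        proof (cases "\<forall>i\<in>I. pball (x i) (k i) \<inter> pball (y i) (l i) \<noteq> {}")
          case True
          have "\<exists>v m. pball (x i) (k i) \<inter> pball (y i) (l i) = pball v m" if i: "i \<in> I" for i
          proof (cases "real CARD('p) powi (- int (k i)) \<le> real CARD('p) powi (- int (l i))")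
            case le: True
            hence "pball (x i) (k i) \<subseteq> pball (y i) (l i)"
              using True i by (intro cball_padic_Int) auto
            thus ?thesis by (intro exI[of _ "x i"] exI[of _ "k i"]) auto
          next
            case le: False
            hence "pball (y i) (l i) \<subseteq> pball (x i) (k i)"
              using True i by (intro cball_padic_Int) (auto simp: Int_commute)
            thus ?thesis by (intro exI[of _ "y i"] exI[of _ "l i"]) auto
          qed
          hence "\<forall>i. \<exists>v m. i \<in> I \<longrightarrow> pball (x i) (k i) \<inter> pball (y i) (l i) = pball v m" by blast
          then obtain v m where vm: "\<And>i. i \<in> I \<Longrightarrow> pball (x i) (k i) \<inter> pball (y i) (l i) = pball (v i) (m i)"
            by metis
          have "a \<inter> b = (\<Pi>\<^sub>E i\<in>I. pball (x i) (k i) \<inter> pball (y i) (l i))"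
            unfolding 2 pbox_def by (rule PiE_Int)
          also have "\<dots> = pbox I v m" unfolding pbox_def by (rule PiE_cong) (rule vm)
          finally show ?thesis by auto
        next
          case False
          then obtain i where i: "i \<in> I" "pball (x i) (k i) \<inter> pball (y i) (l i) = {}" by blast
          have "a \<inter> b = {}"
          proof (rule ccontr)
            assume "a \<inter> b \<noteq> {}"
            then obtain f where "f \<in> pbox I x k" "f \<in> pbox I y l" using 2 by blast
            hence "f i \<in> pball (x i) (k i) \<inter> pball (y i) (l i)" using i(1) unfolding pbox_def by blast
            thus False using i(2) by blast
          qed
          thus ?thesis by simp
        qed
      qed simp
    qed
    show "?E \<subseteq> Pow (\<Pi>\<^sub>E i\<in>I. UNIV)" by (auto simp: pbox_def PiE_iff extensional_def)
    show "sets M = sigma_sets (\<Pi>\<^sub>E i\<in>I. UNIV) ?E" "sets N = sigma_sets (\<Pi>\<^sub>E i\<in>I. UNIV) ?E"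
      unfolding M(1) N(1) by (rule gen)+
    show "emeasure M X = emeasure N X" if "X \<in> ?E" for X
      using that eq by auto
    let ?A = "PiE I ` (\<Pi>\<^sub>E i\<in>I. pballs_from 0 :: 'p padic set set)"
    have A: "?A \<subseteq> range (\<lambda>(x, k). pbox I x k)"
    proof
      fix a assume "a \<in> ?A"
      then obtain A where A: "A \<in> (\<Pi>\<^sub>E i\<in>I. pballs_from 0)" "a = PiE I A" by blast
      have "\<forall>i\<in>I. \<exists>x k. A i = pball x k" using A(1) unfolding PiE_iff pballs_from_iff by blast
      then obtain x k where xk: "\<And>i. i \<in> I \<Longrightarrow> A i = pball (x i) (k i)" by metis
      have "a = pbox I x k" unfolding A(2) pbox_def by (rule PiE_cong) (rule xk)
      thus "a \<in> range (\<lambda>(x, k). pbox I x k)" by auto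
    qed
    thus "?A \<subseteq> ?E" by blast
    show "countable ?A" by (intro countable_image countable_PiE I countable_pballs_from)
    show "emeasure M X \<noteq> \<infinity>" if X: "X \<in> ?A" for X
    proof -
      obtain x k where "X = pbox I x k" using subsetD[OF A X] by auto
      thus ?thesis using eq2[of x k] by simp
    qed
    show "\<Union> ?A = (\<Pi>\<^sub>E i\<in>I. UNIV)"
    proof (rule antisym; rule subsetI)
      fix f :: "'i \<Rightarrow> 'p padic" assume f: "f \<in> (\<Pi>\<^sub>E i\<in>I. UNIV)"
      have "pball (f i) 0 \<in> pballs_from 0" for i unfolding pballs_from_iff by blast
      hence "(\<lambda>i\<in>I. pball (f i) 0) \<in> (\<Pi>\<^sub>E i\<in>I. pballs_from 0)" by auto
      moreover have "f \<in> PiE I (\<lambda>i\<in>I. pball (f i) 0)" using f by (auto simp: PiE_iff)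
      ultimately show "f \<in> \<Union> ?A" by (meson UnionI imageI)
    qed (auto simp: PiE_iff extensional_def)
  qed
qed

text \<open>The product measure witnesses existence in the description of \<open>vol\<close>, and
  the preceding uniqueness identifies the two.\<close>

lemma vol_eq_haar_PiM: "(vol n :: (nat \<times> nat \<Rightarrow> 'p::prime_card padic) measure) = haar_PiM (mat_idx n)"
proof -
  let ?H = "haar_PiM (mat_idx n) :: (nat \<times> nat \<Rightarrow> 'p padic) measure"
  have I: "finite (mat_idx n)" by (simp add: mat_idx_def)
  have alg: "sets (mat_algebra n) = sets (PiM (mat_idx n) (\<lambda>_. borel :: 'p padic measure))"
    by (simp add: mat_algebra_def)
  have tr: "translate_on (mat_idx n) w = (\<lambda>z. \<lambda>ij\<in>mat_idx n. z ij + w ij)" for w :: "nat \<times> nat \<Rightarrow> 'p padic"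
    by (simp add: translate_on_def fun_eq_iff)
  have H: "sets ?H = sets (PiM (mat_idx n) (\<lambda>_. borel))"
    "\<And>w. w \<in> space ?H \<Longrightarrow> distr ?H ?H (translate_on (mat_idx n) w) = ?H"
    "emeasure ?H (\<Pi>\<^sub>E ij\<in>mat_idx n. padic_ints) = 1"
  proof -
    have "emeasure ?H (\<Pi>\<^sub>E ij\<in>mat_idx n. padic_ints) = (\<Prod>ij\<in>mat_idx n. emeasure haar (padic_ints :: 'p padic set))"
      by (rule haar_product.emeasure_PiM[OF I]) (simp add: padic_ints_eq_cball)
    thus "emeasure ?H (\<Pi>\<^sub>E ij\<in>mat_idx n. padic_ints) = 1" by simp
  qed (simp_all add: sets_haar_PiM haar_PiM_translate[OF I])
  show ?thesis
    unfolding vol_def alg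
  proof (rule the_equality)
    show "sets ?H = sets (PiM (mat_idx n) (\<lambda>_. borel)) \<and>
        (\<forall>w\<in>space ?H. distr ?H ?H (\<lambda>z. \<lambda>ij\<in>mat_idx n. z ij + w ij) = ?H) \<and>
        emeasure ?H (\<Pi>\<^sub>E ij\<in>mat_idx n. padic_ints) = 1"
      using H unfolding tr by blast
    fix V :: "(nat \<times> nat \<Rightarrow> 'p padic) measure"
    assume "sets V = sets (PiM (mat_idx n) (\<lambda>_. borel)) \<and>
        (\<forall>w\<in>space V. distr V V (\<lambda>z. \<lambda>ij\<in>mat_idx n. z ij + w ij) = V) \<and>
        emeasure V (\<Pi>\<^sub>E ij\<in>mat_idx n. padic_ints) = 1"
    hence V: "sets V = sets (PiM (mat_idx n) (\<lambda>_. borel))"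
      "\<And>w. w \<in> space V \<Longrightarrow> distr V V (translate_on (mat_idx n) w) = V"
      "emeasure V (\<Pi>\<^sub>E ij\<in>mat_idx n. padic_ints) = 1"
      unfolding tr by auto
    show "V = ?H"
      by (rule translation_invariant_unique[OF I V(1) _ V(3) H(1) _ H(3)]) (simp_all only: V(2) H(2))
  qed
qed

section \<open>Maximal minors of the graph of a matrix\<close>

text \<open>The rows span the graph of z, a point of a Grassmannian on which GL(2n) acts linearly
  from the right. This linearises the fractional linear action.\<close>

definition graph_mat :: "'a::comm_ring_1 mat \<Rightarrow> 'a mat" where
  "graph_mat z = Matrix.mat (dim_row z) (2 * dim_row z)
     (\<lambda>(i, j). if j < dim_row z then (if i = j then 1 else 0) else z $$ (i, j - dim_row z))"

definition left_block :: "'a mat \<Rightarrow> 'a mat" where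
  "left_block M = Matrix.mat (dim_row M) (dim_row M) (\<lambda>(i, j). M $$ (i, j))"

definition right_block :: "'a mat \<Rightarrow> 'a mat" where
  "right_block M = Matrix.mat (dim_row M) (dim_row M) (\<lambda>(i, j). M $$ (i, dim_row M + j))"

lemma graph_mat_carrier [simp]: "z \<in> carrier_mat n n \<Longrightarrow> graph_mat z \<in> carrier_mat n (2 * n)"
  by (auto simp: graph_mat_def)

lemma block_carrier [simp]:
  "M \<in> carrier_mat n m \<Longrightarrow> left_block M \<in> carrier_mat n n"
  "M \<in> carrier_mat n m \<Longrightarrow> right_block M \<in> carrier_mat n n"
  by (auto simp: left_block_def right_block_def)

lemma graph_mat_mult_index:
  assumes z: "z \<in> carrier_mat n n" and g: "g \<in> carrier_mat (2 * n) m" and ij: "i < n" "j < m"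
  shows "(graph_mat z * g) $$ (i, j) = g $$ (i, j) + (\<Sum>l<n. z $$ (i, l) * g $$ (n + l, j))"
proof -
  let ?G = "\<lambda>k. (if k < n then (if i = k then 1 else 0) else z $$ (i, k - n)) * g $$ (k, j)"
  have "(graph_mat z * g) $$ (i, j) = (\<Sum>k = 0..<2 * n. graph_mat z $$ (i, k) * g $$ (k, j))"
    using graph_mat_carrier[OF z] g ij by (simp add: scalar_prod_def)
  also have "\<dots> = (\<Sum>k = 0..<n + n. ?G k)"
    using z ij by (intro sum.cong) (auto simp: graph_mat_def)
  also have "\<dots> = (\<Sum>k = 0..<n. ?G k) + (\<Sum>k = n..<n + n. ?G k)"
    by (rule sum.atLeastLessThan_concat[symmetric]) simp_all
  also have "(\<Sum>k = 0..<n. ?G k) = (\<Sum>k = 0..<n. if i = k then g $$ (k, j) else 0)"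
    by (rule sum.cong) auto
  also have "\<dots> = g $$ (i, j)" using ij by simp
  also have "(\<Sum>k = n..<n + n. ?G k) = (\<Sum>l<n. z $$ (i, l) * g $$ (n + l, j))"
    using sum.shift_bounds_nat_ivl[of ?G 0 n n] by (simp add: lessThan_atLeast0 add.commute)
  finally show ?thesis .
qed

lemma mult_graph_mat_index:
  assumes A: "A \<in> carrier_mat m n" and w: "w \<in> carrier_mat n n" and ij: "i < m" "j < 2 * n"
  shows "(A * graph_mat w) $$ (i, j) = (if j < n then A $$ (i, j) else (A * w) $$ (i, j - n))"
proof -
  have "(A * graph_mat w) $$ (i, j) = (\<Sum>k = 0..<n. A $$ (i, k) * graph_mat w $$ (k, j))"
    using graph_mat_carrier[OF w] A ij by (simp add: scalar_prod_def)
  also have "\<dots> = (if j < n then A $$ (i, j) else (A * w) $$ (i, j - n))"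
  proof (cases "j < n")
    case True
    have "(\<Sum>k = 0..<n. A $$ (i, k) * graph_mat w $$ (k, j)) = (\<Sum>k = 0..<n. if j = k then A $$ (i, k) else 0)"
      using True w ij by (intro sum.cong) (auto simp: graph_mat_def)
    thus ?thesis using True by simp
  next
    case False
    have "(\<Sum>k = 0..<n. A $$ (i, k) * graph_mat w $$ (k, j)) = (\<Sum>k = 0..<n. A $$ (i, k) * w $$ (k, j - n))"
      using False w ij by (intro sum.cong) (auto simp: graph_mat_def)
    thus ?thesis using False A w ij by (simp add: scalar_prod_def)
  qed
  finally show ?thesis .
qed

lemma eq_mult_graph_mat:
  assumes M: "M \<in> carrier_mat n (2 * n)" and w: "w \<in> carrier_mat n n"
    and eq: "right_block M = left_block M * w"
  shows "M = left_block M * graph_mat w"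
proof (rule eq_matI)
  have L: "left_block M \<in> carrier_mat n n" using M by simp
  have d: "dim_row (left_block M * graph_mat w) = n" "dim_col (left_block M * graph_mat w) = 2 * n"
    using L graph_mat_carrier[OF w] by simp_all
  show "dim_row M = dim_row (left_block M * graph_mat w)" "dim_col M = dim_col (left_block M * graph_mat w)"
    using M unfolding d by simp_all
  fix i j assume "i < dim_row (left_block M * graph_mat w)" "j < dim_col (left_block M * graph_mat w)"
  hence ij: "i < n" "j < 2 * n" by (simp_all only: d)
  have "(left_block M * graph_mat w) $$ (i, j)
      = (if j < n then left_block M $$ (i, j) else right_block M $$ (i, j - n))"
    unfolding eq by (rule mult_graph_mat_index[OF L w ij])
  also have "\<dots> = M $$ (i, j)" using M ij by (auto simp: left_block_def right_block_def)
  finally show "M $$ (i, j) = (left_block M * graph_mat w) $$ (i, j)" ..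
qed

lemma left_block_mult_graph:
  assumes A: "A \<in> carrier_mat n n" and w: "w \<in> carrier_mat n n"
  shows "left_block (A * graph_mat w) = A" and "right_block (A * graph_mat w) = A * w"
proof -
  have d: "dim_row (A * graph_mat w) = n" using A by simp
  show "left_block (A * graph_mat w) = A"
    using A by (intro eq_matI) (auto simp: left_block_def d mult_graph_mat_index[OF A w] simp del: index_mult_mat(1))
  show "right_block (A * graph_mat w) = A * w"
    using A w by (intro eq_matI) (auto simp: right_block_def d mult_graph_mat_index[OF A w] simp del: index_mult_mat(1))
qed

lemma left_block_mult:
  assumes A: "A \<in> carrier_mat n n" and M: "M \<in> carrier_mat n (2 * n)"
  shows "left_block (A * M) = A * left_block M" "right_block (A * M) = A * right_block M"
  using A M by (auto intro!: eq_matI simp: left_block_def right_block_def scalar_prod_def)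

lemma block_index:
  assumes "M \<in> carrier_mat n m" "i < n" "j < n"
  shows "left_block M $$ (i, j) = M $$ (i, j)" "right_block M $$ (i, j) = M $$ (i, n + j)"
  using assms by (auto simp: left_block_def right_block_def)

text \<open>The column selection is an arbitrary function. Repetitions give 0 and permutations a
  sign, so the largest norm is unaffected, and the multilinear expansion of a product runs over all
  functions. The selected columns are written as rows because \<open>det\<close> is expanded in its
  rows.\<close>

definition minor :: "'a::comm_ring_1 mat \<Rightarrow> (nat \<Rightarrow> nat) \<Rightarrow> 'a" where
  "minor M f = det (mat\<^sub>r (dim_row M) (dim_row M) (\<lambda>k. col M (f k)))"

text \<open>The maximum norm of the vector of Pluecker coordinates.\<close>

definition minor_max :: "'p::prime_card padic mat \<Rightarrow> real" where
  "minor_max M = Max ((\<lambda>f. padic_norm (minor M f)) ` ({..<dim_row M} \<rightarrow>\<^sub>E {..<dim_col M}))"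

lemma finite_minor_index: "finite ({..<n :: nat} \<rightarrow>\<^sub>E {..<m :: nat})"
  by (intro finite_PiE) auto

lemma minor_restrict:
  "M \<in> carrier_mat n m \<Longrightarrow> minor M (restrict f {..<n}) = minor M f"
  unfolding minor_def by (intro arg_cong[of _ _ det] eq_rowI) auto

lemma minor_le_minor_max:
  assumes M: "M \<in> carrier_mat n m" and f: "\<And>k. k < n \<Longrightarrow> f k < m"
  shows "padic_norm (minor M f :: 'p::prime_card padic) \<le> minor_max M"
proof -
  have "padic_norm (minor M (restrict f {..<n})) \<le> minor_max M"
    unfolding minor_max_def
  proof (rule Max_ge[OF finite_imageI[OF finite_minor_index] imageI])
    show "restrict f {..<n} \<in> {..<dim_row M} \<rightarrow>\<^sub>E {..<dim_col M}"
      unfolding carrier_matD[OF M] using f by (intro restrict_PiE_iff[THEN iffD2]) simp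
  qed
  thus ?thesis using minor_restrict[OF M] by simp
qed

lemma minor_max_attained:
  assumes M: "M \<in> carrier_mat n m" and nm: "n = 0 \<or> m > 0"
  obtains f where "\<And>k. k < n \<Longrightarrow> f k < m" "minor_max M = padic_norm (minor M f :: 'p::prime_card padic)"
proof -
  have ne: "{..<n} \<rightarrow>\<^sub>E {..<m} \<noteq> {}" using nm by (auto simp: PiE_eq_empty_iff)
  hence "minor_max M \<in> (\<lambda>f. padic_norm (minor M f)) ` ({..<n} \<rightarrow>\<^sub>E {..<m})"
    unfolding minor_max_def carrier_matD[OF M]
    by (intro Max_in finite_imageI finite_minor_index) simp
  then obtain f where f: "f \<in> {..<n} \<rightarrow>\<^sub>E {..<m}" "minor_max M = padic_norm (minor M f)" by blast
  show ?thesis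
  proof (rule that[OF _ f(2)])
    show "f k < m" if "k < n" for k using f(1) that by auto
  qed
qed

lemma minor_max_nonneg:
  assumes M: "(M :: 'p::prime_card padic mat) \<in> carrier_mat n m" and nm: "n = 0 \<or> m > 0"
  shows "minor_max M \<ge> 0"
proof -
  obtain f where "minor_max M = padic_norm (minor M f)" by (rule minor_max_attained[OF M nm])
  thus ?thesis by simp
qed

text \<open>The selected columns of A M are A times the selected columns of M; with columns laid out
  as rows this becomes a right factor \<open>transpose_mat A\<close>.\<close>

lemma minor_mult_left:
  assumes A: "A \<in> carrier_mat n n" and M: "M \<in> carrier_mat n m" and f: "\<And>k. k < n \<Longrightarrow> f k < m"
  shows "minor (A * M) f = det A * minor M f"
proof -
  let ?X = "mat\<^sub>r n n (\<lambda>k. col M (f k))"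
  have X: "?X \<in> carrier_mat n n" by simp
  have "mat\<^sub>r n n (\<lambda>k. col (A * M) (f k)) = ?X * transpose_mat A"
  proof (rule eq_matI)
    fix i j assume "i < dim_row (?X * transpose_mat A)" "j < dim_col (?X * transpose_mat A)"
    hence ij: "i < n" "j < n" using A by auto
    have fi: "f i < m" using f ij by simp
    show "mat\<^sub>r n n (\<lambda>k. col (A * M) (f k)) $$ (i, j) = (?X * transpose_mat A) $$ (i, j)"
      using A M ij fi by (simp add: scalar_prod_def mult.commute)
  qed (use A in auto)
  hence "minor (A * M) f = det (?X * transpose_mat A)"
    using A by (simp add: minor_def)
  also have "\<dots> = det ?X * det A"
    using det_mult[OF X, of "transpose_mat A"] A det_transpose[OF A] by simp
  finally show ?thesis using M by (simp add: minor_def mult.commute)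
qed

lemma minor_max_mult_left:
  assumes A: "(A :: 'p::prime_card padic mat) \<in> carrier_mat n n" and M: "M \<in> carrier_mat n m"
    and nm: "n = 0 \<or> m > 0"
  shows "minor_max (A * M) = padic_norm (det A) * minor_max M"
proof (rule antisym)
  have AM: "A * M \<in> carrier_mat n m" using A M by simp
  obtain f where f: "\<And>k. k < n \<Longrightarrow> f k < m" "minor_max (A * M) = padic_norm (minor (A * M) f)"
    using minor_max_attained[OF AM nm] by metis
  show "minor_max (A * M) \<le> padic_norm (det A) * minor_max M"
    using minor_le_minor_max[OF M f(1)]
    by (simp add: f(2) minor_mult_left[OF A M f(1)] padic_norm_mult mult_left_mono)
  obtain h where h: "\<And>k. k < n \<Longrightarrow> h k < m" "minor_max M = padic_norm (minor M h)"
    using minor_max_attained[OF M nm] by metis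
  have "padic_norm (det A) * minor_max M = padic_norm (minor (A * M) h)"
    by (simp add: h(2) minor_mult_left[OF A M h(1)] padic_norm_mult)
  also have "\<dots> \<le> minor_max (A * M)" by (rule minor_le_minor_max[OF AM h(1)])
  finally show "padic_norm (det A) * minor_max M \<le> minor_max (A * M)" .
qed

text \<open>By multilinearity, the minors of \<open>M g\<close> are integral combinations of those of \<open>M\<close>.\<close>

lemma minor_max_mult_right:
  assumes M: "(M :: 'p::prime_card padic mat) \<in> carrier_mat n m" and g: "g \<in> carrier_mat m m"
    and int: "\<And>i j. i < m \<Longrightarrow> j < m \<Longrightarrow> g $$ (i, j) \<in> padic_ints" and nm: "n = 0 \<or> m > 0"
  shows "minor_max (M * g) \<le> minor_max M"
proof -
  have Mg: "M * g \<in> carrier_mat n m" using M g by simp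
  obtain f where f: "\<And>k. k < n \<Longrightarrow> f k < m" "minor_max (M * g) = padic_norm (minor (M * g) f)"
    using minor_max_attained[OF Mg nm] by metis
  let ?a = "\<lambda>k l. g $$ (l, f k) \<cdot>\<^sub>v col M l"
  \<comment> \<open>Functions extended by the identity, so that every selection of n columns occurs
    exactly once in the expansion.\<close>
  let ?F = "{h. (\<forall>i\<in>{0..<n}. h i \<in> {..<m}) \<and> (\<forall>i. i \<notin> {0..<n} \<longrightarrow> h i = i)}"
  have a: "?a \<in> {0..<n} \<rightarrow> {..<m} \<rightarrow> carrier_vec n"
    using M by auto
  have "mat\<^sub>r n n (\<lambda>k. col (M * g) (f k)) = mat\<^sub>r n n (\<lambda>k. finsum_vec TYPE('p padic) n (?a k) {..<m})"
  proof (rule eq_rowI)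
    fix k assume "k < dim_row (mat\<^sub>r n n (\<lambda>k. finsum_vec TYPE('p padic) n (?a k) {..<m}))"
    hence k: "k < n" by simp
    have c: "col (M * g) (f k) \<in> carrier_vec n" by (rule col_carrier_vec[OF f(1)[OF k] Mg])
    have s: "finsum_vec TYPE('p padic) n (?a k) {..<m} \<in> carrier_vec n"
      using a k by (intro finsum_vec_closed) auto
    have "col (M * g) (f k) = finsum_vec TYPE('p padic) n (?a k) {..<m}"
    proof (rule eq_vecI)
      show "dim_vec (col (M * g) (f k)) = dim_vec (finsum_vec TYPE('p padic) n (?a k) {..<m})"
        unfolding carrier_vecD[OF c] carrier_vecD[OF s] ..
      fix i assume "i < dim_vec (finsum_vec TYPE('p padic) n (?a k) {..<m})"
      hence i: "i < n" unfolding carrier_vecD[OF s] .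
      have "finsum_vec TYPE('p padic) n (?a k) {..<m} $ i = (\<Sum>l<m. ?a k l $ i)"
        using a k by (intro index_finsum_vec i) auto
      also have "\<dots> = (\<Sum>l<m. g $$ (l, f k) * M $$ (i, l))"
        using M i by (intro sum.cong) auto
      finally show "col (M * g) (f k) $ i = finsum_vec TYPE('p padic) n (?a k) {..<m} $ i"
        using M g i f(1)[OF k] by (simp add: scalar_prod_def lessThan_atLeast0 mult.commute)
    qed
    thus "row (mat\<^sub>r n n (\<lambda>k. col (M * g) (f k))) k
        = row (mat\<^sub>r n n (\<lambda>k. finsum_vec TYPE('p padic) n (?a k) {..<m})) k"
      using k c s by simp
  qed auto
  hence "minor (M * g) f = det (mat\<^sub>r n n (\<lambda>k. finsum_vec TYPE('p padic) n (?a k) {..<m}))"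
    using M by (simp add: minor_def)
  also have "\<dots> = (\<Sum>h\<in>?F. det (mat\<^sub>r n n (\<lambda>k. ?a k (h k))))"
    by (rule det_linear_rows_sum[OF _ a]) simp
  also have "\<dots> = (\<Sum>h\<in>?F. (\<Prod>k = 0..<n. g $$ (h k, f k)) * minor M h)"
    using M by (intro sum.cong refl, subst det_rows_mul) (auto simp: minor_def)
  finally have eq: "minor (M * g) f = (\<Sum>h\<in>?F. (\<Prod>k = 0..<n. g $$ (h k, f k)) * minor M h)" .
  show ?thesis unfolding f(2) eq
  proof (rule padic_norm_sum_le[OF _ minor_max_nonneg[OF M nm]])
    fix h assume h: "h \<in> ?F"
    have "(\<Prod>k = 0..<n. padic_norm (g $$ (h k, f k))) \<le> (\<Prod>k = 0..<n. 1)"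
      using h f(1) int by (intro prod_mono) (auto simp: padic_ints_def)
    hence "padic_norm (\<Prod>k = 0..<n. g $$ (h k, f k)) * padic_norm (minor M h) \<le> 1 * minor_max M"
      using h by (intro mult_mono minor_le_minor_max[OF M]) (auto simp: padic_norm_prod)
    thus "padic_norm ((\<Prod>k = 0..<n. g $$ (h k, f k)) * minor M h) \<le> minor_max M"
      by (simp add: padic_norm_mult)
  qed
qed

text \<open>A non-archimedean Hadamard bound: every Leibniz term takes one entry from each column,
  and a sum is no larger than its largest term, so no factor n! arises.\<close>

lemma padic_norm_det_le:
  assumes A: "(A :: 'p::prime_card padic mat) \<in> carrier_mat n n"
    and le: "\<And>i j. i < n \<Longrightarrow> j < n \<Longrightarrow> padic_norm (A $$ (i, j)) \<le> C j"
  shows "padic_norm (det A) \<le> (\<Prod>j<n. C j)"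
proof (cases "n = 0")
  case True
  thus ?thesis using A by simp
next
  case False
  have C: "C j \<ge> 0" if "j < n" for j
    using le[OF _ that, of 0] False padic_norm_nonneg[of "A $$ (0, j)"] by linarith
  show ?thesis unfolding det_col[OF A]
  proof (rule padic_norm_sum_le)
    fix p assume "p \<in> {p. p permutes {0..<n}}"
    hence p: "\<And>j. j < n \<Longrightarrow> p j < n" using permutes_in_image[of p "{0..<n}"] by auto
    have "padic_norm (signof p :: 'p padic) = 1" by (auto simp: sign_def)
    hence "padic_norm (signof p * (\<Prod>j<n. A $$ (p j, j))) = (\<Prod>j<n. padic_norm (A $$ (p j, j)))"
      by (simp add: padic_norm_mult padic_norm_prod)
    also have "\<dots> \<le> (\<Prod>j<n. C j)" using p le by (intro prod_mono) auto
    finally show "padic_norm (signof p * (\<Prod>j<n. A $$ (p j, j))) \<le> (\<Prod>j<n. C j)" .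
  qed (use C in \<open>auto intro: prod_nonneg\<close>)
qed

lemma det_mat_diag: "det (mat_diag n d :: 'a::comm_ring_1 mat) = (\<Prod>i<n. d i)"
proof -
  have "upper_triangular (mat_diag n d)" by (auto simp: mat_diag_def)
  hence "det (mat_diag n d) = prod_list (diag_mat (mat_diag n d))"
    by (rule det_upper_triangular[OF _ mat_diag_dim])
  also have "\<dots> = (\<Prod>i = 0..<n. mat_diag n d $$ (i, i))"
    using prod_list_diag_prod[of "mat_diag n d"] by (simp add: mat_diag_def)
  also have "\<dots> = (\<Prod>i<n. d i)" by (simp add: mat_diag_def lessThan_atLeast0)
  finally show ?thesis .
qed

text \<open>For the upper bound, the entries of row j of (1 | D) are 0, 1 or d j, and every term of
  a minor uses each row once. The bound is attained by choosing, for every k, column k of whichever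
  block carries the larger entry.\<close>

lemma minor_max_graph_diag:
  "minor_max (graph_mat (mat_diag n d :: 'p::prime_card padic mat)) = (\<Prod>i<n. max 1 (padic_norm (d i)))"
proof (rule antisym)
  let ?M = "graph_mat (mat_diag n d :: 'p padic mat)"
  have M: "?M \<in> carrier_mat n (2 * n)" by simp
  have ent: "?M $$ (i, j) = (if j < n then if i = j then 1 else 0 else if i = j - n then d i else 0)"
    if "i < n" "j < 2 * n" for i j
    using that by (auto simp: graph_mat_def mat_diag_def)
  have nm: "n = 0 \<or> 2 * n > 0" by auto
  obtain f where f: "\<And>k. k < n \<Longrightarrow> f k < 2 * n" "minor_max ?M = padic_norm (minor ?M f)"
    using minor_max_attained[OF M nm] by metis
  have row: "mat\<^sub>r n n (\<lambda>k. col ?M (h k)) $$ (i, j) = ?M $$ (j, h i)"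
    if that: "i < n" "j < n" "h i < 2 * n" for h i j
  proof -
    have "col ?M (h i) $ j = ?M $$ (j, h i)"
      by (rule index_col) (simp_all only: carrier_matD[OF M] that)
    thus ?thesis using that by simp
  qed
  show "minor_max ?M \<le> (\<Prod>i<n. max 1 (padic_norm (d i)))"
    unfolding f(2) minor_def
  proof -
    have "padic_norm (det (mat\<^sub>r n n (\<lambda>k. col ?M (f k)))) \<le> (\<Prod>i<n. max 1 (padic_norm (d i)))"
    proof (rule padic_norm_det_le)
      fix i j assume ij: "i < n" "j < n"
      show "padic_norm (mat\<^sub>r n n (\<lambda>k. col ?M (f k)) $$ (i, j)) \<le> max 1 (padic_norm (d j))"
        unfolding row[where h = f, OF ij f(1)[OF ij(1)]] ent[OF ij(2) f(1)[OF ij(1)]] by auto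
    qed simp
    thus "padic_norm (det (mat\<^sub>r (dim_row ?M) (dim_row ?M) (\<lambda>k. col ?M (f k)))) \<le> (\<Prod>i<n. max 1 (padic_norm (d i)))"
      unfolding carrier_matD(1)[OF M] .
  qed
  define h where "h k = (if padic_norm (d k) \<le> 1 then k else n + k)" for k
  have h: "h k < 2 * n" if "k < n" for k using that by (auto simp: h_def)
  have "mat\<^sub>r n n (\<lambda>k. col ?M (h k)) = mat_diag n (\<lambda>k. if padic_norm (d k) \<le> 1 then 1 else d k)"
  proof (rule eq_matI)
    fix i j assume "i < dim_row (mat_diag n (\<lambda>k. if padic_norm (d k) \<le> 1 then 1 else d k))"
      "j < dim_col (mat_diag n (\<lambda>k. if padic_norm (d k) \<le> 1 then 1 else d k))"
    hence ij: "i < n" "j < n" by (simp_all add: mat_diag_def)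
    show "mat\<^sub>r n n (\<lambda>k. col ?M (h k)) $$ (i, j) = mat_diag n (\<lambda>k. if padic_norm (d k) \<le> 1 then 1 else d k) $$ (i, j)"
      unfolding row[where h = h, OF ij h[OF ij(1)]] ent[OF ij(2) h[OF ij(1)]] using ij by (auto simp: h_def mat_diag_def)
  qed (simp_all add: mat_diag_def)
  hence "minor ?M h = (\<Prod>k<n. if padic_norm (d k) \<le> 1 then 1 else d k)"
    unfolding minor_def carrier_matD(1)[OF M] by (simp only: det_mat_diag)
  hence eq: "padic_norm (minor ?M h) = (\<Prod>i<n. max 1 (padic_norm (d i)))"
    unfolding padic_norm_prod by (simp add: padic_norm_prod) (intro prod.cong, auto simp: max_def)
  show "(\<Prod>i<n. max 1 (padic_norm (d i))) \<le> minor_max ?M"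
    unfolding eq[symmetric] by (rule minor_le_minor_max[OF M h])
qed

section \<open>Invertible integral matrices and invariance of the largest minor\<close>

lemma GL_padic_ints_iff:
  "A \<in> GL_padic_ints n \<longleftrightarrow> A \<in> carrier_mat n n \<and> (\<forall>i<n. \<forall>j<n. A $$ (i, j) \<in> padic_ints) \<and>
     (\<exists>B\<in>carrier_mat n n. (\<forall>i<n. \<forall>j<n. B $$ (i, j) \<in> padic_ints) \<and> A * B = 1\<^sub>m n \<and> B * A = 1\<^sub>m n)"
proof -
  have "elements_mat X \<subseteq> padic_ints \<longleftrightarrow> (\<forall>i<n. \<forall>j<n. X $$ (i, j) \<in> padic_ints)" if "X \<in> carrier_mat n n" for X :: "'a::prime_card padic mat"
    using that by auto
  thus ?thesis unfolding GL_padic_ints_def by auto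
qed

lemma GL_padic_ints_carrier: "A \<in> GL_padic_ints n \<Longrightarrow> A \<in> carrier_mat n n"
  by (simp add: GL_padic_ints_iff)

lemma GL_padic_ints_entry: "A \<in> GL_padic_ints n \<Longrightarrow> i < n \<Longrightarrow> j < n \<Longrightarrow> A $$ (i, j) \<in> padic_ints"
  by (simp add: GL_padic_ints_iff)

lemma GL_padic_ints_inverse:
  assumes "A \<in> GL_padic_ints n"
  obtains B where "B \<in> GL_padic_ints n" "A * B = 1\<^sub>m n" "B * A = 1\<^sub>m n"
proof -
  obtain B where B: "B \<in> carrier_mat n n" "\<forall>i<n. \<forall>j<n. B $$ (i, j) \<in> padic_ints" "A * B = 1\<^sub>m n" "B * A = 1\<^sub>m n"
    using assms unfolding GL_padic_ints_iff by metis
  have "B \<in> GL_padic_ints n" unfolding GL_padic_ints_iff using B assms[unfolded GL_padic_ints_iff] by metis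
  thus ?thesis using B that by blast
qed

lemma padic_ints_mat_mult:
  assumes "A \<in> carrier_mat n m" "B \<in> carrier_mat m l" "i < n" "j < l"
    and "\<And>i j. i < n \<Longrightarrow> j < m \<Longrightarrow> A $$ (i, j) \<in> padic_ints"
    and "\<And>i j. i < m \<Longrightarrow> j < l \<Longrightarrow> B $$ (i, j) \<in> padic_ints"
  shows "(A * B) $$ (i, j) \<in> (padic_ints :: 'p::prime_card padic set)"
  using assms by (auto simp: scalar_prod_def intro!: padic_ints_sum padic_ints_mult)

lemma GL_padic_ints_mult:
  assumes A: "A \<in> GL_padic_ints n" and B: "B \<in> GL_padic_ints n"
  shows "A * B \<in> GL_padic_ints n"
proof -
  obtain A' where A': "A' \<in> GL_padic_ints n" "A * A' = 1\<^sub>m n" "A' * A = 1\<^sub>m n" by (rule GL_padic_ints_inverse[OF A])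
  obtain B' where B': "B' \<in> GL_padic_ints n" "B * B' = 1\<^sub>m n" "B' * B = 1\<^sub>m n" by (rule GL_padic_ints_inverse[OF B])
  note c = GL_padic_ints_carrier[OF A] GL_padic_ints_carrier[OF B] GL_padic_ints_carrier[OF A'(1)] GL_padic_ints_carrier[OF B'(1)]
  have "(A * B) * (B' * A') = A * (B * B') * A'" using c by (simp add: assoc_mult_mat[of _ n n _ n _ n])
  hence 1: "(A * B) * (B' * A') = 1\<^sub>m n" using c A' B' by simp
  have "(B' * A') * (A * B) = B' * (A' * A) * B" using c by (simp add: assoc_mult_mat[of _ n n _ n _ n])
  hence 2: "(B' * A') * (A * B) = 1\<^sub>m n" using c A' B' by simp
  have i1: "(A * B) $$ (i, j) \<in> padic_ints" if "i < n" "j < n" for i j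
    by (rule padic_ints_mat_mult[OF c(1,2) that GL_padic_ints_entry[OF A] GL_padic_ints_entry[OF B]])
  have i2: "(B' * A') $$ (i, j) \<in> padic_ints" if "i < n" "j < n" for i j
    by (rule padic_ints_mat_mult[OF c(4,3) that GL_padic_ints_entry[OF B'(1)] GL_padic_ints_entry[OF A'(1)]])
  show ?thesis
    unfolding GL_padic_ints_iff using c 1 2 i1 i2
    by (intro conjI bexI[of _ "B' * A'"] allI impI) (simp_all del: index_mult_mat(1))
qed

text \<open>The determinants of A and of its inverse have norm at most 1 and product 1.\<close>

lemma GL_padic_ints_det:
  assumes A: "A \<in> GL_padic_ints n"
  shows "padic_norm (det A) = 1"
proof -
  obtain B where B: "B \<in> GL_padic_ints n" "A * B = 1\<^sub>m n" by (rule GL_padic_ints_inverse[OF A])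
  have le: "padic_norm (det X) \<le> 1" if "X \<in> GL_padic_ints n" for X :: "'a padic mat"
    using padic_norm_det_le[OF GL_padic_ints_carrier[OF that], of "\<lambda>_. 1"] GL_padic_ints_entry[OF that]
    by (simp add: padic_ints_def)
  have "det A * det B = 1"
    using det_mult[OF GL_padic_ints_carrier[OF A] GL_padic_ints_carrier[OF B(1)]] B(2) by simp
  hence "padic_norm (det A) * padic_norm (det B) = 1" by (simp flip: padic_norm_mult)
  moreover have "padic_norm (det A) * padic_norm (det B) \<le> padic_norm (det A)"
    using le[OF B(1)] by (intro mult_left_le) simp_all
  ultimately show ?thesis using le[OF A] by linarith
qed

text \<open>An integral right factor cannot increase the largest minor, and the inverse of g is
  integral as well.\<close>

lemma minor_max_GL:
  assumes M: "(M :: 'p::prime_card padic mat) \<in> carrier_mat n m" and g: "g \<in> GL_padic_ints m"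
    and nm: "n = 0 \<or> m > 0"
  shows "minor_max (M * g) = minor_max M"
proof (rule antisym)
  note gc = GL_padic_ints_carrier[OF g]
  show "minor_max (M * g) \<le> minor_max M"
    by (rule minor_max_mult_right[OF M gc GL_padic_ints_entry[OF g] nm])
  obtain h where h: "h \<in> GL_padic_ints m" "g * h = 1\<^sub>m m" by (rule GL_padic_ints_inverse[OF g])
  note hc = GL_padic_ints_carrier[OF h(1)]
  have "M = (M * g) * h" using M gc hc h(2) by (simp add: assoc_mult_mat[of _ n m _ m _ m])
  moreover have "minor_max ((M * g) * h) \<le> minor_max (M * g)"
    using M gc by (intro minor_max_mult_right[OF _ hc GL_padic_ints_entry[OF h(1)] nm]) simp
  ultimately show "minor_max M \<le> minor_max (M * g)" by simp
qed

lemma mult_mat_sandwich: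
  assumes "A' \<in> carrier_mat n n" "A \<in> carrier_mat n n" "z \<in> carrier_mat n n" "B \<in> carrier_mat n n" "B' \<in> carrier_mat n n"
  shows "A' * (A * z * B) * B' = (A' * A) * z * (B * (B' :: 'a::comm_ring_1 mat))"
  using assms by (simp add: assoc_mult_mat[of _ n n _ n _ n])

text \<open>With A' the inverse of A, (1 | z) diag(A', B) = A' (1 | A z B). The right factor is
  integral, and det A' has norm 1.\<close>

lemma minor_max_graph_GL_le:
  assumes z: "z \<in> carrier_mat n n" and A: "A \<in> GL_padic_ints n" and B: "B \<in> GL_padic_ints n"
  shows "minor_max (graph_mat (A * z * B)) \<le> minor_max (graph_mat (z :: 'p::prime_card padic mat))"
proof -
  obtain A' where A': "A' \<in> GL_padic_ints n" "A * A' = 1\<^sub>m n" "A' * A = 1\<^sub>m n" by (rule GL_padic_ints_inverse[OF A])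
  note c = GL_padic_ints_carrier[OF A] GL_padic_ints_carrier[OF B] GL_padic_ints_carrier[OF A'(1)]
  define g where "g = Matrix.mat (2 * n) (2 * n) (\<lambda>(i, j). if i < n then (if j < n then A' $$ (i, j) else 0)
      else (if j < n then 0 else B $$ (i - n, j - n)))"
  have g: "g \<in> carrier_mat (2 * n) (2 * n)" by (simp add: g_def)
  have G: "graph_mat z * g \<in> carrier_mat n (2 * n)" using z g by (metis graph_mat_carrier mult_carrier_mat)
  have int: "g $$ (i, j) \<in> padic_ints" if "i < 2 * n" "j < 2 * n" for i j
    using that A'(1) B by (auto simp: g_def GL_padic_ints_entry)
  have nm: "n = 0 \<or> 2 * n > 0" by auto
  have L: "left_block (graph_mat z * g) = A'"
  proof (rule eq_matI)
    show "dim_row (left_block (graph_mat z * g)) = dim_row A'" "dim_col (left_block (graph_mat z * g)) = dim_col A'"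
      unfolding carrier_matD[OF block_carrier(1)[OF G]] carrier_matD[OF c(3)] by simp_all
    fix i j assume "i < dim_row A'" "j < dim_col A'"
    hence ij: "i < n" "j < n" unfolding carrier_matD[OF c(3)] .
    show "left_block (graph_mat z * g) $$ (i, j) = A' $$ (i, j)"
      unfolding block_index[OF G ij] using ij
      by (subst graph_mat_mult_index[OF z g]) (simp_all add: g_def)
  qed
  have zB: "z * B \<in> carrier_mat n n" using z c(2) by simp
  have R: "right_block (graph_mat z * g) = z * B"
  proof (rule eq_matI)
    show "dim_row (right_block (graph_mat z * g)) = dim_row (z * B)" "dim_col (right_block (graph_mat z * g)) = dim_col (z * B)"
      unfolding carrier_matD[OF block_carrier(2)[OF G]] carrier_matD[OF zB] by simp_all
    fix i j assume "i < dim_row (z * B)" "j < dim_col (z * B)"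
    hence ij: "i < n" "j < n" unfolding carrier_matD[OF zB] .
    have "right_block (graph_mat z * g) $$ (i, j) = (\<Sum>l<n. z $$ (i, l) * B $$ (l, j))"
      unfolding block_index[OF G ij] using ij
      by (subst graph_mat_mult_index[OF z g]) (simp_all add: g_def)
    also have "\<dots> = (z * B) $$ (i, j)"
      using ij z c(2) by (simp add: scalar_prod_def lessThan_atLeast0)
    finally show "right_block (graph_mat z * g) $$ (i, j) = (z * B) $$ (i, j)" .
  qed
  have AzB: "A * z * B \<in> carrier_mat n n" using c z by simp
  have "A' * (A * z * B) = (A' * A) * (z * B)" using c z by (simp add: assoc_mult_mat[of _ n n _ n _ n])
  hence "right_block (graph_mat z * g) = left_block (graph_mat z * g) * (A * z * B)"
    unfolding L R using c z A'(3) by simp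
  hence "graph_mat z * g = A' * graph_mat (A * z * B)"
    using eq_mult_graph_mat[OF G AzB] L by simp
  hence "minor_max (graph_mat z * g) = minor_max (graph_mat (A * z * B))"
    using minor_max_mult_left[OF c(3) graph_mat_carrier[OF AzB] nm] GL_padic_ints_det[OF A'(1)] by simp
  moreover have "minor_max (graph_mat z * g) \<le> minor_max (graph_mat z)"
    by (rule minor_max_mult_right[OF graph_mat_carrier[OF z] g int nm])
  ultimately show ?thesis by simp
qed

lemma minor_max_graph_GL:
  assumes z: "z \<in> carrier_mat n n" and A: "A \<in> GL_padic_ints n" and B: "B \<in> GL_padic_ints n"
  shows "minor_max (graph_mat (A * z * B)) = minor_max (graph_mat (z :: 'p::prime_card padic mat))"
proof (rule antisym)
  show "minor_max (graph_mat (A * z * B)) \<le> minor_max (graph_mat z)"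
    by (rule minor_max_graph_GL_le[OF z A B])
  obtain A' where A': "A' \<in> GL_padic_ints n" "A * A' = 1\<^sub>m n" "A' * A = 1\<^sub>m n" by (rule GL_padic_ints_inverse[OF A])
  obtain B' where B': "B' \<in> GL_padic_ints n" "B * B' = 1\<^sub>m n" "B' * B = 1\<^sub>m n" by (rule GL_padic_ints_inverse[OF B])
  note c = GL_padic_ints_carrier[OF A] GL_padic_ints_carrier[OF B] GL_padic_ints_carrier[OF A'(1)] GL_padic_ints_carrier[OF B'(1)]
  have "A' * (A * z * B) * B' = (A' * A) * z * (B * B')" by (rule mult_mat_sandwich[OF c(3,1) z c(2,4)])
  hence "A' * (A * z * B) * B' = z" using c z A' B' by simp
  moreover have "A * z * B \<in> carrier_mat n n" using c z by simp
  ultimately show "minor_max (graph_mat z) \<le> minor_max (graph_mat (A * z * B))"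
    using minor_max_graph_GL_le[OF _ A'(1) B'(1), of "A * z * B"] by simp
qed

text \<open>\<open>p_power_neg (Some m)\<close> has norm p^m and \<open>p_power_neg None\<close> is
  0, so the maximum with 1 keeps exactly the positive exponents. As the right hand side mentions
  only z, the value is the same for all decompositions.\<close>

lemma singular_exponents_minor_max:
  assumes z: "z \<in> carrier_mat n n" and k: "singular_exponents (z :: 'p::prime_card padic mat) k"
  shows "(\<Prod>j\<in>{j. j < n \<and> k j > Some 0}. real CARD('p) powi the (k j)) = minor_max (graph_mat z)"
proof -
  obtain A B where AB: "A \<in> GL_padic_ints n" "B \<in> GL_padic_ints n"
    "z = A * mat_diag n (\<lambda>j. p_power_neg (k j)) * B"
    using k z by (auto simp: singular_exponents_def Let_def)
  have D: "(mat_diag n (\<lambda>j. p_power_neg (k j)) :: 'p padic mat) \<in> carrier_mat n n" by simp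
  have "minor_max (graph_mat z) = (\<Prod>j<n. max 1 (padic_norm (p_power_neg (k j) :: 'p padic)))"
    unfolding AB(3) minor_max_graph_GL[OF D AB(1,2)] by (rule minor_max_graph_diag)
  also have "\<dots> = (\<Prod>j<n. if k j > Some 0 then real CARD('p) powi the (k j) else 1)"
  proof (rule prod.cong[OF refl])
    fix j
    show "max 1 (padic_norm (p_power_neg (k j) :: 'p padic)) = (if k j > Some 0 then real CARD('p) powi the (k j) else 1)"
    proof (cases "k j")
      case None
      thus ?thesis by (simp add: p_power_neg_def)
    next
      case (Some m)
      have "1 \<le> real CARD('p) powi m \<longleftrightarrow> 0 \<le> m"
        using powi_le_iff[OF card_prime_gt_1[where 'p='p], of 0 m] by simp
      moreover have "real CARD('p) powi m = 1" if "m = 0" using that by simp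
      ultimately show ?thesis using Some
        by (auto simp: p_power_neg_def padic_norm_prime_powi max_def)
    qed
  qed
  also have "\<dots> = (\<Prod>j\<in>{j. j < n \<and> k j > Some 0}. real CARD('p) powi the (k j))"
    by (subst prod.inter_filter[symmetric]) (auto intro!: prod.cong)
  finally show ?thesis ..
qed

section \<open>Elementary matrices and the Smith normal form\<close>

text \<open>Rows may be scaled only by units and combined only with integral coefficients, so that
  every generator is invertible over the p-adic integers.\<close>

inductive_set elem_mats :: "nat \<Rightarrow> 'p::prime_card padic mat set" for n :: nat where
  one: "1\<^sub>m n \<in> elem_mats n"
| mult: "A \<in> elem_mats n \<Longrightarrow> B \<in> elem_mats n \<Longrightarrow> A * B \<in> elem_mats n"
| swap: "k < n \<Longrightarrow> l < n \<Longrightarrow> k \<noteq> l \<Longrightarrow> swaprows_mat n k l \<in> elem_mats n"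
| addrow: "k < n \<Longrightarrow> l < n \<Longrightarrow> k \<noteq> l \<Longrightarrow> t \<in> padic_ints \<Longrightarrow> addrow_mat n t k l \<in> elem_mats n"
| multrow: "k < n \<Longrightarrow> padic_norm u = 1 \<Longrightarrow> multrow_mat n k u \<in> elem_mats n"

lemma GL_padic_intsI:
  assumes "A \<in> carrier_mat n n" "B \<in> carrier_mat n n" "A * B = 1\<^sub>m n" "B * A = 1\<^sub>m n"
    "\<And>i j. i < n \<Longrightarrow> j < n \<Longrightarrow> A $$ (i, j) \<in> padic_ints" "\<And>i j. i < n \<Longrightarrow> j < n \<Longrightarrow> B $$ (i, j) \<in> padic_ints"
  shows "A \<in> GL_padic_ints n"
  unfolding GL_padic_ints_iff using assms by blast

lemma one_GL: "1\<^sub>m n \<in> GL_padic_ints n"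
  by (rule GL_padic_intsI[of _ _ "1\<^sub>m n"]) auto

lemma swaprows_mat_sym: "swaprows_mat n k l = swaprows_mat n l k"
  by (rule eq_matI) auto

lemma swap_GL: "k < n \<Longrightarrow> l < n \<Longrightarrow> swaprows_mat n k l \<in> GL_padic_ints n"
  by (rule GL_padic_intsI[of _ _ "swaprows_mat n k l"]) (auto simp: swaprows_mat_inv simp del: index_mult_mat(1))

lemma addrow_GL:
  assumes "k < n" "l < n" "k \<noteq> l" "t \<in> padic_ints"
  shows "addrow_mat n t k l \<in> GL_padic_ints n"
proof (rule GL_padic_intsI[of _ _ "addrow_mat n (- t) k l"])
  show "addrow_mat n t k l * addrow_mat n (- t) k l = 1\<^sub>m n" by (rule addrow_mat_inv[OF assms(1-3)])
  show "addrow_mat n (- t) k l * addrow_mat n t k l = 1\<^sub>m n"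
    using addrow_mat_inv[OF assms(1-3), of "- t"] by simp
qed (use assms in \<open>auto simp: padic_ints_add\<close>)

lemma multrow_GL:
  assumes "k < n" "padic_norm u = 1"
  shows "multrow_mat n k u \<in> GL_padic_ints n"
proof (rule GL_padic_intsI[of _ _ "multrow_mat n k (inverse u)"])
  have u: "u \<noteq> 0" using assms(2) by auto
  show "multrow_mat n k u * multrow_mat n k (inverse u) = 1\<^sub>m n" by (rule multrow_mat_inv[OF assms(1) u])
  show "multrow_mat n k (inverse u) * multrow_mat n k u = 1\<^sub>m n"
    using multrow_mat_inv[OF assms(1), of "inverse u"] u by simp
qed (use assms in \<open>auto simp: padic_ints_def padic_norm_inverse\<close>)

lemma elem_mats_GL: "A \<in> elem_mats n \<Longrightarrow> A \<in> GL_padic_ints n"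
  by (induction rule: elem_mats.induct) (auto intro: one_GL GL_padic_ints_mult swap_GL addrow_GL multrow_GL)

lemma elem_mats_carrier: "A \<in> elem_mats n \<Longrightarrow> A \<in> carrier_mat n n"
  by (intro GL_padic_ints_carrier elem_mats_GL)

lemma elem_mats_inverse: "A \<in> elem_mats n \<Longrightarrow> \<exists>B\<in>elem_mats n. A * B = 1\<^sub>m n \<and> B * A = 1\<^sub>m n"
proof (induction rule: elem_mats.induct)
  case one
  show ?case by (rule bexI[OF _ elem_mats.one]) simp
next
  case (mult A B)
  then obtain A' B' where AB: "A' \<in> elem_mats n" "A * A' = 1\<^sub>m n" "A' * A = 1\<^sub>m n"
    "B' \<in> elem_mats n" "B * B' = 1\<^sub>m n" "B' * B = 1\<^sub>m n" by blast
  note c = elem_mats_carrier[OF mult.hyps(1)] elem_mats_carrier[OF mult.hyps(2)]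
    elem_mats_carrier[OF AB(1)] elem_mats_carrier[OF AB(4)]
  have "(A * B) * (B' * A') = A * (B * B') * A'" using c by (simp add: assoc_mult_mat[of _ n n _ n _ n])
  moreover have "(B' * A') * (A * B) = B' * (A' * A) * B" using c by (simp add: assoc_mult_mat[of _ n n _ n _ n])
  ultimately show ?case using AB c by (intro bexI[of _ "B' * A'"] elem_mats.mult) simp_all
next
  case (swap k l)
  show ?case by (rule bexI[OF _ elem_mats.swap[OF swap]]) (simp add: swaprows_mat_inv swap)
next
  case (addrow k l t)
  have "- t \<in> padic_ints" using addrow by simp
  thus ?case
    using addrow_mat_inv[OF addrow(1-3), of "t"] addrow_mat_inv[OF addrow(1-3), of "- t"]
    by (intro bexI[OF _ elem_mats.addrow[OF addrow(1-3), of "- t"]]) auto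
next
  case (multrow k u)
  have u: "u \<noteq> 0" using multrow(2) by auto
  have "padic_norm (inverse u) = 1" using multrow by (simp add: padic_norm_inverse)
  thus ?case
    using multrow_mat_inv[OF multrow(1) u] multrow_mat_inv[OF multrow(1), of "inverse u"] u
    by (intro bexI[OF _ elem_mats.multrow[OF multrow(1)]]) auto
qed

text \<open>Column operations are obtained as transposes of row operations.\<close>

lemma elem_mats_transpose: "A \<in> elem_mats n \<Longrightarrow> transpose_mat A \<in> elem_mats n"
proof (induction rule: elem_mats.induct)
  case one
  show ?case by (simp add: elem_mats.one)
next
  case (mult A B)
  have "transpose_mat (A * B) = transpose_mat B * transpose_mat A"
    by (rule transpose_mult[OF elem_mats_carrier[OF mult.hyps(1)] elem_mats_carrier[OF mult.hyps(2)]])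
  thus ?case using elem_mats.mult[OF mult.IH(2,1)] by simp
next
  case (swap k l)
  have "transpose_mat (swaprows_mat n k l :: 'a padic mat) = swaprows_mat n k l" by (rule eq_matI) auto
  thus ?case using elem_mats.swap[OF swap] by simp
next
  case (addrow k l t)
  have "transpose_mat (addrow_mat n t k l) = addrow_mat n t l k" by (rule eq_matI) auto
  thus ?case using elem_mats.addrow[OF addrow(2,1) _ addrow(4)] addrow(3) by simp
next
  case (multrow k u)
  have "transpose_mat (multrow_mat n k u) = multrow_mat n k u" by (rule eq_matI) auto
  thus ?case using elem_mats.multrow[OF multrow] by simp
qed

text \<open>A whole sweep of row operations with pivot row m: left multiplication adds t i times row
  m to every row i in S.\<close>

definition elim_mat :: "nat \<Rightarrow> nat \<Rightarrow> nat set \<Rightarrow> (nat \<Rightarrow> 'a::comm_ring_1) \<Rightarrow> 'a mat" where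
  "elim_mat n m S t = Matrix.mat n n (\<lambda>(i, j). (if i = j then 1 else 0) + (if j = m \<and> i \<in> S then t i else 0))"

lemma elim_mat_carrier [simp]: "elim_mat n m S t \<in> carrier_mat n n"
  by (simp add: elim_mat_def)

lemma elim_mat_mult_index:
  assumes w: "w \<in> carrier_mat n l" and ij: "i < n" "j < l" and m: "m < n"
  shows "(elim_mat n m S t * w) $$ (i, j) = w $$ (i, j) + (if i \<in> S then t i * w $$ (m, j) else 0)"
proof -
  have "(elim_mat n m S t * w) $$ (i, j)
      = (\<Sum>k = 0..<n. ((if i = k then 1 else 0) + (if k = m \<and> i \<in> S then t i else 0)) * w $$ (k, j))"
    using w ij by (simp add: scalar_prod_def elim_mat_def)
  also have "\<dots> = (\<Sum>k = 0..<n. (if i = k then w $$ (k, j) else 0) + (if k = m then (if i \<in> S then t i * w $$ (m, j) else 0) else 0))"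
    by (intro sum.cong) (auto simp: distrib_right)
  also have "\<dots> = w $$ (i, j) + (if i \<in> S then t i * w $$ (m, j) else 0)"
    using ij m by (simp add: sum.distrib)
  finally show ?thesis .
qed

lemma elim_mat_elem:
  assumes "finite S" "S \<subseteq> {..<n}" "m \<notin> S" "m < n" "\<And>i. i \<in> S \<Longrightarrow> t i \<in> padic_ints"
  shows "elim_mat n m S t \<in> elem_mats n"
  using assms
proof (induction S rule: finite_induct)
  case empty
  have "elim_mat n m {} t = 1\<^sub>m n" by (rule eq_matI) (auto simp: elim_mat_def)
  thus ?case by (simp add: elem_mats.one)
next
  case (insert x S)
  have x: "x < n" "x \<noteq> m" using insert.prems by auto
  have c: "elim_mat n m S t \<in> carrier_mat n n" by simp
  have "elim_mat n m (insert x S) t = addrow (t x) x m (elim_mat n m S t)"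
    using x insert.prems insert.hyps by (intro eq_matI) (auto simp: elim_mat_def)
  also have "\<dots> = addrow_mat n (t x) x m * elim_mat n m S t" by (rule addrow_mat[OF c \<open>m < n\<close>])
  also have "\<dots> \<in> elem_mats n"
    using x insert by (intro elem_mats.mult elem_mats.addrow) auto
  finally show ?case .
qed

text \<open>The invariant of the elimination: the first \<open>m\<close> rows and columns are in normal form.\<close>

definition smith_upto :: "nat \<Rightarrow> nat \<Rightarrow> (nat \<Rightarrow> int option) \<Rightarrow> 'p::prime_card padic mat \<Rightarrow> bool" where
  "smith_upto n m k w \<longleftrightarrow> w \<in> carrier_mat n n \<and>
     (\<forall>i<n. \<forall>j<n. i \<noteq> j \<longrightarrow> i < m \<or> j < m \<longrightarrow> w $$ (i, j) = 0) \<and>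
     (\<forall>i<m. w $$ (i, i) = p_power_neg (k i)) \<and>
     (\<forall>l<m. \<forall>i<n. \<forall>j<n. l \<le> i \<longrightarrow> l \<le> j \<longrightarrow> padic_norm (w $$ (i, j)) \<le> padic_norm (w $$ (l, l)))"

text \<open>Normalises a pivot: every nonzero element is a unit times a power of p.\<close>

lemma padic_unit_times_power:
  assumes "(x :: 'p::prime_card padic) \<noteq> 0"
  obtains u a where "padic_norm u = 1" "u * x = p_power_neg (Some a)"
proof -
  obtain a where a: "padic_norm x = real CARD('p) powi a" using padic_norm_value[OF assms] by blast
  let ?y = "p_power_neg (Some a) :: 'p padic"
  have y: "padic_norm ?y = padic_norm x" by (simp add: p_power_neg_def padic_norm_prime_powi a)
  have "padic_norm (?y / x) = 1" using assms by (simp add: padic_norm_divide y)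
  moreover have "(?y / x) * x = ?y" using assms by simp
  ultimately show ?thesis by (rule that)
qed

lemma mult_mat_chain:
  assumes "E \<in> carrier_mat n n" "U \<in> carrier_mat n n" "X \<in> carrier_mat n n" "w \<in> carrier_mat n n"
    "Y \<in> carrier_mat n n" "F \<in> carrier_mat n n"
  shows "E * (U * (X * w * Y)) * F = (E * U * X) * w * (Y * (F :: 'a::comm_ring_1 mat))"
  using assms by (simp add: assoc_mult_mat[of _ n n _ n _ n])

lemma swapcols_index:
  assumes "V \<in> carrier_mat n l" "i < n" "j < l"
  shows "swapcols k k' V $$ (i, j) = V $$ (i, if j = k then k' else if j = k' then k else j)"
  using assms by auto

text \<open>The p-adic integers form a valuation ring: an entry of largest norm in the remaining
  block divides all others in it, so one sweep over its column and one over its row clear both with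
  integral multipliers.\<close>

lemma smith_step:
  assumes w: "smith_upto n m k (w :: 'p::prime_card padic mat)" and m: "m < n"
  shows "\<exists>A\<in>elem_mats n. \<exists>B\<in>elem_mats n. \<exists>k'. smith_upto n (Suc m) k' (A * w * B)"
proof -
  have wc: "w \<in> carrier_mat n n" and off: "\<And>i j. i < n \<Longrightarrow> j < n \<Longrightarrow> i \<noteq> j \<Longrightarrow> i < m \<or> j < m \<Longrightarrow> w $$ (i, j) = 0"
    and dia: "\<And>i. i < m \<Longrightarrow> w $$ (i, i) = p_power_neg (k i)"
    and dom: "\<And>l i j. l < m \<Longrightarrow> i < n \<Longrightarrow> j < n \<Longrightarrow> l \<le> i \<Longrightarrow> l \<le> j \<Longrightarrow> padic_norm (w $$ (i, j)) \<le> padic_norm (w $$ (l, l))"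
    using w unfolding smith_upto_def by blast+
  show ?thesis
  proof (cases "\<forall>i\<in>{m..<n}. \<forall>j\<in>{m..<n}. w $$ (i, j) = 0")
    case True
    hence z: "w $$ (i, j) = 0" if "m \<le> i" "i < n" "m \<le> j" "j < n" for i j using that by simp
    \<comment> \<open>The remaining block vanishes, and the exponent -\<infinity> stands for the
      diagonal entry 0.\<close>
    have "smith_upto n (Suc m) (k(m := None)) w"
      unfolding smith_upto_def
    proof (intro conjI allI impI wc)
      fix i j assume "i < n" "j < n" "i \<noteq> j" "i < Suc m \<or> j < Suc m"
      thus "w $$ (i, j) = 0" using off[of i j] z[of i j] by (cases "i < m \<or> j < m") auto
    next
      fix i assume "i < Suc m"
      thus "w $$ (i, i) = p_power_neg ((k(m := None)) i)"
        using dia[of i] z[of m m] m by (cases "i = m") (auto simp: p_power_neg_def)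
    next
      fix l i j assume "l < Suc m" "i < n" "j < n" "l \<le> i" "l \<le> j"
      thus "padic_norm (w $$ (i, j)) \<le> padic_norm (w $$ (l, l))"
        using dom[of l i j] z[of i j] by (cases "l = m") auto
    qed
    moreover have "1\<^sub>m n * w * 1\<^sub>m n = w" using wc by simp
    ultimately show ?thesis by (metis elem_mats.one)
  next
    case False
    let ?R = "{m..<n} \<times> {m..<n}"
    let ?N = "Max ((\<lambda>ij. padic_norm (w $$ ij)) ` ?R)"
    have fin: "finite ((\<lambda>ij. padic_norm (w $$ ij)) ` ?R)" by simp
    have "?N \<in> (\<lambda>ij. padic_norm (w $$ ij)) ` ?R" using m by (intro Max_in fin) auto
    then obtain i0 j0 where ij0: "m \<le> i0" "i0 < n" "m \<le> j0" "j0 < n" "padic_norm (w $$ (i0, j0)) = ?N"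
      by auto
    have mx: "padic_norm (w $$ (i, j)) \<le> padic_norm (w $$ (i0, j0))" if "m \<le> i" "i < n" "m \<le> j" "j < n" for i j
      unfolding ij0(5) by (rule Max_ge[OF fin]) (use that in auto)
    have e0: "w $$ (i0, j0) \<noteq> 0"
    proof
      assume "w $$ (i0, j0) = 0"
      hence "w $$ (i, j) = 0" if "m \<le> i" "i < n" "m \<le> j" "j < n" for i j
        using mx[OF that] padic_norm_nonneg[of "w $$ (i, j)"] padic_norm_eq_0_iff[of "w $$ (i, j)"]
        by (metis antisym padic_norm_zero)
      thus False using False by auto
    qed
    obtain u a where u: "padic_norm u = 1" "u * w $$ (i0, j0) = p_power_neg (Some a)"
      by (rule padic_unit_times_power[OF e0])
    \<comment> \<open>The row and column exchanges that move the pivot from (i0, j0) to (m, m), as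
      maps of indices.\<close>
    define \<sigma> where "\<sigma> i = (if i = m then i0 else if i = i0 then m else i)" for i
    define \<tau> where "\<tau> j = (if j = m then j0 else if j = j0 then m else j)" for j
    have \<sigma>: "i < n \<Longrightarrow> \<sigma> i < n" "i \<ge> m \<Longrightarrow> \<sigma> i \<ge> m" "i < m \<Longrightarrow> \<sigma> i = i" for i
      using ij0 m by (auto simp: \<sigma>_def)
    have \<tau>: "i < n \<Longrightarrow> \<tau> i < n" "i \<ge> m \<Longrightarrow> \<tau> i \<ge> m" "i < m \<Longrightarrow> \<tau> i = i" for i
      using ij0 m by (auto simp: \<tau>_def)
    define X1 where "X1 = (if i0 = m then 1\<^sub>m n else swaprows_mat n m i0 :: 'p padic mat)"
    define X2 where "X2 = (if j0 = m then 1\<^sub>m n else swaprows_mat n m j0 :: 'p padic mat)"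
    have X: "X1 \<in> elem_mats n" "X2 \<in> elem_mats n"
      using ij0 m by (auto simp: X1_def X2_def intro: elem_mats.intros)
    note Xc = elem_mats_carrier[OF X(1)] elem_mats_carrier[OF X(2)]
    define w1 where "w1 = X1 * w * X2"
    have w1c: "w1 \<in> carrier_mat n n" using Xc wc by (simp add: w1_def)
    have w1: "w1 $$ (i, j) = w $$ (\<sigma> i, \<tau> j)" if "i < n" "j < n" for i j
    proof -
      have r: "(X1 * w) $$ (i, j) = w $$ (\<sigma> i, j)" if "i < n" "j < n" for i j
        using that wc ij0 m swaprows_mat[OF wc m ij0(2)]
        by (auto simp: X1_def \<sigma>_def simp del: index_mult_mat(1) simp flip: swaprows_mat[OF wc m ij0(2)])
      have c: "X1 * w \<in> carrier_mat n n" using Xc wc by simp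
      show ?thesis
      proof (cases "j0 = m")
        case True
        hence "w1 = X1 * w" unfolding w1_def X2_def using right_mult_one_mat[OF c] by simp
        thus ?thesis using True that r[of i j] by (simp add: \<tau>_def)
      next
        case False
        have "w1 = swapcols m j0 (X1 * w)"
          using swapcols_mat[OF c m ij0(4)] False by (simp add: w1_def X2_def)
        hence "w1 $$ (i, j) = (X1 * w) $$ (i, \<tau> j)"
          using swapcols_index[OF c that] by (simp add: \<tau>_def)
        thus ?thesis using r[of i "\<tau> j"] that \<tau>(1)[of j] by simp
      qed
    qed
    define w2 where "w2 = multrow_mat n m u * w1"
    have w2c: "w2 \<in> carrier_mat n n" unfolding w2_def by (rule mult_carrier_mat[OF multrow_mat_carrier w1c])
    define c where "c i = (if i = m then u else 1)" for i
    have c: "padic_norm (c i) = 1" "c m = u" "i < m \<Longrightarrow> c i = 1" for i using u(1) by (simp_all add: c_def)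
    have w2: "w2 $$ (i, j) = c i * w $$ (\<sigma> i, \<tau> j)" if "i < n" "j < n" for i j
      unfolding w2_def multrow_mat[OF w1c, symmetric] using that w1c by (auto simp: w1 c_def)
    let ?q = "p_power_neg (Some a) :: 'p padic"
    have w2mm: "w2 $$ (m, m) = ?q" using w2[OF m m] u c(2) by (simp add: \<sigma>_def \<tau>_def)
    have qn: "padic_norm ?q = padic_norm (w $$ (i0, j0))" unfolding u(2)[symmetric] padic_norm_mult u(1) by simp
    have q0: "?q \<noteq> 0" using qn e0 by (metis padic_norm_eq_0_iff)
    have w2le: "padic_norm (w2 $$ (i, j)) \<le> padic_norm ?q" if "m \<le> i" "i < n" "m \<le> j" "j < n" for i j
      using mx[of "\<sigma> i" "\<tau> j"] \<sigma>[of i] \<tau>[of j] that u(1)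
      by (simp add: w2 qn padic_norm_mult c(1))
    have w2off: "w2 $$ (i, j) = 0" if "i < n" "j < n" "i \<noteq> j" "i < m \<or> j < m" for i j
    proof -
      have "\<sigma> i \<noteq> \<tau> j" "\<sigma> i < m \<or> \<tau> j < m"
        using that(3,4) \<sigma>(2,3)[of i] \<tau>(2,3)[of j] by linarith+
      hence "w $$ (\<sigma> i, \<tau> j) = 0" using off[of "\<sigma> i" "\<tau> j"] \<sigma>(1) \<tau>(1) that by simp
      thus ?thesis unfolding w2[OF that(1,2)] by simp
    qed
    have w2dia: "w2 $$ (i, i) = w $$ (i, i)" if "i < m" for i
      using that m \<sigma>[of i] \<tau>[of i] by (simp add: w2 c(3))
    let ?S = "{Suc m..<n}"
    \<comment> \<open>The quotients by the pivot are integral because the pivot has the largest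
      norm.\<close>
    define E where "E = elim_mat n m ?S (\<lambda>i. - (w2 $$ (i, m) / ?q))"
    have E: "E \<in> elem_mats n" unfolding E_def
      using m w2le q0 by (intro elim_mat_elem) (auto simp: padic_ints_def padic_norm_divide)
    define w3 where "w3 = E * w2"
    have w3c: "w3 \<in> carrier_mat n n" using w2c elem_mats_carrier[OF E] by (simp add: w3_def)
    have w3: "w3 $$ (i, j) = w2 $$ (i, j) + (if i \<in> ?S then - (w2 $$ (i, m) / ?q) * w2 $$ (m, j) else 0)"
      if "i < n" "j < n" for i j
      unfolding w3_def E_def by (rule elim_mat_mult_index[OF w2c that m])
    have w3m: "w3 $$ (i, m) = 0" if "i \<in> ?S" for i
      using that m q0 by (simp add: w3 w2mm)
    have w3r: "w3 $$ (m, j) = w2 $$ (m, j)" if "j < n" for j using that m by (simp add: w3)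
    have w3off: "w3 $$ (i, j) = 0" if "i < n" "j < n" "i \<noteq> j" "i < m \<or> j < m" for i j
      using that m w2off[of i j] w2off[of m j] w2off[of i m] by (auto simp: w3)
    have w3dia: "w3 $$ (i, i) = w $$ (i, i)" if "i < m" for i
      using that m w2dia[of i] by (simp add: w3)
    \<comment> \<open>The correction is an integral multiple of an entry of the pivot row, so the
      row sweep preserves the bound that the column sweep needs.\<close>
    have w3le: "padic_norm (w3 $$ (i, j)) \<le> padic_norm ?q" if ij: "m \<le> i" "i < n" "m \<le> j" "j < n" for i j
    proof -
      have "padic_norm (if i \<in> ?S then - (w2 $$ (i, m) / ?q) * w2 $$ (m, j) else 0) \<le> padic_norm ?q"
      proof (cases "i \<in> ?S")
        case True
        have "padic_norm (- (w2 $$ (i, m) / ?q) * w2 $$ (m, j)) = padic_norm (w2 $$ (i, m)) / padic_norm ?q * padic_norm (w2 $$ (m, j))"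
          by (simp add: padic_norm_mult padic_norm_divide)
        also have "\<dots> \<le> 1 * padic_norm ?q"
          using w2le[of i m] w2le[of m j] ij m q0 by (intro mult_mono) simp_all
        finally show ?thesis using True by simp
      next
        case False
        show ?thesis unfolding if_not_P[OF False] by simp
      qed
      thus ?thesis using w2le[OF ij] padic_norm_ultrametric[of "w2 $$ (i, j)" "if i \<in> ?S then - (w2 $$ (i, m) / ?q) * w2 $$ (m, j) else 0"]
        unfolding w3[OF ij(2,4)] by linarith
    qed
    define F where "F = transpose_mat (elim_mat n m ?S (\<lambda>j. - (w3 $$ (m, j) / ?q)))"
    have F: "F \<in> elem_mats n" unfolding F_def
      using m w3le q0 by (intro elem_mats_transpose elim_mat_elem) (auto simp: padic_ints_def padic_norm_divide)
    define w4 where "w4 = w3 * F"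
    have w4c: "w4 \<in> carrier_mat n n" using w3c elem_mats_carrier[OF F] by (simp add: w4_def)
    have w4: "w4 $$ (i, j) = w3 $$ (i, j) + (if j \<in> ?S then - (w3 $$ (m, j) / ?q) * w3 $$ (i, m) else 0)"
      if ij: "i < n" "j < n" for i j
    proof -
      have tc: "transpose_mat w3 \<in> carrier_mat n n" using w3c by simp
      have "transpose_mat w4 = elim_mat n m ?S (\<lambda>j. - (w3 $$ (m, j) / ?q)) * transpose_mat w3"
        using transpose_mult[OF w3c, of F n] by (simp add: w4_def F_def)
      hence "transpose_mat w4 $$ (j, i) = transpose_mat w3 $$ (j, i)
          + (if j \<in> ?S then - (w3 $$ (m, j) / ?q) * transpose_mat w3 $$ (m, i) else 0)"
        using elim_mat_mult_index[OF tc ij(2,1) m] by simp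
      thus ?thesis using ij m w3c w4c by simp
    qed
    \<comment> \<open>Rows below the pivot already have 0 in column m, so the column sweep leaves
      them alone.\<close>
    have w4r: "w4 $$ (i, j) = w3 $$ (i, j)" if "i \<in> ?S" "j < n" for i j
      using that w3m[of i] m by (simp add: w4)
    have w3mm: "w3 $$ (m, m) = ?q" using w3r[OF m] w2mm by simp
    have w4m: "w4 $$ (m, j) = 0" if "j \<in> ?S" for j
      using that m q0 by (simp add: w4 w3mm)
    have w4mm: "w4 $$ (m, m) = ?q" using m by (simp add: w4 w3mm)
    have w4l: "w4 $$ (i, j) = w3 $$ (i, j)" if "i < m" "j < n" for i j
      using that m w3off[of i m] by (simp add: w4)
    have "smith_upto n (Suc m) (k(m := Some a)) w4"
      unfolding smith_upto_def
    proof (intro conjI allI impI w4c)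
      fix i j assume ij: "i < n" "j < n" "i \<noteq> j" "i < Suc m \<or> j < Suc m"
      consider "i < m" | "i = m" | "i \<in> ?S" using ij by force
      thus "w4 $$ (i, j) = 0"
      proof cases
        case 1
        thus ?thesis using w4l[of i j] w3off[of i j] ij by simp
      next
        case 2
        show ?thesis
        proof (cases "j < m")
          case True
          thus ?thesis using w4[OF ij(1,2)] w3off[OF ij(1-3)] by simp
        next
          case False
          thus ?thesis using w4m[of j] ij 2 by simp
        qed
      next
        case 3
        hence "j < m \<or> j = m" using ij by auto
        thus ?thesis using w4r[OF 3 ij(2)] w3off[OF ij(1-3)] w3m[OF 3] by auto
      qed
    next
      fix i assume "i < Suc m"
      thus "w4 $$ (i, i) = p_power_neg ((k(m := Some a)) i)"
        using w4l[of i i] w3dia[of i] dia[of i] w4mm m by (cases "i = m") auto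
    next
      fix l i j assume l: "l < Suc m" and ij: "i < n" "j < n" "l \<le> i" "l \<le> j"
      have w4q: "padic_norm (w4 $$ (i, j)) \<le> padic_norm ?q" if "m \<le> i" "m \<le> j"
      proof (cases "i = m")
        case True
        thus ?thesis using w4m[of j] w4mm ij that by (cases "j = m") auto
      next
        case False
        thus ?thesis using w4r[of i j] w3le[of i j] ij that by simp
      qed
      show "padic_norm (w4 $$ (i, j)) \<le> padic_norm (w4 $$ (l, l))"
      proof (cases "l = m")
        case True
        thus ?thesis using w4q ij w4mm by simp
      next
        case False
        hence l: "l < m" using l by simp
        have ll: "w4 $$ (l, l) = w $$ (l, l)" using w4l[of l l] w3dia[of l] l m by simp
        show ?thesis
        proof (cases "m \<le> i \<and> m \<le> j")
          case True
          hence "padic_norm (w4 $$ (i, j)) \<le> padic_norm (w $$ (i0, j0))" using w4q qn by simp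
          \<comment> \<open>The new pivot comes from an entry of the old remaining block, which the
            earlier pivots dominate.\<close>
          also have "\<dots> \<le> padic_norm (w $$ (l, l))" using dom[of l i0 j0] l ij0 by simp
          finally show ?thesis by (simp add: ll)
        next
          case F: False
          show ?thesis
          proof (cases "i = j")
            case True
            hence "i < m" using F by simp
            hence "w4 $$ (i, j) = w $$ (i, j)" using True w4l[of i i] w3dia[of i] ij by simp
            thus ?thesis using dom[OF l ij] ll by simp
          next
            case False
            have "w4 $$ (i, j) = 0"
            proof (cases "i < m")
              case True
              thus ?thesis using w4l[of i j] w3off[of i j] ij False by simp
            next
              case i: False
              hence "j < m" using F by simp
              thus ?thesis using w4[OF ij(1,2)] w3off[OF ij(1,2) False] by simp
            qed
            thus ?thesis by simp
          qed
        qed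
      qed
    qed
    moreover have "w4 = (E * multrow_mat n m u * X1) * w * (X2 * F)"
      unfolding w4_def w3_def w2_def w1_def
      by (rule mult_mat_chain[OF elem_mats_carrier[OF E] multrow_mat_carrier Xc(1) wc Xc(2) elem_mats_carrier[OF F]])
    moreover have "E * multrow_mat n m u * X1 \<in> elem_mats n" "X2 * F \<in> elem_mats n"
      using E F X u m by (auto intro!: elem_mats.intros)
    ultimately show ?thesis by blast
  qed
qed

text \<open>The exponents come out in decreasing order because each pivot dominates all later
  entries.\<close>

lemma smith_normal_form_elem:
  assumes z: "(z :: 'p::prime_card padic mat) \<in> carrier_mat n n"
  obtains A B k where "A \<in> elem_mats n" "B \<in> elem_mats n"
    "\<And>i j. i \<le> j \<Longrightarrow> j < n \<Longrightarrow> k j \<le> k i" "z = A * mat_diag n (\<lambda>j. p_power_neg (k j)) * B"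
proof -
  have "\<exists>A\<in>elem_mats n. \<exists>B\<in>elem_mats n. \<exists>k. smith_upto n m k (A * z * B)" if "m \<le> n" for m
    using that
  proof (induction m)
    case 0
    have "smith_upto n 0 (\<lambda>_. None) (1\<^sub>m n * z * 1\<^sub>m n)" using z by (simp add: smith_upto_def)
    thus ?case using elem_mats.one by blast
  next
    case (Suc m)
    then obtain A B k where AB: "A \<in> elem_mats n" "B \<in> elem_mats n" "smith_upto n m k (A * z * B)" by auto
    obtain A' B' k' where AB': "A' \<in> elem_mats n" "B' \<in> elem_mats n" "smith_upto n (Suc m) k' (A' * (A * z * B) * B')"
      using smith_step[OF AB(3)] Suc.prems by (metis Suc_le_lessD)
    have "A' * (A * z * B) * B' = (A' * A) * z * (B * B')"
      using z elem_mats_carrier[OF AB(1)] elem_mats_carrier[OF AB(2)] elem_mats_carrier[OF AB'(1)] elem_mats_carrier[OF AB'(2)]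
      by (simp add: assoc_mult_mat[of _ n n _ n _ n])
    thus ?case using AB AB' elem_mats.mult by metis
  qed
  then obtain A B k where AB: "A \<in> elem_mats n" "B \<in> elem_mats n" "smith_upto n n k (A * z * B)" by blast
  obtain A' B' where AB': "A' \<in> elem_mats n" "A' * A = 1\<^sub>m n" "B' \<in> elem_mats n" "B * B' = 1\<^sub>m n"
    using elem_mats_inverse[OF AB(1)] elem_mats_inverse[OF AB(2)] by blast
  note c = elem_mats_carrier[OF AB(1)] elem_mats_carrier[OF AB(2)] elem_mats_carrier[OF AB'(1)] elem_mats_carrier[OF AB'(3)]
  have wc: "A * z * B \<in> carrier_mat n n" using c z by simp
  have D: "A * z * B = mat_diag n (\<lambda>j. p_power_neg (k j))"
  proof (rule eq_matI)
    fix i j assume "i < dim_row (mat_diag n (\<lambda>j. p_power_neg (k j)) :: 'p padic mat)"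
      "j < dim_col (mat_diag n (\<lambda>j. p_power_neg (k j)) :: 'p padic mat)"
    hence ij: "i < n" "j < n" by (simp_all add: mat_diag_def)
    show "(A * z * B) $$ (i, j) = mat_diag n (\<lambda>j. p_power_neg (k j)) $$ (i, j)"
      using AB(3) ij unfolding smith_upto_def by (cases "i = j") (simp_all add: mat_diag_def del: index_mult_mat(1))
  qed (use wc in \<open>auto simp: mat_diag_def\<close>)
  have "A' * (A * z * B) * B' = (A' * A) * z * (B * B')" by (rule mult_mat_sandwich[OF c(3,1) z c(2,4)])
  hence eq: "z = A' * mat_diag n (\<lambda>j. p_power_neg (k j)) * B'" using AB' z D by simp
  have mono: "k j \<le> k i" if ij: "i \<le> j" "j < n" for i j
  proof -
    have "padic_norm ((A * z * B) $$ (j, j)) \<le> padic_norm ((A * z * B) $$ (i, i))"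
      using AB(3) ij unfolding smith_upto_def by (meson le_less_trans)
    hence le: "padic_norm (p_power_neg (k j) :: 'p padic) \<le> padic_norm (p_power_neg (k i) :: 'p padic)"
      unfolding D using ij by (simp add: mat_diag_def)
    show ?thesis
    proof (cases "k j")
      case (Some b)
      have b: "padic_norm (p_power_neg (Some b) :: 'p padic) = real CARD('p) powi b" for b
        by (simp add: p_power_neg_def padic_norm_prime_powi)
      show ?thesis
      proof (cases "k i")
        case None
        hence "real CARD('p) powi b \<le> 0" using le Some b by (simp add: p_power_neg_def)
        thus ?thesis using pball_radius_pos[of b, where 'p='p] by linarith
      next
        case i: (Some a)
        have "b \<le> a" using le unfolding Some i b powi_le_iff[OF card_prime_gt_1] .
        thus ?thesis by (simp add: Some i)
      qed
    qed simp
  qed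
  show ?thesis by (rule that[OF AB'(1) AB'(3) mono eq])
qed

text \<open>The Smith normal form provides a value for the description of \<open>gamma_mat\<close>,
  and the largest minor shows that there is only one. Measurability and the transformation law are
  read off from the minors.\<close>

lemma gamma_mat_eq:
  assumes z: "(z :: 'p::prime_card padic mat) \<in> carrier_mat n n"
  shows "gamma_mat z = minor_max (graph_mat z)"
  unfolding gamma_mat_def
proof (rule the_equality)
  have d: "dim_row z = n" using z by simp
  obtain A B k where AB: "A \<in> elem_mats n" "B \<in> elem_mats n"
    "\<And>i j. i \<le> j \<Longrightarrow> j < n \<Longrightarrow> k j \<le> k i" "z = A * mat_diag n (\<lambda>j. p_power_neg (k j)) * B"
    using smith_normal_form_elem[OF z] by metis
  have "singular_exponents z k"
    unfolding singular_exponents_def Let_def d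
    using AB(3,4) elem_mats_GL[OF AB(1)] elem_mats_GL[OF AB(2)] by blast
  thus "\<exists>k. singular_exponents z k \<and>
      minor_max (graph_mat z) = (\<Prod>j\<in>{j. j < dim_row z \<and> k j > Some 0}. real CARD('p) powi the (k j))"
    using singular_exponents_minor_max[OF z] unfolding d by metis
  show "c = minor_max (graph_mat z)"
    if "\<exists>k. singular_exponents z k \<and>
      c = (\<Prod>j\<in>{j. j < dim_row z \<and> k j > Some 0}. real CARD('p) powi the (k j))" for c
    using that singular_exponents_minor_max[OF z] unfolding d by metis
qed

text \<open>The diagonal part of the normal form of an invertible g is itself invertible, so its
  entries are units; as powers of p they equal 1, and only the two elementary factors
  remain.\<close>

lemma GL_padic_ints_eq_elem: "GL_padic_ints n = (elem_mats n :: 'p::prime_card padic mat set)"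
proof (rule antisym; rule subsetI)
  fix g :: "'p padic mat" assume g: "g \<in> GL_padic_ints n"
  obtain A B k where AB: "A \<in> elem_mats n" "B \<in> elem_mats n" "g = A * mat_diag n (\<lambda>j. p_power_neg (k j)) * B"
    using smith_normal_form_elem[OF GL_padic_ints_carrier[OF g]] by metis
  let ?D = "mat_diag n (\<lambda>j. p_power_neg (k j)) :: 'p padic mat"
  obtain A' B' where AB': "A' \<in> elem_mats n" "A' * A = 1\<^sub>m n" "B' \<in> elem_mats n" "B * B' = 1\<^sub>m n"
    using elem_mats_inverse[OF AB(1)] elem_mats_inverse[OF AB(2)] by blast
  note c = elem_mats_carrier[OF AB(1)] elem_mats_carrier[OF AB(2)] elem_mats_carrier[OF AB'(1)] elem_mats_carrier[OF AB'(3)]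
  have Dc: "?D \<in> carrier_mat n n" by simp
  have "A' * g * B' = (A' * A) * ?D * (B * B')" unfolding AB(3) by (rule mult_mat_sandwich[OF c(3,1) Dc c(2,4)])
  hence "?D = A' * g * B'" using left_mult_one_mat[OF Dc] right_mult_one_mat[OF Dc] by (simp only: AB'(2,4))
  hence D: "?D \<in> GL_padic_ints n"
    using g elem_mats_GL[OF AB'(1)] elem_mats_GL[OF AB'(3)] by (simp add: GL_padic_ints_mult)
  have "p_power_neg (k i) = (1 :: 'p padic)" if i: "i < n" for i
  proof -
    obtain D' where D': "D' \<in> GL_padic_ints n" "?D * D' = 1\<^sub>m n" using GL_padic_ints_inverse[OF D] by metis
    have "(?D * D') $$ (i, i) = p_power_neg (k i) * D' $$ (i, i)"
      using i GL_padic_ints_carrier[OF D'(1)] by (simp add: mat_diag_mult_left[of D' n n])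
    hence 1: "p_power_neg (k i) * D' $$ (i, i) = 1" using D'(2) i by simp
    have le: "padic_norm (p_power_neg (k i) :: 'p padic) \<le> 1" "padic_norm (D' $$ (i, i)) \<le> 1"
      using GL_padic_ints_entry[OF D i i] GL_padic_ints_entry[OF D'(1) i i] i by (simp_all add: padic_ints_def mat_diag_def)
    have m: "padic_norm (p_power_neg (k i) :: 'p padic) * padic_norm (D' $$ (i, i)) = 1"
      unfolding padic_norm_mult[symmetric] 1 by simp
    moreover have "padic_norm (p_power_neg (k i) :: 'p padic) * padic_norm (D' $$ (i, i)) \<le> padic_norm (p_power_neg (k i) :: 'p padic)"
      using le(2) by (intro mult_left_le) simp_all
    ultimately have n1: "padic_norm (p_power_neg (k i) :: 'p padic) = 1" using le(1) by linarith
    show ?thesis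
    proof (cases "k i")
      case None
      thus ?thesis using n1 by (simp add: p_power_neg_def)
    next
      case (Some a)
      have "real CARD('p) powi a = real CARD('p) powi 0" using n1 Some by (simp add: p_power_neg_def padic_norm_prime_powi)
      hence "a = 0"
        using powi_le_iff[OF card_prime_gt_1[where 'p='p], of a 0] powi_le_iff[OF card_prime_gt_1[where 'p='p], of 0 a] by simp
      thus ?thesis using Some by (simp add: p_power_neg_def)
    qed
  qed
  hence "?D = 1\<^sub>m n" by (intro eq_matI) (auto simp: mat_diag_def)
  hence "g = A * B" using AB(3) c by simp
  thus "g \<in> elem_mats n" using AB elem_mats.mult by simp
qed (rule elem_mats_GL)

section \<open>Generators adapted to the block structure\<close>

lemma swaprows_mat_entry:
  assumes "i < m" "j < m"
  shows "swaprows_mat m k l $$ (i, j) = (if Transposition.transpose k l i = j then 1 else 0)"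
  using assms by (simp add: Transposition.transpose_def)

lemma swaprows_conj_index:
  assumes A: "A \<in> carrier_mat m m" and kl: "k < m" "l < m" and ij: "i < m" "j < m"
  shows "(swaprows_mat m k l * A * swaprows_mat m k l) $$ (i, j)
           = A $$ (Transposition.transpose k l i, Transposition.transpose k l j)"
proof -
  have c: "swaprows_mat m k l * A \<in> carrier_mat m m" by (rule mult_carrier_mat[OF swaprows_mat_carrier A])
  have t: "Transposition.transpose k l i < m" using kl ij by (simp add: Transposition.transpose_def)
  have t': "Transposition.transpose k l j < m" using kl ij by (simp add: Transposition.transpose_def)
  have "swaprows_mat m k l * A * swaprows_mat m k l = swapcols k l (swaprows k l A)"
    unfolding swaprows_mat[OF A kl] by (rule swapcols_mat[OF c kl, symmetric])
  also have "\<dots> $$ (i, j) = swaprows k l A $$ (i, Transposition.transpose k l j)"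
    using A kl ij by (simp add: Transposition.transpose_def)
  also have "\<dots> = A $$ (Transposition.transpose k l i, Transposition.transpose k l j)"
    using A t' ij by (simp add: Transposition.transpose_def[of k l i])
  finally show ?thesis .
qed

lemma swaprows_conj_eqI:
  assumes A: "A \<in> carrier_mat m m" and B: "B \<in> carrier_mat m m" and kl: "k < m" "l < m"
    and eq: "\<And>i j. i < m \<Longrightarrow> j < m \<Longrightarrow> Transposition.transpose k l i < m \<Longrightarrow> Transposition.transpose k l j < m \<Longrightarrow>
      A $$ (Transposition.transpose k l i, Transposition.transpose k l j) = B $$ (i, j)"
  shows "swaprows_mat m k l * A * swaprows_mat m k l = B"
proof (rule eq_matI)
  fix i j assume "i < dim_row B" "j < dim_col B"
  hence ij: "i < m" "j < m" using B by auto
  show "(swaprows_mat m k l * A * swaprows_mat m k l) $$ (i, j) = B $$ (i, j)"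
    unfolding swaprows_conj_index[OF A kl ij] by (rule eq[OF ij]) (use ij kl in \<open>simp_all add: Transposition.transpose_def\<close>)
qed (use A B in auto)

text \<open>The relation (x l)(y l)(x l) = (x y). With l in the other block it expresses a
  transposition inside one block by transpositions across the blocks.\<close>

lemma swaprows_conj_swap:
  assumes "x < m" "y < m" "l < m" "x \<noteq> y" "x \<noteq> l" "y \<noteq> l"
  shows "swaprows_mat m x l * swaprows_mat m y l * swaprows_mat m x l = (swaprows_mat m x y :: 'a::comm_ring_1 mat)"
proof (rule swaprows_conj_eqI)
  fix i j
  let ?\<tau> = "Transposition.transpose x l"
  assume ij: "i < m" "j < m" "?\<tau> i < m" "?\<tau> j < m"
  have "?\<tau> (Transposition.transpose y l (?\<tau> i)) = Transposition.transpose x y i"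
    using transpose_triple[of x y l i] assms by (simp add: transpose_commute[of y l])
  hence "Transposition.transpose y l (?\<tau> i) = ?\<tau> j \<longleftrightarrow> Transposition.transpose x y i = j"
    by (metis transpose_involutory)
  thus "swaprows_mat m y l $$ (?\<tau> i, ?\<tau> j) = (swaprows_mat m x y $$ (i, j) :: 'a)"
    by (simp only: swaprows_mat_entry[OF ij(1,2)] swaprows_mat_entry[OF ij(3,4)])
qed (use assms in simp_all)

lemma addrow_mat_entry:
  assumes "i < m" "j < m"
  shows "addrow_mat m t k l $$ (i, j) = (if i = j then 1 else 0) + (if i = k \<and> j = l then t else (0 :: 'a::comm_ring_1))"
  using assms by simp

lemma swaprows_conj_addrow:
  assumes "k < m" "l < m"
  shows "swaprows_mat m k l * addrow_mat m t x y * swaprows_mat m k l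
    = (addrow_mat m t (Transposition.transpose k l x) (Transposition.transpose k l y) :: 'a::comm_ring_1 mat)"
proof (rule swaprows_conj_eqI)
  fix i j
  let ?\<tau> = "Transposition.transpose k l"
  assume ij: "i < m" "j < m" "?\<tau> i < m" "?\<tau> j < m"
  have "?\<tau> i = ?\<tau> j \<longleftrightarrow> i = j" "?\<tau> i = x \<longleftrightarrow> i = ?\<tau> x" "?\<tau> j = y \<longleftrightarrow> j = ?\<tau> y"
    by (metis transpose_involutory)+
  thus "addrow_mat m t x y $$ (?\<tau> i, ?\<tau> j) = addrow_mat m t (?\<tau> x) (?\<tau> y) $$ (i, j)"
    by (simp only: addrow_mat_entry[OF ij(1,2)] addrow_mat_entry[OF ij(3,4)])
qed (use assms in simp_all)

lemma swaprows_conj_multrow: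
  assumes "x < m" "l < m"
  shows "swaprows_mat m l x * multrow_mat m l u * swaprows_mat m l x = (multrow_mat m x u :: 'a::comm_ring_1 mat)"
proof (rule swaprows_conj_eqI)
  fix i j
  let ?\<tau> = "Transposition.transpose l x"
  assume ij: "i < m" "j < m" "?\<tau> i < m" "?\<tau> j < m"
  have "?\<tau> i = ?\<tau> j \<longleftrightarrow> i = j" "?\<tau> i = l \<longleftrightarrow> i = x" "?\<tau> j = l \<longleftrightarrow> j = x"
    by (metis transpose_involutory transpose_apply_first)+
  thus "multrow_mat m l u $$ (?\<tau> i, ?\<tau> j) = (multrow_mat m x u $$ (i, j) :: 'a)"
    using ij by (simp add: eq_commute[of l] eq_commute[of x])
qed (use assms in simp_all)

text \<open>
  All elementary matrices of size \<open>2 n\<close> are obtained from those listed here by conjugation with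
  transpositions that exchange the two blocks.
\<close>

lemma GL_block_induct:
  assumes g: "g \<in> GL_padic_ints (2 * n)"
    and one: "Q (1\<^sub>m (2 * n))"
    and mult: "\<And>A B. A \<in> GL_padic_ints (2 * n) \<Longrightarrow> B \<in> GL_padic_ints (2 * n) \<Longrightarrow> Q A \<Longrightarrow> Q B \<Longrightarrow> Q (A * B)"
    and swap: "\<And>i j. i < n \<Longrightarrow> j < n \<Longrightarrow> Q (swaprows_mat (2 * n) i (n + j))"
    and addrow: "\<And>i j t. i < n \<Longrightarrow> j < n \<Longrightarrow> t \<in> padic_ints \<Longrightarrow> Q (addrow_mat (2 * n) t i (n + j))"
    and multrow: "\<And>i u. i < n \<Longrightarrow> padic_norm u = 1 \<Longrightarrow> Q (multrow_mat (2 * n) i u)"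
  shows "Q (g :: 'p::prime_card padic mat)"
proof -
  have conj: "Q (swaprows_mat (2 * n) i (n + j) * A * swaprows_mat (2 * n) i (n + j))"
    if "A \<in> GL_padic_ints (2 * n)" "Q A" "i < n" "j < n" for A i j
    using that by (intro mult GL_padic_ints_mult swap swap_GL) auto
  have swap': "Q (swaprows_mat (2 * n) x y)" if xy: "x < 2 * n" "y < 2 * n" "x \<noteq> y" for x y
  proof -
    consider "x < n" "y < n" | j where "x < n" "j < n" "y = n + j" | j where "y < n" "j < n" "x = n + j"
      | i j where "i < n" "j < n" "x = n + i" "y = n + j"
      using xy by (metis add_less_cancel_left le_Suc_ex mult_2 not_le)
    thus ?thesis
    proof cases
      case 1
      \<comment> \<open>Any index of the other block would do as the auxiliary one; n + 0 exists
        because x < n forces n > 0.\<close>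
      have "Q (swaprows_mat (2 * n) x (n + 0) * swaprows_mat (2 * n) y (n + 0) * swaprows_mat (2 * n) x (n + 0))"
        using 1 by (intro conj swap swap_GL) auto
      thus ?thesis using 1 xy by (subst (asm) swaprows_conj_swap) auto
    next
      case 2
      thus ?thesis using swap by simp
    next
      case 3
      thus ?thesis using swap[of y j] by (simp only: swaprows_mat_sym[of "2 * n" "n + j" y])
    next
      case 4
      have "Q (swaprows_mat (2 * n) 0 (n + i) * swaprows_mat (2 * n) 0 (n + j) * swaprows_mat (2 * n) 0 (n + i))"
        using 4 by (intro conj swap swap_GL) auto
      moreover have "swaprows_mat (2 * n) (n + i) 0 * swaprows_mat (2 * n) (n + j) 0 * swaprows_mat (2 * n) (n + i) 0
          = (swaprows_mat (2 * n) (n + i) (n + j) :: 'p padic mat)"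
        using 4 xy by (intro swaprows_conj_swap) auto
      ultimately show ?thesis unfolding 4(3,4)
        by (simp only: swaprows_mat_sym[of "2 * n" "n + i" 0] swaprows_mat_sym[of "2 * n" "n + j" 0])
    qed
  qed
  have addrow': "Q (addrow_mat (2 * n) t x y)" if xy: "x < 2 * n" "y < 2 * n" "x \<noteq> y" and t: "t \<in> padic_ints" for x y t
  proof -
    consider "x < n" "y < n" | j where "x < n" "j < n" "y = n + j" | j where "y < n" "j < n" "x = n + j"
      | i j where "i < n" "j < n" "x = n + i" "y = n + j"
      using xy by (metis add_less_cancel_left le_Suc_ex mult_2 not_le)
    thus ?thesis
    proof cases
      case 1
      have "Q (swaprows_mat (2 * n) y (n + 0) * addrow_mat (2 * n) t x (n + 0) * swaprows_mat (2 * n) y (n + 0))"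
        using 1 t by (intro conj addrow addrow_GL) auto
      thus ?thesis using 1 xy by (subst (asm) swaprows_conj_addrow) auto
    next
      case 2
      thus ?thesis using addrow t by simp
    next
      case 3
      \<comment> \<open>Exchanging the two indices turns an upper right elementary matrix into a
        lower left one.\<close>
      have "Q (swaprows_mat (2 * n) y (n + j) * addrow_mat (2 * n) t y (n + j) * swaprows_mat (2 * n) y (n + j))"
        using 3 t by (intro conj addrow addrow_GL) auto
      thus ?thesis using 3 xy by (subst (asm) swaprows_conj_addrow) auto
    next
      case 4
      have "Q (swaprows_mat (2 * n) 0 (n + i) * addrow_mat (2 * n) t 0 (n + j) * swaprows_mat (2 * n) 0 (n + i))"
        using 4 t by (intro conj addrow addrow_GL) auto
      thus ?thesis using 4 xy by (subst (asm) swaprows_conj_addrow) auto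
    qed
  qed
  have multrow': "Q (multrow_mat (2 * n) x u)" if x: "x < 2 * n" and u: "padic_norm u = 1" for x u
  proof (cases "x < n")
    case True
    thus ?thesis using multrow u by simp
  next
    case False
    then obtain i where i: "x = n + i" "i < n" using x by (metis add_less_cancel_left le_Suc_ex mult_2 not_le)
    have "Q (swaprows_mat (2 * n) 0 (n + i) * multrow_mat (2 * n) 0 u * swaprows_mat (2 * n) 0 (n + i))"
      using i u by (intro conj multrow multrow_GL) auto
    thus ?thesis using i x by (subst (asm) swaprows_conj_multrow) auto
  qed
  have "g \<in> elem_mats (2 * n)" using g by (simp add: GL_padic_ints_eq_elem)
  thus ?thesis
    by (induction rule: elem_mats.induct) (auto intro: one swap' addrow' multrow' mult elem_mats_GL)
qed

section \<open>The action on finite matrices\<close>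

text \<open>For g with blocks a, b, c, d these are a + zc and, in \<open>fin_right\<close>, b + zd.
  As z is a function on all pairs of indices, infinite matrices can be inserted without first
  cutting out a corner.\<close>

definition fin_left :: "nat \<Rightarrow> 'a::comm_ring_1 mat \<Rightarrow> (nat \<times> nat \<Rightarrow> 'a) \<Rightarrow> 'a mat" where
  "fin_left n g z = Matrix.mat n n (\<lambda>(i, j). g $$ (i, j) + (\<Sum>l<n. z (i, l) * g $$ (n + l, j)))"

definition fin_right :: "nat \<Rightarrow> 'a::comm_ring_1 mat \<Rightarrow> (nat \<times> nat \<Rightarrow> 'a) \<Rightarrow> 'a mat" where
  "fin_right n g z = Matrix.mat n n (\<lambda>(i, j). g $$ (i, n + j) + (\<Sum>l<n. z (i, l) * g $$ (n + l, n + j)))"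

definition fin_det :: "nat \<Rightarrow> 'a::comm_ring_1 mat \<Rightarrow> (nat \<times> nat \<Rightarrow> 'a) \<Rightarrow> 'a" where
  "fin_det n g z = det (fin_left n g z)"

text \<open>The inverse of the left block is expressed by the adjugate matrix, which makes measurability obvious.\<close>

definition fin_act :: "nat \<Rightarrow> 'a::field mat \<Rightarrow> (nat \<times> nat \<Rightarrow> 'a) \<Rightarrow> (nat \<times> nat \<Rightarrow> 'a)" where
  "fin_act n g z = (\<lambda>(i, j)\<in>mat_idx n.
     inverse (fin_det n g z) * (\<Sum>l<n. adj_mat (fin_left n g z) $$ (i, l) * fin_right n g z $$ (l, j)))"

lemma fin_carrier [simp]: "fin_left n g z \<in> carrier_mat n n" "fin_right n g z \<in> carrier_mat n n"
  by (simp_all add: fin_left_def fin_right_def)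

lemma mult_mat_index:
  assumes "A \<in> carrier_mat n m" "B \<in> carrier_mat m l" "i < n" "j < l"
  shows "(A * B) $$ (i, j) = (\<Sum>k<m. A $$ (i, k) * (B :: 'a::comm_ring_1 mat) $$ (k, j))"
  using assms by (simp add: scalar_prod_def lessThan_atLeast0)

lemma fin_blocks:
  assumes g: "g \<in> carrier_mat (2 * n) (2 * n)"
  shows "graph_mat (Matrix.mat n n z) * g \<in> carrier_mat n (2 * n)"
    and "left_block (graph_mat (Matrix.mat n n z) * g) = fin_left n g z"
    and "right_block (graph_mat (Matrix.mat n n z) * g) = fin_right n g z"
proof -
  have z: "Matrix.mat n n z \<in> carrier_mat n n" by simp
  show G: "graph_mat (Matrix.mat n n z) * g \<in> carrier_mat n (2 * n)"
    by (rule mult_carrier_mat[OF graph_mat_carrier[OF z] g])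
  show "left_block (graph_mat (Matrix.mat n n z) * g) = fin_left n g z"
  proof (rule eq_matI)
    fix i j assume "i < dim_row (fin_left n g z)" "j < dim_col (fin_left n g z)"
    hence ij: "i < n" "j < n" by (simp_all add: fin_left_def)
    show "left_block (graph_mat (Matrix.mat n n z) * g) $$ (i, j) = fin_left n g z $$ (i, j)"
      unfolding block_index[OF G ij] using ij
      by (subst graph_mat_mult_index[OF z g]) (simp_all add: fin_left_def)
  qed (simp_all add: fin_left_def carrier_matD[OF block_carrier(1)[OF G]])
  show "right_block (graph_mat (Matrix.mat n n z) * g) = fin_right n g z"
  proof (rule eq_matI)
    fix i j assume "i < dim_row (fin_right n g z)" "j < dim_col (fin_right n g z)"
    hence ij: "i < n" "j < n" by (simp_all add: fin_right_def)
    show "right_block (graph_mat (Matrix.mat n n z) * g) $$ (i, j) = fin_right n g z $$ (i, j)"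
      unfolding block_index[OF G ij] using ij
      by (subst graph_mat_mult_index[OF z g]) (simp_all add: fin_right_def)
  qed (simp_all add: fin_right_def carrier_matD[OF block_carrier(2)[OF G]])
qed

text \<open>The adjugate identity turns the explicit formula into the equation (a + zc) w = b + zd,
  in which form the action is easier to handle.\<close>

lemma fin_left_mult_act:
  assumes "fin_det n g z \<noteq> 0"
  shows "fin_left n g z * Matrix.mat n n (fin_act n g z) = fin_right n g z"
proof -
  let ?L = "fin_left n g z" and ?R = "fin_right n g z"
  have L: "?L \<in> carrier_mat n n" and R: "?R \<in> carrier_mat n n" by simp_all
  note adj = adj_mat[OF L]
  have AR: "adj_mat ?L * ?R \<in> carrier_mat n n" by (rule mult_carrier_mat[OF adj(1) R])
  have "Matrix.mat n n (fin_act n g z) = inverse (fin_det n g z) \<cdot>\<^sub>m (adj_mat ?L * ?R)"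
  proof (rule eq_matI)
    fix i j assume "i < dim_row (inverse (fin_det n g z) \<cdot>\<^sub>m (adj_mat ?L * ?R))"
      "j < dim_col (inverse (fin_det n g z) \<cdot>\<^sub>m (adj_mat ?L * ?R))"
    hence ij: "i < n" "j < n" using AR by auto
    have "(inverse (fin_det n g z) \<cdot>\<^sub>m (adj_mat ?L * ?R)) $$ (i, j) = inverse (fin_det n g z) * (adj_mat ?L * ?R) $$ (i, j)"
      by (rule index_smult_mat(1)) (use ij AR in auto)
    also have "\<dots> = Matrix.mat n n (fin_act n g z) $$ (i, j)"
      unfolding mult_mat_index[OF adj(1) R ij] using ij by (simp add: fin_act_def mat_idx_def)
    finally show "Matrix.mat n n (fin_act n g z) $$ (i, j) = (inverse (fin_det n g z) \<cdot>\<^sub>m (adj_mat ?L * ?R)) $$ (i, j)" ..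
  qed (use AR in auto)
  hence "?L * Matrix.mat n n (fin_act n g z) = inverse (fin_det n g z) \<cdot>\<^sub>m (?L * (adj_mat ?L * ?R))"
    using mult_smult_distrib[OF L AR] by simp
  also have "?L * (adj_mat ?L * ?R) = (?L * adj_mat ?L) * ?R"
    by (rule assoc_mult_mat[OF L adj(1) R, symmetric])
  also have "\<dots> = fin_det n g z \<cdot>\<^sub>m ?R"
    unfolding adj(2) fin_det_def mult_smult_assoc_mat[OF one_carrier_mat R] left_mult_one_mat[OF R] ..
  also have "inverse (fin_det n g z) \<cdot>\<^sub>m (fin_det n g z \<cdot>\<^sub>m ?R) = ?R"
    using assms by (intro eq_matI) (auto simp: mult.assoc[symmetric])
  finally show ?thesis .
qed

lemma graph_fin_act:
  assumes g: "g \<in> carrier_mat (2 * n) (2 * n)" and nz: "fin_det n g z \<noteq> 0"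
  shows "graph_mat (Matrix.mat n n z) * g = fin_left n g z * graph_mat (Matrix.mat n n (fin_act n g z))"
proof -
  have w: "Matrix.mat n n (fin_act n g z) \<in> carrier_mat n n" by simp
  show ?thesis
    using eq_mult_graph_mat[OF fin_blocks(1)[OF g] w] fin_left_mult_act[OF nz] unfolding fin_blocks(2,3)[OF g] by simp
qed

lemma mult_mat_left_cancel:
  assumes "A \<in> carrier_mat n n" "det A \<noteq> (0 :: 'a::field)" "B \<in> carrier_mat n n" "C \<in> carrier_mat n n" "A * B = A * C"
  shows "B = C"
proof -
  note adj = adj_mat[OF assms(1)]
  have *: "adj_mat A * (A * X) = det A \<cdot>\<^sub>m X" if X: "X \<in> carrier_mat n n" for X
  proof -
    have "adj_mat A * (A * X) = (adj_mat A * A) * X" by (rule assoc_mult_mat[OF adj(1) assms(1) X, symmetric])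
    thus ?thesis unfolding adj(3) mult_smult_assoc_mat[OF one_carrier_mat X] left_mult_one_mat[OF X] .
  qed
  have eq: "det A \<cdot>\<^sub>m B = det A \<cdot>\<^sub>m C" using *[OF assms(3)] *[OF assms(4)] assms(5) by simp
  show ?thesis
  proof (rule eq_matI)
    fix i j assume ij: "i < dim_row C" "j < dim_col C"
    have "(det A \<cdot>\<^sub>m B) $$ (i, j) = (det A \<cdot>\<^sub>m C) $$ (i, j)" by (simp only: eq)
    thus "B $$ (i, j) = C $$ (i, j)" using ij assms by auto
  qed (use assms in auto)
qed

lemma mat_inj_on_mat_idx:
  assumes "Matrix.mat n n w = Matrix.mat n n w'" "w \<in> extensional (mat_idx n)" "w' \<in> extensional (mat_idx n)"
  shows "w = w'"
proof (rule extensionalityI[OF assms(2,3)])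
  fix x assume "x \<in> mat_idx n"
  then obtain i j where x: "x = (i, j)" "i < n" "j < n" by (auto simp: mat_idx_def)
  have "Matrix.mat n n w $$ (i, j) = Matrix.mat n n w' $$ (i, j)" by (simp only: assms(1))
  thus "w x = w' x" using x by simp
qed

lemma fin_act_extensional: "fin_act n g z \<in> extensional (mat_idx n)"
  by (simp add: fin_act_def)

text \<open>The left block of L (1 | w) is L, so a factorisation of (1 | z) g of this form
  determines L and, by invertibility, also w.\<close>

lemma fin_act_unique:
  assumes g: "g \<in> carrier_mat (2 * n) (2 * n)" and L: "L \<in> carrier_mat n n" and nz: "det L \<noteq> 0"
    and eq: "graph_mat (Matrix.mat n n z) * g = L * graph_mat (Matrix.mat n n w)"
    and w: "w \<in> extensional (mat_idx n)"
  shows "fin_left n g z = L" "fin_det n g z = det L" "fin_act n g z = w"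
proof -
  have wc: "Matrix.mat n n w \<in> carrier_mat n n" by simp
  show L': "fin_left n g z = L"
    using fin_blocks(2)[OF g, of z] left_block_mult_graph(1)[OF L wc] unfolding eq by simp
  thus d: "fin_det n g z = det L" by (simp add: fin_det_def)
  have R: "fin_right n g z = L * Matrix.mat n n w"
    using fin_blocks(3)[OF g, of z] left_block_mult_graph(2)[OF L wc] unfolding eq by simp
  have eq': "L * Matrix.mat n n (fin_act n g z) = L * Matrix.mat n n w"
    using fin_left_mult_act[of n g z] nz unfolding d L' R by simp
  have "Matrix.mat n n (fin_act n g z) = Matrix.mat n n w"
    by (rule mult_mat_left_cancel[OF L nz _ wc eq']) simp
  thus "fin_act n g z = w" by (rule mat_inj_on_mat_idx[OF _ fin_act_extensional w])
qed

text \<open>In terms of (1 | z) the composition law is associativity of the matrix product. The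
  action is from the right, and \<open>fin_det\<close> is a multiplicative cocycle for it.\<close>

lemma fin_act_mult:
  assumes g: "g \<in> carrier_mat (2 * n) (2 * n)" and h: "h \<in> carrier_mat (2 * n) (2 * n)"
    and nz: "fin_det n g z \<noteq> 0"
  shows "fin_left n (g * h) z = fin_left n g z * fin_left n h (fin_act n g z)"
    and "fin_right n (g * h) z = fin_left n g z * fin_right n h (fin_act n g z)"
    and "fin_det n (g * h) z = fin_det n g z * fin_det n h (fin_act n g z)"
    and "fin_det n h (fin_act n g z) \<noteq> 0 \<Longrightarrow> fin_act n (g * h) z = fin_act n h (fin_act n g z)"
proof -
  let ?w = "fin_act n g z"
  let ?M = "graph_mat (Matrix.mat n n ?w)"
  have gh: "g * h \<in> carrier_mat (2 * n) (2 * n)" using g h by simp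
  have zc: "graph_mat (Matrix.mat n n z) \<in> carrier_mat n (2 * n)" by simp
  have wc: "?M \<in> carrier_mat n (2 * n)" by simp
  have L: "fin_left n g z \<in> carrier_mat n n" by simp
  have "graph_mat (Matrix.mat n n z) * (g * h) = (graph_mat (Matrix.mat n n z) * g) * h"
    by (rule assoc_mult_mat[OF zc g h, symmetric])
  also have "\<dots> = fin_left n g z * ?M * h" by (simp only: graph_fin_act[OF g nz])
  also have "\<dots> = fin_left n g z * (?M * h)" by (rule assoc_mult_mat[OF L wc h])
  finally have eq: "graph_mat (Matrix.mat n n z) * (g * h) = fin_left n g z * (?M * h)" .
  show 1: "fin_left n (g * h) z = fin_left n g z * fin_left n h ?w"
    using left_block_mult(1)[OF L fin_blocks(1)[OF h]] unfolding fin_blocks(2)[OF gh, symmetric] eq fin_blocks(2)[OF h] .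
  show "fin_right n (g * h) z = fin_left n g z * fin_right n h ?w"
    using left_block_mult(2)[OF L fin_blocks(1)[OF h]] unfolding fin_blocks(3)[OF gh, symmetric] eq fin_blocks(3)[OF h] .
  show d: "fin_det n (g * h) z = fin_det n g z * fin_det n h ?w"
    unfolding fin_det_def 1 by (rule det_mult[OF L fin_carrier(1)])
  assume nz': "fin_det n h ?w \<noteq> 0"
  have Lh: "fin_left n h ?w \<in> carrier_mat n n" by simp
  have hc: "graph_mat (Matrix.mat n n (fin_act n h ?w)) \<in> carrier_mat n (2 * n)" by simp
  show "fin_act n (g * h) z = fin_act n h ?w"
  proof (rule fin_act_unique(3)[OF gh, where L = "fin_left n (g * h) z"])
    show "det (fin_left n (g * h) z) \<noteq> 0" using d nz nz' by (simp add: fin_det_def)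
    show "graph_mat (Matrix.mat n n z) * (g * h) = fin_left n (g * h) z * graph_mat (Matrix.mat n n (fin_act n h ?w))"
      unfolding eq graph_fin_act[OF h nz'] 1 by (rule assoc_mult_mat[OF L Lh hc, symmetric])
  qed (simp_all add: fin_act_extensional)
qed

text \<open>Two evaluations of the largest minor of (1 | z) g: the right factor g leaves it
  unchanged, and in the form A (1 | w) the left factor contributes |det A|.\<close>

lemma minor_max_fin_act:
  assumes g: "g \<in> GL_padic_ints (2 * n)" and nz: "fin_det n g z \<noteq> 0"
  shows "minor_max (graph_mat (Matrix.mat n n z))
           = padic_norm (fin_det n g z) * minor_max (graph_mat (Matrix.mat n n (fin_act n g z)))"
proof -
  note gc = GL_padic_ints_carrier[OF g]
  have nm: "n = 0 \<or> 2 * n > 0" by auto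
  have zc: "graph_mat (Matrix.mat n n z) \<in> carrier_mat n (2 * n)" by simp
  have wc: "graph_mat (Matrix.mat n n (fin_act n g z)) \<in> carrier_mat n (2 * n)" by simp
  have L: "fin_left n g z \<in> carrier_mat n n" by simp
  have "minor_max (graph_mat (Matrix.mat n n z)) = minor_max (graph_mat (Matrix.mat n n z) * g)"
    by (rule minor_max_GL[OF zc g nm, symmetric])
  also have "\<dots> = padic_norm (fin_det n g z) * minor_max (graph_mat (Matrix.mat n n (fin_act n g z)))"
    unfolding graph_fin_act[OF gc nz] fin_det_def by (rule minor_max_mult_left[OF L wc nm])
  finally show ?thesis .
qed

section \<open>Measurability of determinants, the action and the largest minor\<close>

lemma det_measurable:
  fixes A :: "'a \<Rightarrow> 'p::prime_card padic mat"
  assumes c: "\<And>x. A x \<in> carrier_mat n n"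
    and m: "\<And>i j. i < n \<Longrightarrow> j < n \<Longrightarrow> (\<lambda>x. A x $$ (i, j)) \<in> borel_measurable M"
  shows "(\<lambda>x. det (A x)) \<in> borel_measurable M"
proof -
  have p: "p i < n" if "p \<in> {p. p permutes {0..<n}}" "i \<in> {0..<n}" for p i
    using that permutes_in_image[of p "{0..<n}" i] by auto
  have "(\<lambda>x. \<Sum>p | p permutes {0..<n}. signof p * (\<Prod>i = 0..<n. A x $$ (i, p i))) \<in> borel_measurable M"
    by (intro borel_measurable_sum padic_times_measurable padic_prod_measurable borel_measurable_const m) (auto dest: p)
  moreover have "(\<lambda>x. det (A x)) = (\<lambda>x. \<Sum>p | p permutes {0..<n}. signof p * (\<Prod>i = 0..<n. A x $$ (i, p i)))"
    using det_def'[OF c] by (intro ext) simp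
  ultimately show ?thesis by simp
qed

lemma adj_mat_measurable:
  fixes A :: "'a \<Rightarrow> 'p::prime_card padic mat"
  assumes c: "\<And>x. A x \<in> carrier_mat n n"
    and m: "\<And>i j. i < n \<Longrightarrow> j < n \<Longrightarrow> (\<lambda>x. A x $$ (i, j)) \<in> borel_measurable M"
    and ij: "i < n" "j < n"
  shows "(\<lambda>x. adj_mat (A x) $$ (i, j)) \<in> borel_measurable M"
proof -
  have d: "dim_row (A x) = n" "dim_col (A x) = n" for x using c by auto
  have "(\<lambda>x. det (mat_delete (A x) j i)) \<in> borel_measurable M"
  proof (rule det_measurable)
    show "mat_delete (A x) j i \<in> carrier_mat (n - 1) (n - 1)" for x
      by (simp add: mat_delete_def d)
    fix k l assume kl: "k < n - 1" "l < n - 1"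
    have "(\<lambda>x. mat_delete (A x) j i $$ (k, l)) = (\<lambda>x. A x $$ (if k < j then k else Suc k, if l < i then l else Suc l))"
      using kl by (simp add: mat_delete_def d)
    also have "\<dots> \<in> borel_measurable M" using kl by (intro m) auto
    finally show "(\<lambda>x. mat_delete (A x) j i $$ (k, l)) \<in> borel_measurable M" .
  qed
  hence "(\<lambda>x. (-1) ^ (j + i) * det (mat_delete (A x) j i)) \<in> borel_measurable M"
    by (intro padic_times_measurable borel_measurable_const)
  thus ?thesis using ij by (simp add: adj_mat_def cofactor_def d)
qed

lemma coord_measurable: "i \<in> I \<Longrightarrow> (\<lambda>z. z i) \<in> borel_measurable (PiM I (\<lambda>_. borel))"
  by measurable

lemma fin_left_measurable:
  assumes "i < n" "j < n"
  shows "(\<lambda>z. fin_left n g z $$ (i, j)) \<in> borel_measurable (mat_algebra n :: (nat \<times> nat \<Rightarrow> 'p::prime_card padic) measure)"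
  using assms unfolding fin_left_def mat_algebra_def
  by (auto intro!: borel_measurable_sum padic_times_measurable borel_measurable_add coord_measurable simp: mat_idx_def)

lemma fin_right_measurable:
  assumes "i < n" "j < n"
  shows "(\<lambda>z. fin_right n g z $$ (i, j)) \<in> borel_measurable (mat_algebra n :: (nat \<times> nat \<Rightarrow> 'p::prime_card padic) measure)"
  using assms unfolding fin_right_def mat_algebra_def
  by (auto intro!: borel_measurable_sum padic_times_measurable borel_measurable_add coord_measurable simp: mat_idx_def)

lemma fin_det_measurable [measurable]:
  "fin_det n g \<in> borel_measurable (mat_algebra n :: (nat \<times> nat \<Rightarrow> 'p::prime_card padic) measure)"
  unfolding fin_det_def by (rule det_measurable[OF fin_carrier(1)]) (rule fin_left_measurable)

lemma fin_act_measurable [measurable]: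
  "fin_act n g \<in> mat_algebra n \<rightarrow>\<^sub>M (mat_algebra n :: (nat \<times> nat \<Rightarrow> 'p::prime_card padic) measure)"
proof -
  have "(\<lambda>z. \<lambda>ij\<in>mat_idx n. case ij of (i, j) \<Rightarrow>
      inverse (fin_det n g z) * (\<Sum>l<n. adj_mat (fin_left n g z) $$ (i, l) * fin_right n g z $$ (l, j)))
    \<in> mat_algebra n \<rightarrow>\<^sub>M PiM (mat_idx n) (\<lambda>_. borel :: 'p padic measure)"
  proof (rule measurable_restrict)
    fix ij assume "ij \<in> mat_idx n"
    then obtain i j where ij: "ij = (i, j)" "i < n" "j < n" by (auto simp: mat_idx_def)
    show "(\<lambda>z. case ij of (i, j) \<Rightarrow>
        inverse (fin_det n g z) * (\<Sum>l<n. adj_mat (fin_left n g z) $$ (i, l) * fin_right n g z $$ (l, j)))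
      \<in> borel_measurable (mat_algebra n)"
      unfolding ij using ij(2,3)
      by (auto intro!: padic_times_measurable padic_inverse_measurable borel_measurable_sum fin_det_measurable
          adj_mat_measurable[OF fin_carrier(1)] fin_left_measurable fin_right_measurable)
  qed
  thus ?thesis by (simp add: fin_act_def[abs_def] mat_algebra_def)
qed

lemma minor_max_measurable [measurable]:
  "(\<lambda>z. minor_max (graph_mat (Matrix.mat n n z))) \<in> borel_measurable (mat_algebra n :: (nat \<times> nat \<Rightarrow> 'p::prime_card padic) measure)"
proof -
  let ?F = "{..<n} \<rightarrow>\<^sub>E {..<2 * n}"
  have zc: "graph_mat (Matrix.mat n n z) \<in> carrier_mat n (2 * n)" for z :: "nat \<times> nat \<Rightarrow> 'p padic" by simp
  have eq: "(\<lambda>z. minor_max (graph_mat (Matrix.mat n n z)))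
      = (\<lambda>z :: nat \<times> nat \<Rightarrow> 'p padic. Max ((\<lambda>f. padic_norm (minor (graph_mat (Matrix.mat n n z)) f)) ` ?F))"
    unfolding minor_max_def carrier_matD[OF zc] ..
  show ?thesis unfolding eq
  proof (rule borel_measurable_Max[OF finite_minor_index])
    fix f assume f: "f \<in> ?F"
    have "(\<lambda>z. det (mat\<^sub>r n n (\<lambda>k. col (graph_mat (Matrix.mat n n z)) (f k)))) \<in> borel_measurable (mat_algebra n :: (nat \<times> nat \<Rightarrow> 'p padic) measure)"
    proof (rule det_measurable)
      fix i j assume ij: "i < n" "j < n"
      have fi: "f i < 2 * n" using f ij by auto
      have e: "mat\<^sub>r n n (\<lambda>k. col (graph_mat (Matrix.mat n n z)) (f k)) $$ (i, j)
          = (if f i < n then if j = f i then 1 else 0 else z (j, f i - n))" for z :: "nat \<times> nat \<Rightarrow> 'p padic"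
      proof -
        have "col (graph_mat (Matrix.mat n n z)) (f i) $ j = graph_mat (Matrix.mat n n z) $$ (j, f i)"
          by (rule index_col) (simp_all only: carrier_matD[OF zc] ij fi)
        thus ?thesis using ij fi by (auto simp: graph_mat_def)
      qed
      show "(\<lambda>z. mat\<^sub>r n n (\<lambda>k. col (graph_mat (Matrix.mat n n z)) (f k)) $$ (i, j)) \<in> borel_measurable (mat_algebra n :: (nat \<times> nat \<Rightarrow> 'p padic) measure)"
        unfolding e
      proof -
        show "(\<lambda>z. if f i < n then if j = f i then 1 else 0 else z (j, f i - n)) \<in> borel_measurable (mat_algebra n :: (nat \<times> nat \<Rightarrow> 'p padic) measure)"
        using ij fi unfolding mat_algebra_def by (auto intro!: coord_measurable simp: mat_idx_def)
      qed
    qed simp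
    thus "(\<lambda>z. padic_norm (minor (graph_mat (Matrix.mat n n z)) f)) \<in> borel_measurable (mat_algebra n :: (nat \<times> nat \<Rightarrow> 'p padic) measure)"
      unfolding minor_def carrier_matD(1)[OF zc] by (rule measurable_compose) simp
  qed
qed

section \<open>Jacobians\<close>

text \<open>
  For the exchange of columns, \<open>e\<close> is the inverted entry, \<open>J1\<close> consists of the other entries in the row
  and the column of \<open>e\<close>, and \<open>\<theta>\<close> is the rank one correction of the remaining entries.
\<close>

lemma nn_integral_swap_map:
  fixes F :: "('i \<Rightarrow> 'p::prime_card padic) \<Rightarrow> ennreal" and \<epsilon> :: "'i \<Rightarrow> 'p padic"
    and \<theta> :: "'p padic \<Rightarrow> ('i \<Rightarrow> 'p padic) \<Rightarrow> 'i \<Rightarrow> 'p padic"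
  assumes fin: "finite J1" "finite J2" and dis: "J1 \<inter> J2 = {}" "e \<notin> J1" "e \<notin> J2"
    and \<epsilon>: "\<And>k. k \<in> J1 \<Longrightarrow> padic_norm (\<epsilon> k) = 1"
    and F: "F \<in> borel_measurable (PiM (insert e (J1 \<union> J2)) (\<lambda>_. borel))"
    and T: "T \<in> PiM (insert e (J1 \<union> J2)) (\<lambda>_. borel) \<rightarrow>\<^sub>M PiM (insert e (J1 \<union> J2)) (\<lambda>_. borel)"
    and T_eq: "\<And>z. z e \<noteq> 0 \<Longrightarrow> T z = (\<lambda>k\<in>insert e (J1 \<union> J2). if k = e then inverse (z e)
        else if k \<in> J1 then \<epsilon> k * inverse (z e) * z k else z k + \<theta> (z e) (restrict z J1) k)"
  shows "(\<integral>\<^sup>+z. F (T z) * ennreal (inverse (padic_norm (z e)) ^ (2 + card J1)) \<partial>haar_PiM (insert e (J1 \<union> J2)))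
           = (\<integral>\<^sup>+z. F z \<partial>haar_PiM (insert e (J1 \<union> J2)))"
proof -
  let ?J = "J1 \<union> J2"
  let ?I = "insert e ?J"
  have finJ: "finite ?J" and eJ: "e \<notin> ?J" using fin dis by auto
  have sH: "sets (haar_PiM K :: ('i \<Rightarrow> 'p padic) measure) = sets (PiM K (\<lambda>_. borel))" for K :: "'i set"
    by (rule sets_haar_PiM)
  have F': "F \<in> borel_measurable (haar_PiM ?I)"
    using F measurable_cong_sets[OF sH refl] by blast
  have T': "T \<in> haar_PiM ?I \<rightarrow>\<^sub>M haar_PiM ?I"
    using T measurable_cong_sets[OF sH sH] by blast
  have upd: "(\<lambda>x. x(e := y)) \<in> haar_PiM ?J \<rightarrow>\<^sub>M haar_PiM ?I" for y :: "'p padic"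
    by (rule measurable_fun_upd[of _ ?J]) (auto simp: measurable_ident)
  have [measurable]: "(\<lambda>z. z e) \<in> borel_measurable (haar_PiM ?I :: ('i \<Rightarrow> 'p padic) measure)"
    using coord_measurable[of e ?I] measurable_cong_sets[OF sH refl] by blast
  \<comment> \<open>The inner integral for a fixed value of the coordinate e; it reduces the claim
    to one variable.\<close>
  define B where "B y = (\<integral>\<^sup>+x. F (x(e := y)) \<partial>haar_PiM ?J)" for y
  have B: "B \<in> borel_measurable borel"
  proof -
    interpret J: sigma_finite_measure "haar_PiM ?J :: ('i \<Rightarrow> 'p padic) measure"
      by (rule haar_product.sigma_finite[OF finJ])
    have "(\<lambda>(x, y). F (x(e := y))) \<in> borel_measurable (haar_PiM ?J \<Otimes>\<^sub>M haar)"
      using measurable_compose[OF measurable_add_dim[of e ?J "\<lambda>_. haar"] F'] by (simp add: split_beta' comp_def)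
    hence "(\<lambda>(y, x). F (x(e := y))) \<in> borel_measurable (haar \<Otimes>\<^sub>M haar_PiM ?J)"
      using measurable_pair_swap_iff[of "\<lambda>(x, y). F (x(e := y))" "haar_PiM ?J" haar borel] by (simp add: split_beta')
    hence "B \<in> borel_measurable haar" unfolding B_def[abs_def] by (rule J.borel_measurable_nn_integral)
    thus ?thesis by simp
  qed
  have inner: "(\<integral>\<^sup>+x. F (T (x(e := y))) \<partial>haar_PiM ?J) * ennreal (inverse (padic_norm y) ^ card J1) = B (inverse y)"
    if y: "y \<noteq> 0" for y
  proof -
    let ?c = "\<lambda>k. \<epsilon> k * inverse y"
    have mF: "(\<lambda>x. F (x(e := v))) \<in> borel_measurable (haar_PiM ?J)" for v
      by (rule measurable_compose[OF upd F'])
    have mFT: "(\<lambda>x. F (T (x(e := v)))) \<in> borel_measurable (haar_PiM ?J)" for v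
      by (rule measurable_compose[OF measurable_compose[OF upd T'] F'])
    \<comment> \<open>The inner coordinates are split into the scaled ones, J1, and the translated
      ones, J2. The translation depends only on y and on the coordinates in J1, so J2 is integrated
      first.\<close>
    define G where "G x1 x2 = F ((merge J1 J2 (x1, x2))(e := inverse y))" for x1 x2
    define K where "K x1 = (\<integral>\<^sup>+x2. G x1 x2 \<partial>haar_PiM J2)" for x1
    have mG: "(\<lambda>(x1, x2). G x1 x2) \<in> borel_measurable (haar_PiM J1 \<Otimes>\<^sub>M haar_PiM J2)"
      using measurable_compose[OF measurable_merge[of J1 J2 "\<lambda>_. haar"] mF[of "inverse y"]] by (simp add: G_def split_beta')
    interpret J2: sigma_finite_measure "haar_PiM J2 :: ('i \<Rightarrow> 'p padic) measure"
      by (rule haar_product.sigma_finite[OF fin(2)])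
    have mK: "K \<in> borel_measurable (PiM J1 (\<lambda>_. borel))"
      using J2.borel_measurable_nn_integral[OF mG] measurable_cong_sets[OF sH refl]
      unfolding K_def[abs_def] by blast
    have mG2: "G x1 \<in> borel_measurable (PiM J2 (\<lambda>_. borel))" if "x1 \<in> space (haar_PiM J1)" for x1
      using measurable_compose_Pair1[OF that mG] measurable_cong_sets[OF sH refl] by simp
    have Teq: "F (T ((merge J1 J2 (x1, x2))(e := y)))
        = G (\<lambda>k\<in>J1. ?c k * x1 k + 0) (\<lambda>k\<in>J2. 1 * x2 k + \<theta> y x1 k)"
      if x: "x1 \<in> space (haar_PiM J1)" for x1 x2
    proof -
      have r: "restrict ((merge J1 J2 (x1, x2))(e := y)) J1 = x1"
        using x dis by (auto simp: space_PiM PiE_iff extensional_def restrict_def merge_def fun_eq_iff)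
      have "T ((merge J1 J2 (x1, x2))(e := y))
        = (merge J1 J2 (\<lambda>k\<in>J1. ?c k * x1 k + 0, \<lambda>k\<in>J2. 1 * x2 k + \<theta> y x1 k))(e := inverse y)"
        unfolding T_eq[of "(merge J1 J2 (x1, x2))(e := y)", unfolded r fun_upd_same, OF y]
        using dis by (auto simp: fun_eq_iff merge_def)
      thus ?thesis by (simp add: G_def)
    qed
    have "(\<integral>\<^sup>+x. F (T (x(e := y))) \<partial>haar_PiM ?J)
        = (\<integral>\<^sup>+x1. \<integral>\<^sup>+x2. F (T ((merge J1 J2 (x1, x2))(e := y))) \<partial>haar_PiM J2 \<partial>haar_PiM J1)"
      by (rule haar_product.product_nn_integral_fold[OF dis(1) fin mFT])
    also have "\<dots> = (\<integral>\<^sup>+x1. K (\<lambda>k\<in>J1. ?c k * x1 k + 0) \<partial>haar_PiM J1)"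
    proof (rule nn_integral_cong)
      fix x1 :: "'i \<Rightarrow> 'p padic" assume x1: "x1 \<in> space (haar_PiM J1)"
      have sp: "(\<lambda>k\<in>J1. ?c k * x1 k + 0) \<in> space (haar_PiM J1)" by (simp add: space_PiM)
      have "(\<integral>\<^sup>+x2. F (T ((merge J1 J2 (x1, x2))(e := y))) \<partial>haar_PiM J2)
          = (\<integral>\<^sup>+x2. G (\<lambda>k\<in>J1. ?c k * x1 k + 0) (\<lambda>k\<in>J2. 1 * x2 k + \<theta> y x1 k) \<partial>haar_PiM J2)"
        by (simp only: Teq[OF x1])
      also have "\<dots> = K (\<lambda>k\<in>J1. ?c k * x1 k + 0)"
        using nn_integral_haar_PiM_affine[where c = "\<lambda>_. 1" and w = "\<theta> y x1", OF fin(2) _ mG2[OF sp]] by (simp add: K_def)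
      finally show "(\<integral>\<^sup>+x2. F (T ((merge J1 J2 (x1, x2))(e := y))) \<partial>haar_PiM J2) = K (\<lambda>k\<in>J1. ?c k * x1 k + 0)" .
    qed
    finally have 1: "(\<integral>\<^sup>+x. F (T (x(e := y))) \<partial>haar_PiM ?J) = (\<integral>\<^sup>+x1. K (\<lambda>k\<in>J1. ?c k * x1 k + 0) \<partial>haar_PiM J1)" .
    have c0: "?c k \<noteq> 0" if "k \<in> J1" for k using \<epsilon>[OF that] y by auto
    \<comment> \<open>Every coordinate in J1 is multiplied by a unit times 1/y; this accounts for
      all but two of the powers of |y|.\<close>
    have "(\<Prod>k\<in>J1. padic_norm (?c k)) = inverse (padic_norm y) ^ card J1"
      using \<epsilon> by (simp add: padic_norm_mult padic_norm_inverse)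
    hence "ennreal (inverse (padic_norm y) ^ card J1) * (\<integral>\<^sup>+x1. K (\<lambda>k\<in>J1. ?c k * x1 k + 0) \<partial>haar_PiM J1)
        = (\<integral>\<^sup>+x1. K x1 \<partial>haar_PiM J1)"
      using nn_integral_haar_PiM_affine[where c = ?c and w = "\<lambda>_. 0", OF fin(1) c0 mK] by simp
    also have "\<dots> = B (inverse y)"
      unfolding B_def K_def G_def by (rule haar_product.product_nn_integral_fold[OF dis(1) fin mF, symmetric])
    finally show ?thesis unfolding 1 by (simp add: mult.commute)
  qed
  have mall: "(\<lambda>z. F (T z) * ennreal (inverse (padic_norm (z e)) ^ (2 + card J1))) \<in> borel_measurable (haar_PiM ?I)"
    by (intro borel_measurable_times_ennreal measurable_compose[OF T' F']) measurable
  have "(\<integral>\<^sup>+z. F (T z) * ennreal (inverse (padic_norm (z e)) ^ (2 + card J1)) \<partial>haar_PiM ?I)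
      = (\<integral>\<^sup>+y. \<integral>\<^sup>+x. F (T (x(e := y))) * ennreal (inverse (padic_norm ((x(e := y)) e)) ^ (2 + card J1)) \<partial>haar_PiM ?J \<partial>haar)"
    by (rule haar_product.product_nn_integral_insert_rev[OF finJ eJ mall])
  also have "\<dots> = (\<integral>\<^sup>+y. ennreal (padic_norm y powi (-2)) * B (inverse y) \<partial>haar)"
  proof (rule nn_integral_cong)
    fix y :: "'p padic"
    show "(\<integral>\<^sup>+x. F (T (x(e := y))) * ennreal (inverse (padic_norm ((x(e := y)) e)) ^ (2 + card J1)) \<partial>haar_PiM ?J)
        = ennreal (padic_norm y powi (-2)) * B (inverse y)"
    proof (cases "y = 0")
      \<comment> \<open>Both sides vanish because \<open>inverse 0 = 0\<close> and the exponents are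
        nonzero.\<close>
      case True
      thus ?thesis by simp
    next
      case False
      have mFT: "(\<lambda>x. F (T (x(e := y)))) \<in> borel_measurable (haar_PiM ?J)"
        by (rule measurable_compose[OF measurable_compose[OF upd T'] F'])
      have p2: "padic_norm y powi (-2) = inverse (padic_norm y) ^ 2" by (simp add: power_int_minus power_inverse)
      have "(\<integral>\<^sup>+x. F (T (x(e := y))) * ennreal (inverse (padic_norm ((x(e := y)) e)) ^ (2 + card J1)) \<partial>haar_PiM ?J)
          = (\<integral>\<^sup>+x. F (T (x(e := y))) \<partial>haar_PiM ?J) * ennreal (inverse (padic_norm y) ^ (2 + card J1))"
        by (simp only: fun_upd_same) (rule nn_integral_multc[OF mFT])
      also have "ennreal (inverse (padic_norm y) ^ (2 + card J1))
          = ennreal (inverse (padic_norm y) ^ card J1) * ennreal (padic_norm y powi (-2))"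
        unfolding p2 by (subst ennreal_mult[symmetric]) (simp_all add: power_add power2_eq_square mult.commute del: power_inverse)
      also have "(\<integral>\<^sup>+x. F (T (x(e := y))) \<partial>haar_PiM ?J) * (ennreal (inverse (padic_norm y) ^ card J1) * ennreal (padic_norm y powi (-2)))
          = ennreal (padic_norm y powi (-2)) * ((\<integral>\<^sup>+x. F (T (x(e := y))) \<partial>haar_PiM ?J) * ennreal (inverse (padic_norm y) ^ card J1))"
        by (simp only: mult_ac)
      finally show ?thesis unfolding inner[OF False] .
    qed
  qed
  also have "\<dots> = (\<integral>\<^sup>+y. B y \<partial>haar)" by (rule nn_integral_haar_inverse[OF B])
  also have "\<dots> = (\<integral>\<^sup>+z. F z \<partial>haar_PiM ?I)"
    unfolding B_def by (rule haar_product.product_nn_integral_insert_rev[OF finJ eJ F', symmetric])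
  finally show ?thesis .
qed


lemma sets_vol [simp, measurable_cong]: "sets (vol n :: (nat \<times> nat \<Rightarrow> 'p::prime_card padic) measure) = sets (mat_algebra n)"
  unfolding vol_eq_haar_PiM mat_algebra_def by (rule sets_haar_PiM)

lemma space_vol: "space (vol n :: (nat \<times> nat \<Rightarrow> 'p::prime_card padic) measure) = extensional (mat_idx n)"
  using sets_eq_imp_space_eq[OF sets_vol[of n, where 'p='p]] by (auto simp: mat_algebra_def space_PiM PiE_def)

lemma measurable_vol: "f \<in> borel_measurable (mat_algebra n) \<Longrightarrow> f \<in> borel_measurable (vol n)"
  using measurable_cong_sets[OF sets_vol refl] by blast

definition fin_jacobian :: "nat \<Rightarrow> 'p::prime_card padic mat \<Rightarrow> (nat \<times> nat \<Rightarrow> 'p padic) \<Rightarrow> ennreal" where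
  "fin_jacobian n g z = ennreal (inverse (padic_norm (fin_det n g z)) ^ (2 * n))"

text \<open>Stated for all nonnegative measurable F, so that in a composition the Jacobian of the
  second factor can become part of the integrand for the first.\<close>

definition vol_change :: "nat \<Rightarrow> 'p::prime_card padic mat \<Rightarrow> bool" where
  "vol_change n g \<longleftrightarrow> (AE z in vol n. fin_det n g z \<noteq> 0) \<and>
     (\<forall>F\<in>borel_measurable (mat_algebra n).
        (\<integral>\<^sup>+z. F (fin_act n g z) * fin_jacobian n g z \<partial>vol n) = (\<integral>\<^sup>+z. F z \<partial>vol n))"

lemma fin_jacobian_measurable [measurable]: "fin_jacobian n g \<in> borel_measurable (mat_algebra n)"
proof -
  have "(\<lambda>z. padic_norm (fin_det n g z)) \<in> borel_measurable (mat_algebra n)"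
    by (rule measurable_compose[OF fin_det_measurable padic_norm_measurable])
  thus ?thesis unfolding fin_jacobian_def by measurable
qed

text \<open>The Jacobians multiply by the cocycle property of \<open>fin_det\<close>. The delicate
  point is that the action of A sends almost every point into the domain of B.\<close>

lemma vol_change_mult:
  assumes A: "A \<in> carrier_mat (2 * n) (2 * n)" and B: "B \<in> carrier_mat (2 * n) (2 * n)"
    and "vol_change n A" "vol_change n (B :: 'p::prime_card padic mat)"
  shows "vol_change n (A * B)"
proof -
  have aeA: "AE z in vol n. fin_det n A z \<noteq> 0" and aeB: "AE z in vol n. fin_det n B z \<noteq> 0"
    and iA: "\<And>F. F \<in> borel_measurable (mat_algebra n) \<Longrightarrow>
        (\<integral>\<^sup>+z. F (fin_act n A z) * fin_jacobian n A z \<partial>vol n) = (\<integral>\<^sup>+z. F z \<partial>vol n)"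
    and iB: "\<And>F. F \<in> borel_measurable (mat_algebra n) \<Longrightarrow>
        (\<integral>\<^sup>+z. F (fin_act n B z) * fin_jacobian n B z \<partial>vol n) = (\<integral>\<^sup>+z. F z \<partial>vol n)"
    using assms(3,4) by (auto simp: vol_change_def)
  \<comment> \<open>The formula for A, applied to the indicator of the singular set of B, shows that
    the preimage of this null set is null, because the Jacobian is nonzero wherever A acts.\<close>
  let ?N = "\<lambda>z. if fin_det n B z = 0 then 1 else 0 :: ennreal"
  have mN: "?N \<in> borel_measurable (mat_algebra n)"
    by (rule measurable_compose[OF fin_det_measurable, where g = "\<lambda>x. if x = 0 then 1 else 0"]) measurable
  have mNA: "(\<lambda>z. ?N (fin_act n A z) * fin_jacobian n A z) \<in> borel_measurable (vol n)"
    by (intro measurable_vol borel_measurable_times_ennreal measurable_compose[OF fin_act_measurable mN] fin_jacobian_measurable)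
  have "(\<integral>\<^sup>+z. ?N z \<partial>vol n) = 0"
    using aeB by (subst nn_integral_0_iff_AE[OF measurable_vol[OF mN]]) auto
  hence "(\<integral>\<^sup>+z. ?N (fin_act n A z) * fin_jacobian n A z \<partial>vol n) = 0" using iA[OF mN] by simp
  hence "AE z in vol n. ?N (fin_act n A z) * fin_jacobian n A z = 0"
    by (subst (asm) nn_integral_0_iff_AE[OF mNA])
  hence ae: "AE z in vol n. fin_det n A z \<noteq> 0 \<and> fin_det n B (fin_act n A z) \<noteq> 0"
    using aeA
  proof eventually_elim
    case (elim z)
    have "fin_jacobian n A z \<noteq> 0" using elim by (simp add: fin_jacobian_def)
    thus ?case using elim by (auto split: if_splits)
  qed
  show ?thesis unfolding vol_change_def
  proof (intro conjI ballI)
    show "AE z in vol n. fin_det n (A * B) z \<noteq> 0"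
      using ae by eventually_elim (simp add: fin_act_mult(3)[OF A B])
    fix F :: "(nat \<times> nat \<Rightarrow> 'p padic) \<Rightarrow> ennreal" assume F: "F \<in> borel_measurable (mat_algebra n)"
    let ?F = "\<lambda>z. F (fin_act n B z) * fin_jacobian n B z"
    have mF: "?F \<in> borel_measurable (mat_algebra n)"
      by (intro borel_measurable_times_ennreal measurable_compose[OF fin_act_measurable F] fin_jacobian_measurable)
    have "(\<integral>\<^sup>+z. F (fin_act n (A * B) z) * fin_jacobian n (A * B) z \<partial>vol n)
        = (\<integral>\<^sup>+z. ?F (fin_act n A z) * fin_jacobian n A z \<partial>vol n)"
    proof (rule nn_integral_cong_AE)
      show "AE z in vol n. F (fin_act n (A * B) z) * fin_jacobian n (A * B) z = ?F (fin_act n A z) * fin_jacobian n A z"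
        using ae
      proof eventually_elim
        case (elim z)
        have "fin_jacobian n (A * B) z = fin_jacobian n B (fin_act n A z) * fin_jacobian n A z"
          unfolding fin_jacobian_def fin_act_mult(3)[OF A B conjunct1[OF elim]]
          by (subst ennreal_mult[symmetric]) (simp_all add: padic_norm_mult power_mult_distrib mult.commute)
        thus ?case using fin_act_mult(4)[OF A B] elim by (simp add: mult.assoc)
      qed
    qed
    also have "\<dots> = (\<integral>\<^sup>+z. F z \<partial>vol n)" using iA[OF mF] iB[OF F] by simp
    finally show "(\<integral>\<^sup>+z. F (fin_act n (A * B) z) * fin_jacobian n (A * B) z \<partial>vol n) = (\<integral>\<^sup>+z. F z \<partial>vol n)" .
  qed
qed

lemma fin_act_eqI:
  assumes "fin_det n g z \<noteq> 0" "w \<in> extensional (mat_idx n)"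
    and "fin_right n g z = fin_left n g z * Matrix.mat n n w"
  shows "fin_act n g z = w"
proof (rule mat_inj_on_mat_idx[OF _ fin_act_extensional assms(2)])
  have "det (fin_left n g z) \<noteq> 0" using assms(1) by (simp add: fin_det_def)
  moreover have "fin_left n g z * Matrix.mat n n (fin_act n g z) = fin_left n g z * Matrix.mat n n w"
    using fin_left_mult_act[OF assms(1)] assms(3) by simp
  ultimately show "Matrix.mat n n (fin_act n g z) = Matrix.mat n n w"
    by (rule mult_mat_left_cancel[OF fin_carrier(1) _ mat_carrier mat_carrier])
qed

text \<open>Scaling coordinates by units and translating them preserves the product of Haar
  measures, and a determinant of norm 1 makes the Jacobian trivial.\<close>

lemma vol_change_affineI:
  fixes c w :: "nat \<times> nat \<Rightarrow> 'p::prime_card padic"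
  assumes det: "\<And>z. padic_norm (fin_det n g z) = 1"
    and act: "\<And>z. fin_act n g z = (\<lambda>ij\<in>mat_idx n. c ij * z ij + w ij)"
    and c: "\<And>ij. padic_norm (c ij) = 1"
  shows "vol_change n g"
  unfolding vol_change_def
proof (intro conjI ballI)
  have "fin_det n g z \<noteq> 0" for z using det[of z] by auto
  thus "AE z in vol n. fin_det n g z \<noteq> 0" by simp
  fix F :: "(nat \<times> nat \<Rightarrow> 'p padic) \<Rightarrow> ennreal" assume F: "F \<in> borel_measurable (mat_algebra n)"
  have I: "finite (mat_idx n)" by (simp add: mat_idx_def)
  have c0: "c ij \<noteq> 0" for ij using c[of ij] by auto
  have "(\<integral>\<^sup>+z. F (\<lambda>ij\<in>mat_idx n. c ij * z ij + w ij) \<partial>haar_PiM (mat_idx n)) = (\<integral>\<^sup>+z. F z \<partial>haar_PiM (mat_idx n))"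
    using nn_integral_haar_PiM_affine[where c = c and w = w, OF I c0 F[unfolded mat_algebra_def]] by (simp add: c)
  thus "(\<integral>\<^sup>+z. F (fin_act n g z) * fin_jacobian n g z \<partial>vol n) = (\<integral>\<^sup>+z. F z \<partial>vol n)"
    by (simp add: vol_eq_haar_PiM act fin_jacobian_def det)
qed

lemma sum_mult_delta: "b < n \<Longrightarrow> (\<Sum>l<n. f l * (if l = b then 1 else 0)) = (f b :: 'a::comm_ring_1)" for n :: nat
proof -
  assume "b < n"
  have "(\<Sum>l<n. f l * (if l = b then 1 else 0)) = (\<Sum>l<n. if l = b then f l else 0)" by (rule sum.cong) auto
  thus ?thesis using \<open>b < n\<close> by simp
qed

lemma vol_change_one: "vol_change n (1\<^sub>m (2 * n) :: 'p::prime_card padic mat)"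
proof -
  let ?g = "1\<^sub>m (2 * n) :: 'p padic mat"
  have L: "fin_left n ?g z = 1\<^sub>m n" for z by (rule eq_matI) (auto simp: fin_left_def)
  have R: "fin_right n ?g z = Matrix.mat n n z" for z
    by (rule eq_matI) (auto simp: fin_right_def sum_mult_delta)
  have d: "fin_det n ?g z = 1" for z by (simp add: fin_det_def L)
  have a: "fin_act n ?g z = (\<lambda>ij\<in>mat_idx n. 1 * z ij + 0)" for z
  proof (rule fin_act_eqI)
    show "fin_right n ?g z = fin_left n ?g z * Matrix.mat n n (\<lambda>ij\<in>mat_idx n. 1 * z ij + 0)"
      unfolding L R left_mult_one_mat[OF mat_carrier] by (rule eq_matI) (auto simp: mat_idx_def)
  qed (simp_all add: d)
  show ?thesis by (rule vol_change_affineI[OF _ a]) (simp_all add: d)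
qed

lemma vol_change_addrow:
  assumes ij: "i < n" "j < n"
  shows "vol_change n (addrow_mat (2 * n) t i (n + j) :: 'p::prime_card padic mat)"
proof -
  let ?g = "addrow_mat (2 * n) t i (n + j) :: 'p padic mat"
  have g: "?g $$ (x, y) = (if x = y then 1 else 0) + (if x = i \<and> y = n + j then t else 0)" if "x < 2 * n" "y < 2 * n" for x y
    by (rule addrow_mat_entry[OF that])
  have L: "fin_left n ?g z = 1\<^sub>m n" for z
    by (rule eq_matI) (use ij in \<open>auto simp: fin_left_def g simp del: index_mat_addrow_mat(1)\<close>)
  have R: "fin_right n ?g z = Matrix.mat n n (\<lambda>ij'. z ij' + (if ij' = (i, j) then t else 0))" for z
  proof (rule eq_matI)
    fix a b assume "a < dim_row (Matrix.mat n n (\<lambda>ij'. z ij' + (if ij' = (i, j) then t else 0)))"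
      "b < dim_col (Matrix.mat n n (\<lambda>ij'. z ij' + (if ij' = (i, j) then t else 0)))"
    hence ab: "a < n" "b < n" by simp_all
    have "(\<Sum>l<n. z (a, l) * ?g $$ (n + l, n + b)) = (\<Sum>l<n. z (a, l) * (if l = b then 1 else 0))"
      using ab ij by (intro sum.cong refl) (simp add: g del: index_mat_addrow_mat(1))
    also have "\<dots> = z (a, b)" by (rule sum_mult_delta[OF ab(2)])
    finally show "fin_right n ?g z $$ (a, b) = Matrix.mat n n (\<lambda>ij'. z ij' + (if ij' = (i, j) then t else 0)) $$ (a, b)"
      using ab ij by (simp add: fin_right_def g del: index_mat_addrow_mat(1))
  qed (simp_all add: fin_right_def)
  have d: "fin_det n ?g z = 1" for z by (simp add: fin_det_def L)
  have a: "fin_act n ?g z = (\<lambda>ij'\<in>mat_idx n. 1 * z ij' + (if ij' = (i, j) then t else 0))" for z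
  proof (rule fin_act_eqI)
    show "fin_right n ?g z = fin_left n ?g z * Matrix.mat n n (\<lambda>ij'\<in>mat_idx n. 1 * z ij' + (if ij' = (i, j) then t else 0))"
      unfolding L R left_mult_one_mat[OF mat_carrier] by (rule eq_matI) (auto simp: mat_idx_def)
  qed (simp_all add: d)
  show ?thesis by (rule vol_change_affineI[OF _ a]) (simp_all add: d)
qed

lemma vol_change_multrow:
  assumes i: "i < n" and u: "padic_norm u = 1"
  shows "vol_change n (multrow_mat (2 * n) i u :: 'p::prime_card padic mat)"
proof -
  let ?g = "multrow_mat (2 * n) i u :: 'p padic mat"
  \<comment> \<open>The unit stands in row i of the left block, so the return to the form (1 | w)
    divides row i of z by u.\<close>
  let ?c = "\<lambda>ij :: nat \<times> nat. if fst ij = i then inverse u else 1"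
  have u0: "u \<noteq> 0" using u by auto
  have g: "?g $$ (x, y) = (if x = y then if x = i then u else 1 else 0)" if "x < 2 * n" "y < 2 * n" for x y
    using that by auto
  have L: "fin_left n ?g z = multrow_mat n i u" for z
    by (rule eq_matI) (use i in \<open>auto simp: fin_left_def g simp del: index_mat_multrow_mat(1)\<close>, auto)
  have R: "fin_right n ?g z = Matrix.mat n n z" for z
  proof (rule eq_matI)
    fix a b assume "a < dim_row (Matrix.mat n n z)" "b < dim_col (Matrix.mat n n z)"
    hence ab: "a < n" "b < n" by simp_all
    have "(\<Sum>l<n. z (a, l) * ?g $$ (n + l, n + b)) = (\<Sum>l<n. z (a, l) * (if l = b then 1 else 0))"
      using ab i by (intro sum.cong refl) (simp add: g del: index_mat_multrow_mat(1))
    also have "\<dots> = z (a, b)" by (rule sum_mult_delta[OF ab(2)])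
    finally show "fin_right n ?g z $$ (a, b) = Matrix.mat n n z $$ (a, b)"
      using ab i by (simp add: fin_right_def g del: index_mat_multrow_mat(1))
  qed (simp_all add: fin_right_def)
  have d: "fin_det n ?g z = u" for z
    using det_multrow_mat[OF i, of u] by (simp add: fin_det_def L)
  have a: "fin_act n ?g z = (\<lambda>ij\<in>mat_idx n. ?c ij * z ij + 0)" for z
  proof (rule fin_act_eqI)
    show "fin_right n ?g z = fin_left n ?g z * Matrix.mat n n (\<lambda>ij\<in>mat_idx n. ?c ij * z ij + 0)"
      unfolding L R multrow_mat[OF mat_carrier, symmetric]
      by (rule eq_matI) (use i u0 in \<open>auto simp: mat_idx_def\<close>)
  qed (use u0 in \<open>simp_all add: d\<close>)
  show ?thesis by (rule vol_change_affineI[OF _ a]) (simp_all add: d u padic_norm_inverse)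
qed

text \<open>Only the identity contributes to the sum over all permutations.\<close>

lemma det_replaced_column:
  assumes A: "A \<in> carrier_mat n n" and i: "i < n"
    and col: "\<And>a b. a < n \<Longrightarrow> b < n \<Longrightarrow> b \<noteq> i \<Longrightarrow> A $$ (a, b) = (if a = b then 1 else 0)"
  shows "det A = (A $$ (i, i) :: 'a::comm_ring_1)"
proof -
  let ?P = "{p. p permutes {0..<n}}"
  have id: "id \<in> ?P" by (simp add: permutes_id)
  have z: "signof p * (\<Prod>b<n. A $$ (p b, b)) = 0" if p: "p \<in> ?P - {id}" for p
  proof -
    have pp: "p permutes {0..<n}" and pid: "p \<noteq> id" using p by auto
    have "\<exists>b<n. b \<noteq> i \<and> p b \<noteq> b"
    proof (rule ccontr)
      assume "\<not> (\<exists>b<n. b \<noteq> i \<and> p b \<noteq> b)"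
      hence fix1: "p b = b" if "b \<noteq> i" for b
        using that permutes_not_in[OF pp, of b] by (cases "b < n") auto
      \<comment> \<open>A permutation that fixes every point except possibly i also fixes i.\<close>
      have "p i = i"
      proof (rule ccontr)
        assume "p i \<noteq> i"
        hence "p (p i) = p i" by (rule fix1)
        hence "p i = i" using permutes_inj[OF pp] by (auto dest: injD)
        thus False using \<open>p i \<noteq> i\<close> by simp
      qed
      hence "p = id" using fix1 by (metis eq_id_iff)
      thus False using pid by simp
    qed
    then obtain b where b: "b < n" "b \<noteq> i" "p b \<noteq> b" by blast
    have "p b < n" using permutes_in_image[OF pp, of b] b(1) by simp
    hence "A $$ (p b, b) = 0" using col[of "p b" b] b by simp
    hence "(\<Prod>b<n. A $$ (p b, b)) = 0" using b(1) by (intro prod_zero) auto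
    thus ?thesis by simp
  qed
  have "det A = (\<Sum>p\<in>?P. signof p * (\<Prod>b<n. A $$ (p b, b)))" by (rule det_col[OF A])
  also have "\<dots> = (\<Sum>p\<in>{id}. signof p * (\<Prod>b<n. A $$ (p b, b)))"
    by (rule sum.mono_neutral_right) (use id z in \<open>auto simp: finite_permutations\<close>)
  also have "\<dots> = (\<Prod>b<n. A $$ (b, b))" by simp
  also have "\<dots> = (\<Prod>b<n. if b = i then A $$ (i, i) else 1)"
    using col by (intro prod.cong) auto
  also have "\<dots> = A $$ (i, i)" using i by simp
  finally show ?thesis .
qed

text \<open>The exchange acts as a Gauss-Jordan pivot step at the entry (i, j): this entry is
  inverted, the rest of its row and column is divided by it, the column with a sign, and the
  remaining entries form a Schur complement. The left block is the identity with column i replaced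
  by column j of z, so its determinant is the pivot.\<close>

lemma vol_change_swap:
  assumes ij: "i < n" "j < n"
  shows "vol_change n (swaprows_mat (2 * n) i (n + j) :: 'p::prime_card padic mat)"
proof -
  let ?g = "swaprows_mat (2 * n) i (n + j) :: 'p padic mat"
  let ?I = "mat_idx n"
  let ?e = "(i, j)"
  define J1 where "J1 = {i} \<times> ({..<n} - {j}) \<union> ({..<n} - {i}) \<times> {j}"
  define J2 where "J2 = ({..<n} - {i}) \<times> ({..<n} - {j})"
  define \<epsilon> where "\<epsilon> ab = (if fst ab = i then 1 else -1 :: 'p padic)" for ab :: "nat \<times> nat"
  define \<theta> where "\<theta> y x ab = - (x (fst ab, j) * x (i, snd ab) * inverse y)"
    for y :: "'p padic" and x :: "nat \<times> nat \<Rightarrow> 'p padic" and ab :: "nat \<times> nat"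
  define T where "T z = (\<lambda>k\<in>insert ?e (J1 \<union> J2). if k = ?e then inverse (z ?e)
        else if k \<in> J1 then \<epsilon> k * inverse (z ?e) * z k else z k + \<theta> (z ?e) (restrict z J1) k)"
    for z :: "nat \<times> nat \<Rightarrow> 'p padic"
  have I: "?I = insert ?e (J1 \<union> J2)" using ij by (auto simp: mat_idx_def J1_def J2_def)
  have fin: "finite J1" "finite J2" and dis: "J1 \<inter> J2 = {}" "?e \<notin> J1" "?e \<notin> J2"
    by (auto simp: J1_def J2_def)
  have "card J1 = card ({i} \<times> ({..<n} - {j})) + card (({..<n} - {i}) \<times> {j})"
    unfolding J1_def by (rule card_Un_disjoint) auto
  \<comment> \<open>The n - 1 other entries in the row and in the column of the pivot, together with
    two powers from the inversion, give the exponent 2n of the Jacobian.\<close>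
  hence card: "2 + card J1 = 2 * n" using ij by (simp add: card_cartesian_product)
  have g1: "?g $$ (a, b) = (if a = b \<and> a \<noteq> i then 1 else 0)" if "a < n" "b < n" for a b
    using that ij by auto
  have g2: "?g $$ (n + l, b) = (if l = j then if b = i then 1 else 0 else 0)" if "l < n" "b < n" for l b
    using that ij by auto
  have g3: "?g $$ (a, n + b) = (if a = i \<and> b = j then 1 else 0)" if "a < n" "b < n" for a b
    using that ij by auto
  have g4: "?g $$ (n + l, n + b) = (if l = b then if b = j then 0 else 1 else 0)" if "l < n" "b < n" for l b
    using that ij by auto
  have L: "fin_left n ?g z $$ (a, b) = (if a = b \<and> a \<noteq> i then 1 else 0) + (if b = i then z (a, j) else 0)"
    if ab: "a < n" "b < n" for a b z
  proof -
    have "(\<Sum>l<n. z (a, l) * ?g $$ (n + l, b)) = (\<Sum>l<n. (z (a, l) * (if b = i then 1 else 0)) * (if l = j then 1 else 0))"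
      by (rule sum.cong) (use ab in \<open>simp_all add: g2 del: index_mat_swaprows_mat(1)\<close>)
    also have "\<dots> = z (a, j) * (if b = i then 1 else 0)" by (rule sum_mult_delta[OF ij(2)])
    finally show ?thesis using ab by (simp add: fin_left_def g1 del: index_mat_swaprows_mat(1))
  qed
  have R: "fin_right n ?g z $$ (a, b) = (if a = i \<and> b = j then 1 else 0) + (if b = j then 0 else z (a, b))"
    if ab: "a < n" "b < n" for a b z
  proof -
    have "(\<Sum>l<n. z (a, l) * ?g $$ (n + l, n + b)) = (\<Sum>l<n. (z (a, l) * (if b = j then 0 else 1)) * (if l = b then 1 else 0))"
      by (rule sum.cong) (use ab in \<open>simp_all add: g4 del: index_mat_swaprows_mat(1)\<close>)
    also have "\<dots> = z (a, b) * (if b = j then 0 else 1)" by (rule sum_mult_delta[OF ab(2)])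
    finally show ?thesis using ab by (simp add: fin_right_def g3 del: index_mat_swaprows_mat(1))
  qed
  have d: "fin_det n ?g z = z ?e" for z
    unfolding fin_det_def using ij
    by (subst det_replaced_column[OF fin_carrier(1) ij(1)]) (simp_all add: L)
  have T_val: "T z (a, b) = (if a = i then if b = j then inverse (z ?e) else inverse (z ?e) * z (a, b)
      else if b = j then - (inverse (z ?e) * z (a, b)) else z (a, b) - z (a, j) * z (i, b) * inverse (z ?e))"
    if "a < n" "b < n" for a b z
    using that ij unfolding T_def \<epsilon>_def \<theta>_def J1_def J2_def by auto
  have act: "fin_act n ?g z = T z" if z0: "z ?e \<noteq> 0" for z
  proof (rule fin_act_eqI)
    show "fin_det n ?g z \<noteq> 0" using z0 by (simp add: d)
    show "T z \<in> extensional ?I" unfolding I T_def by simp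
    show "fin_right n ?g z = fin_left n ?g z * Matrix.mat n n (T z)"
    proof (rule eq_matI)
      have dd: "dim_row (fin_left n ?g z * Matrix.mat n n (T z)) = n" "dim_col (fin_left n ?g z * Matrix.mat n n (T z)) = n"
        by (simp_all add: fin_left_def)
      show "dim_row (fin_right n ?g z) = dim_row (fin_left n ?g z * Matrix.mat n n (T z))"
        "dim_col (fin_right n ?g z) = dim_col (fin_left n ?g z * Matrix.mat n n (T z))"
        unfolding dd by (simp_all add: fin_right_def)
      fix a b assume "a < dim_row (fin_left n ?g z * Matrix.mat n n (T z))" "b < dim_col (fin_left n ?g z * Matrix.mat n n (T z))"
      hence ab: "a < n" "b < n" unfolding dd .
      have "(fin_left n ?g z * Matrix.mat n n (T z)) $$ (a, b)
          = (\<Sum>c<n. ((if a = c \<and> a \<noteq> i then 1 else 0) + (if c = i then z (a, j) else 0)) * T z (c, b))"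
        unfolding mult_mat_index[OF fin_carrier(1) mat_carrier ab] using ab by (intro sum.cong) (simp_all add: L)
      also have "\<dots> = (\<Sum>c<n. ((if a \<noteq> i then 1 else 0) * T z (c, b)) * (if c = a then 1 else 0))
          + (\<Sum>c<n. (z (a, j) * T z (c, b)) * (if c = i then 1 else 0))"
        unfolding sum.distrib[symmetric] by (rule sum.cong) auto
      also have "\<dots> = (if a \<noteq> i then 1 else 0) * T z (a, b) + z (a, j) * T z (i, b)"
        unfolding sum_mult_delta[OF ab(1)] sum_mult_delta[OF ij(1)] ..
      also have "\<dots> = fin_right n ?g z $$ (a, b)"
        unfolding R[OF ab] T_val[OF ab] T_val[OF ij(1) ab(2)] using z0 by (simp add: field_simps)
      finally show "fin_right n ?g z $$ (a, b) = (fin_left n ?g z * Matrix.mat n n (T z)) $$ (a, b)" ..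
    qed
  qed
  \<comment> \<open>The singular set is a box with a one-point factor, and points have measure
    0.\<close>
  have ae: "AE z in vol n. (z :: nat \<times> nat \<Rightarrow> 'p padic) ?e \<noteq> 0"
  proof (rule AE_I)
    let ?Z = "\<Pi>\<^sub>E k\<in>?I. if k = ?e then {0 :: 'p padic} else UNIV"
    have fI: "finite ?I" by (simp add: mat_idx_def)
    have "?e \<in> ?I" using ij by (simp add: mat_idx_def)
    thus "{z \<in> space (vol n). \<not> z ?e \<noteq> (0 :: 'p padic)} \<subseteq> ?Z"
      by (auto simp: space_vol PiE_iff extensional_def)
    have "emeasure (vol n) ?Z = (\<Prod>k\<in>?I. emeasure haar (if k = ?e then {0 :: 'p padic} else UNIV))"
      unfolding vol_eq_haar_PiM by (rule haar_product.emeasure_PiM[OF fI]) simp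
    also have "\<dots> = 0" using fI \<open>?e \<in> ?I\<close> by (intro prod_zero bexI[of _ ?e]) (simp_all add: emeasure_haar_singleton)
    finally show "emeasure (vol n) ?Z = 0" .
    show "?Z \<in> sets (vol n)" unfolding sets_vol mat_algebra_def by (rule sets_PiM_I_finite[OF fI]) auto
  qed
  have Tm: "fin_act n ?g \<in> PiM (insert ?e (J1 \<union> J2)) (\<lambda>_. borel) \<rightarrow>\<^sub>M PiM (insert ?e (J1 \<union> J2)) (\<lambda>_. borel)"
    using fin_act_measurable[of n ?g] unfolding mat_algebra_def I .
  show ?thesis unfolding vol_change_def
  proof (intro conjI ballI)
    show "AE z in vol n. fin_det n ?g z \<noteq> 0" using ae by (simp add: d)
    fix F :: "(nat \<times> nat \<Rightarrow> 'p padic) \<Rightarrow> ennreal" assume F: "F \<in> borel_measurable (mat_algebra n)"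
    have "(\<integral>\<^sup>+z. F (fin_act n ?g z) * ennreal (inverse (padic_norm (z ?e)) ^ (2 + card J1)) \<partial>haar_PiM (insert ?e (J1 \<union> J2)))
        = (\<integral>\<^sup>+z. F z \<partial>haar_PiM (insert ?e (J1 \<union> J2)))"
    proof (rule nn_integral_swap_map[where \<epsilon> = \<epsilon> and \<theta> = \<theta>, OF fin dis _ _ Tm])
      show "F \<in> borel_measurable (PiM (insert ?e (J1 \<union> J2)) (\<lambda>_. borel))" using F unfolding mat_algebra_def I .
      show "padic_norm (\<epsilon> k) = 1" for k by (simp add: \<epsilon>_def)
      show "fin_act n ?g z = (\<lambda>k\<in>insert ?e (J1 \<union> J2). if k = ?e then inverse (z ?e)
          else if k \<in> J1 then \<epsilon> k * inverse (z ?e) * z k else z k + \<theta> (z ?e) (restrict z J1) k)"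
        if "z ?e \<noteq> 0" for z
        using act[of z] that unfolding T_def by blast
    qed
    thus "(\<integral>\<^sup>+z. F (fin_act n ?g z) * fin_jacobian n ?g z \<partial>vol n) = (\<integral>\<^sup>+z. F z \<partial>vol n)"
      unfolding vol_eq_haar_PiM I[symmetric] card fin_jacobian_def d .
  qed
qed

lemma vol_change_GL: "g \<in> GL_padic_ints (2 * n) \<Longrightarrow> vol_change n g"
  by (rule GL_block_induct)
     (auto intro: vol_change_one vol_change_mult vol_change_swap vol_change_addrow vol_change_multrow GL_padic_ints_carrier)

section \<open>Change of variables for the finite-dimensional measures\<close>

lemma mu_fin_change:
  fixes g :: "'p::prime_card padic mat"
  assumes g: "g \<in> GL_padic_ints (2 * n)"
  shows "AE z in mu_fin s n. fin_det n g z \<noteq> 0"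
    and "F \<in> borel_measurable (mat_algebra n) \<Longrightarrow>
      (\<integral>\<^sup>+z. F (fin_act n g z) * ennreal (padic_norm (fin_det n g z) powr s) \<partial>mu_fin s n) = (\<integral>\<^sup>+z. F z \<partial>mu_fin s n)"
proof -
  let ?\<gamma> = "\<lambda>z :: nat \<times> nat \<Rightarrow> 'p padic. minor_max (graph_mat (Matrix.mat n n z))"
  let ?c = "c_const TYPE('p) n (s + 2 * real n)"
  let ?f = "\<lambda>z. ennreal (?\<gamma> z powr (- s - 2 * real n)) / ?c"
  have mu: "mu_fin s n = density (vol n) ?f"
    unfolding mu_fin_def by (simp add: gamma_mat_eq[OF mat_carrier])
  have mf: "?f \<in> borel_measurable (mat_algebra n)"
    using minor_max_measurable[of n, where 'p='p] by measurable
  have ae: "AE z in vol n. fin_det n g z \<noteq> 0"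
    and int: "\<And>F. F \<in> borel_measurable (mat_algebra n) \<Longrightarrow>
        (\<integral>\<^sup>+z. F (fin_act n g z) * fin_jacobian n g z \<partial>vol n) = (\<integral>\<^sup>+z. F z \<partial>vol n)"
    using vol_change_GL[OF g] by (auto simp: vol_change_def)
  show "AE z in mu_fin s n. fin_det n g z \<noteq> 0"
    unfolding mu AE_density[OF measurable_vol[OF mf]] using ae by eventually_elim simp
  assume F: "F \<in> borel_measurable (mat_algebra n)"
  have mFa: "(\<lambda>z. F (fin_act n g z) * ennreal (padic_norm (fin_det n g z) powr s)) \<in> borel_measurable (mat_algebra n)"
  proof -
    have "(\<lambda>z. padic_norm (fin_det n g z)) \<in> borel_measurable (mat_algebra n)"
      by (rule measurable_compose[OF fin_det_measurable padic_norm_measurable])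
    thus ?thesis by (intro borel_measurable_times_ennreal measurable_compose[OF fin_act_measurable F]) measurable
  qed
  have "(\<integral>\<^sup>+z. F (fin_act n g z) * ennreal (padic_norm (fin_det n g z) powr s) \<partial>mu_fin s n)
      = (\<integral>\<^sup>+z. ?f z * (F (fin_act n g z) * ennreal (padic_norm (fin_det n g z) powr s)) \<partial>vol n)"
    unfolding mu by (rule nn_integral_density[OF measurable_vol[OF mf] measurable_vol[OF mFa]])
  also have "\<dots> = (\<integral>\<^sup>+z. (?f (fin_act n g z) * F (fin_act n g z)) * fin_jacobian n g z \<partial>vol n)"
  proof (rule nn_integral_cong_AE)
    show "AE z in vol n. ?f z * (F (fin_act n g z) * ennreal (padic_norm (fin_det n g z) powr s))
        = (?f (fin_act n g z) * F (fin_act n g z)) * fin_jacobian n g z"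
      using ae
    proof eventually_elim
      case (elim z)
      let ?d = "padic_norm (fin_det n g z)"
      have d: "?d > 0" using elim by simp
      have nn: "?\<gamma> (fin_act n g z) \<ge> 0"
        by (rule minor_max_nonneg[OF graph_mat_carrier[OF mat_carrier]]) auto
      \<comment> \<open>Inserting \<gamma>(z) = |d| \<gamma>(w) leaves |d| to the power -s - 2n + s
        = -2n, which is the Jacobian; the other factor belongs to the density at the image
        w.\<close>
      have "?\<gamma> z powr (- s - 2 * real n) * ?d powr s
          = ?\<gamma> (fin_act n g z) powr (- s - 2 * real n) * (?d powr (- s - 2 * real n) * ?d powr s)"
        unfolding minor_max_fin_act[OF g elim] using nn by (simp add: powr_mult)
      also have "?d powr (- s - 2 * real n) * ?d powr s = ?d powr (- real (2 * n))"
        by (simp add: powr_add[symmetric])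
      also have "\<dots> = inverse ?d ^ (2 * n)"
        using d by (subst powr_minus, subst powr_realpow) (simp_all add: power_inverse)
      finally have eq: "?\<gamma> z powr (- s - 2 * real n) * ?d powr s
          = ?\<gamma> (fin_act n g z) powr (- s - 2 * real n) * inverse ?d ^ (2 * n)" .
      have "ennreal (?\<gamma> z powr (- s - 2 * real n)) * ennreal (?d powr s)
          = ennreal (?\<gamma> (fin_act n g z) powr (- s - 2 * real n)) * fin_jacobian n g z"
        unfolding fin_jacobian_def
        by (subst (1 2) ennreal_mult[symmetric]) (simp_all only: eq powr_ge_zero padic_norm_nonneg zero_le_power inverse_nonnegative_iff_nonnegative)
      thus ?case by (simp add: divide_ennreal_def mult_ac)
    qed
  qed
  also have "\<dots> = (\<integral>\<^sup>+z. ?f z * F z \<partial>vol n)"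
    by (rule int) (intro borel_measurable_times_ennreal mf F)
  also have "\<dots> = (\<integral>\<^sup>+z. F z \<partial>mu_fin s n)"
    unfolding mu by (rule nn_integral_density[OF measurable_vol[OF mf] measurable_vol[OF F], symmetric])
  finally show "(\<integral>\<^sup>+z. F (fin_act n g z) * ennreal (padic_norm (fin_det n g z) powr s) \<partial>mu_fin s n) = (\<integral>\<^sup>+z. F z \<partial>mu_fin s n)" .
qed

section \<open>Infinite matrices\<close>

fun idx_level :: "nat + nat \<Rightarrow> nat" where
  "idx_level (Inl i) = i"
| "idx_level (Inr i) = i"

definition supported_below :: "nat \<Rightarrow> 'a::comm_ring_1 block_imat \<Rightarrow> bool" where
  "supported_below N g \<longleftrightarrow> (\<forall>x y. g (x, y) \<noteq> imat_one (x, y) \<longrightarrow> idx_level x < N \<and> idx_level y < N)"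

lemma supported_belowD:
  assumes "supported_below N g" "\<not> (i < N \<and> j < N)"
  shows "g (Inl i, Inl j) = (if i = j then 1 else 0)" "g (Inr i, Inr j) = (if i = j then 1 else 0)"
    "g (Inl i, Inr j) = 0" "g (Inr i, Inl j) = 0"
proof -
  have *: "g (x, y) = imat_one (x, y)" if "\<not> (idx_level x < N \<and> idx_level y < N)" for x y
    using assms(1) that unfolding supported_below_def by blast
  show "g (Inl i, Inl j) = (if i = j then 1 else 0)" "g (Inr i, Inr j) = (if i = j then 1 else 0)"
    "g (Inl i, Inr j) = 0" "g (Inr i, Inl j) = 0"
    using *[of "Inl i" "Inl j"] *[of "Inr i" "Inr j"] *[of "Inl i" "Inr j"] *[of "Inr i" "Inl j"] assms(2)
    by (simp_all add: imat_one_def)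
qed

lemma finite_support_supported_below:
  assumes "finite {ij. g ij \<noteq> imat_one ij}"
  obtains N where "supported_below N (g :: 'a::comm_ring_1 block_imat)"
proof -
  let ?S = "{ij. g ij \<noteq> imat_one ij}"
  let ?H = "(\<lambda>(x, y). idx_level x) ` ?S \<union> (\<lambda>(x, y). idx_level y) ` ?S"
  have fin: "finite (insert 0 ?H)" using assms by simp
  have "supported_below (Suc (Max (insert 0 ?H))) g"
    unfolding supported_below_def
  proof (intro allI impI)
    fix x y assume "g (x, y) \<noteq> imat_one (x, y)"
    hence "idx_level x \<in> insert 0 ?H" "idx_level y \<in> insert 0 ?H" by force+
    thus "idx_level x < Suc (Max (insert 0 ?H)) \<and> idx_level y < Suc (Max (insert 0 ?H))"
      using Max_ge[OF fin] by (simp add: less_Suc_eq_le)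
  qed
  thus ?thesis by (rule that)
qed

text \<open>Lists the first n indices of both copies of the natural numbers, the left copy first, so
  that the corner inherits the block structure of g.\<close>

definition block_idx :: "nat \<Rightarrow> nat \<Rightarrow> nat + nat" where
  "block_idx n i = (if i < n then Inl i else Inr (i - n))"

definition corner :: "nat \<Rightarrow> 'a block_imat \<Rightarrow> 'a mat" where
  "corner n g = Matrix.mat (2 * n) (2 * n) (\<lambda>(i, j). g (block_idx n i, block_idx n j))"

lemma corner_carrier [simp]: "corner n g \<in> carrier_mat (2 * n) (2 * n)"
  by (simp add: corner_def)

lemma corner_index:
  assumes "i < n" "j < n"
  shows "corner n g $$ (i, j) = g (Inl i, Inl j)" "corner n g $$ (i, n + j) = g (Inl i, Inr j)"
    "corner n g $$ (n + i, j) = g (Inr i, Inl j)" "corner n g $$ (n + i, n + j) = g (Inr i, Inr j)"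
  using assms by (simp_all add: corner_def block_idx_def)

lemma Sum_any_eq_sum: "finite A \<Longrightarrow> (\<And>k. k \<notin> A \<Longrightarrow> f k = 0) \<Longrightarrow> Sum_any f = sum f A"
  by (rule Sum_any.expand_superset) auto

text \<open>A row of g that meets the corner vanishes outside of it, because g agrees with the
  identity from level N on; so the sum over all inner indices is already the finite one.\<close>

lemma corner_mult:
  assumes g: "supported_below N g" and h: "supported_below N h" and n: "N \<le> n"
  shows "corner n (g **\<^sub>i h) = corner n g * corner n (h :: 'a::comm_ring_1 block_imat)"
proof (rule eq_matI)
  fix i j assume "i < dim_row (corner n g * corner n h)" "j < dim_col (corner n g * corner n h)"
  hence ij: "i < 2 * n" "j < 2 * n" by (simp_all add: corner_def)
  let ?x = "block_idx n i" and ?y = "block_idx n j"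
  let ?A = "block_idx n ` {..<2 * n}"
  have inj: "inj_on (block_idx n) {..<2 * n}" by (auto simp: inj_on_def block_idx_def split: if_splits)
  have out: "g (?x, k) = 0" if "k \<notin> ?A" for k
  proof (cases k)
    case (Inl l)
    have "l \<ge> n"
    proof (rule ccontr)
      assume "\<not> l \<ge> n"
      hence "k = block_idx n l" "l < 2 * n" using Inl by (simp_all add: block_idx_def)
      thus False using that by blast
    qed
    thus ?thesis using supported_belowD[OF g, of _ l] n ij by (auto simp: Inl block_idx_def)
  next
    case (Inr l)
    have "l \<ge> n"
    proof (rule ccontr)
      assume "\<not> l \<ge> n"
      hence "k = block_idx n (n + l)" "n + l < 2 * n" using Inr by (simp_all add: block_idx_def)
      thus False using that by blast
    qed
    thus ?thesis using supported_belowD[OF g, of _ l] n ij by (auto simp: Inr block_idx_def)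
  qed
  have "corner n (g **\<^sub>i h) $$ (i, j) = Sum_any (\<lambda>k. g (?x, k) * h (k, ?y))"
    using ij by (simp add: corner_def imat_mult_def)
  also have "\<dots> = (\<Sum>k\<in>?A. g (?x, k) * h (k, ?y))"
    by (rule Sum_any_eq_sum) (simp_all add: out)
  also have "\<dots> = (\<Sum>k<2 * n. g (?x, block_idx n k) * h (block_idx n k, ?y))"
    by (simp add: sum.reindex[OF inj])
  also have "\<dots> = (\<Sum>k<2 * n. corner n g $$ (i, k) * corner n h $$ (k, j))"
    using ij by (intro sum.cong) (simp_all add: corner_def)
  also have "\<dots> = (corner n g * corner n h) $$ (i, j)"
    by (rule mult_mat_index[symmetric]) (use ij in simp_all)
  finally show "corner n (g **\<^sub>i h) $$ (i, j) = (corner n g * corner n h) $$ (i, j)" .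
qed (simp_all add: corner_def)

lemma corner_one: "corner n imat_one = 1\<^sub>m (2 * n)"
  by (rule eq_matI) (auto simp: corner_def imat_one_def block_idx_def)

text \<open>Row finiteness of A and B confines k to a finite set and then l to a finite union of
  finite sets, so that the sums may be interchanged. The columns of C are arbitrary.\<close>

lemma imat_mult_assoc:
  assumes "row_finite A" "row_finite B"
  shows "(A **\<^sub>i B) **\<^sub>i C = A **\<^sub>i (B **\<^sub>i C)"
proof (rule ext, clarify)
  fix i j
  let ?S = "{k. A (i, k) \<noteq> 0}"
  let ?T = "\<Union>k\<in>?S. {l. B (k, l) \<noteq> 0}"
  have S: "finite ?S" and T: "finite ?T" using assms by (auto simp: row_finite_def)
  have AB: "Sum_any (\<lambda>k. A (i, k) * B (k, l)) = (\<Sum>k\<in>?S. A (i, k) * B (k, l))" for l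
    by (rule Sum_any_eq_sum[OF S]) auto
  have "((A **\<^sub>i B) **\<^sub>i C) (i, j) = Sum_any (\<lambda>l. (\<Sum>k\<in>?S. A (i, k) * B (k, l)) * C (l, j))"
    by (simp add: imat_mult_def AB)
  also have "\<dots> = (\<Sum>l\<in>?T. (\<Sum>k\<in>?S. A (i, k) * B (k, l)) * C (l, j))"
  proof (rule Sum_any_eq_sum[OF T])
    fix l assume l: "l \<notin> ?T"
    have "(\<Sum>k\<in>?S. A (i, k) * B (k, l)) = 0" by (rule sum.neutral) (use l in auto)
    thus "(\<Sum>k\<in>?S. A (i, k) * B (k, l)) * C (l, j) = 0" by simp
  qed
  also have "\<dots> = (\<Sum>k\<in>?S. \<Sum>l\<in>?T. A (i, k) * (B (k, l) * C (l, j)))"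
    unfolding sum_distrib_right by (subst sum.swap) (simp add: mult.assoc)
  also have "\<dots> = (\<Sum>k\<in>?S. A (i, k) * Sum_any (\<lambda>l. B (k, l) * C (l, j)))"
  proof (rule sum.cong[OF refl])
    fix k assume k: "k \<in> ?S"
    have "Sum_any (\<lambda>l. B (k, l) * C (l, j)) = (\<Sum>l\<in>?T. B (k, l) * C (l, j))"
      by (rule Sum_any_eq_sum[OF T]) (use k in auto)
    thus "(\<Sum>l\<in>?T. A (i, k) * (B (k, l) * C (l, j))) = A (i, k) * Sum_any (\<lambda>l. B (k, l) * C (l, j))"
      by (simp add: sum_distrib_left)
  qed
  also have "\<dots> = (A **\<^sub>i (B **\<^sub>i C)) (i, j)"
    unfolding imat_mult_def by (simp, rule Sum_any_eq_sum[OF S, symmetric]) auto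
  finally show "((A **\<^sub>i B) **\<^sub>i C) (i, j) = (A **\<^sub>i (B **\<^sub>i C)) (i, j)" .
qed

lemma imat_one_mult: "imat_one **\<^sub>i (A :: 'i \<times> 'j \<Rightarrow> 'a::comm_ring_1) = A"
proof (rule ext, clarify)
  fix i j
  have "Sum_any (\<lambda>k. imat_one (i, k) * A (k, j)) = (\<Sum>k\<in>{i}. imat_one (i, k) * A (k, j))"
    by (rule Sum_any_eq_sum) (auto simp: imat_one_def)
  thus "(imat_one **\<^sub>i A) (i, j) = A (i, j)" by (simp add: imat_mult_def imat_one_def)
qed

lemma imat_mult_one: "(A :: 'i \<times> 'j \<Rightarrow> 'a::comm_ring_1) **\<^sub>i imat_one = A"
proof (rule ext, clarify)
  fix i j
  have "Sum_any (\<lambda>k. A (i, k) * imat_one (k, j)) = (\<Sum>k\<in>{j}. A (i, k) * imat_one (k, j))"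
    by (rule Sum_any_eq_sum) (auto simp: imat_one_def)
  thus "(A **\<^sub>i imat_one) (i, j) = A (i, j)" by (simp add: imat_mult_def imat_one_def)
qed

text \<open>Two-sided inverses are unique by associativity, which is available because all
  candidates are row finite.\<close>

lemma imat_inv_eqI:
  assumes "row_finite B" "A **\<^sub>i B = imat_one" "B **\<^sub>i A = imat_one" "row_finite A"
  shows "imat_inv A = B"
  unfolding imat_inv_def
proof (rule the_equality)
  show "row_finite B \<and> A **\<^sub>i B = imat_one \<and> B **\<^sub>i A = imat_one" using assms by simp
  fix B' assume B': "row_finite B' \<and> A **\<^sub>i B' = imat_one \<and> B' **\<^sub>i A = imat_one"
  have "B' = B' **\<^sub>i (A **\<^sub>i B)" by (simp add: assms imat_mult_one)
  also have "\<dots> = (B' **\<^sub>i A) **\<^sub>i B" using B' assms by (intro imat_mult_assoc[symmetric]) auto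
  also have "\<dots> = B" using B' by (simp add: imat_one_mult)
  finally show "B' = B" .
qed

text \<open>
  For \<open>n\<close> above the support of \<open>g\<close>, the matrix \<open>a + zc\<close> is block lower triangular with
  \<open>fin_left n (corner n g) z\<close> as its upper left corner and an identity matrix as its lower right one.
\<close>

lemma a_zc_entry:
  assumes g: "supported_below N g" and n: "N \<le> n"
  shows "(blk_a g ++\<^sub>i z **\<^sub>i blk_c g) (i, j) =
    (if j < n then (if i < n then g (Inl i, Inl j) else 0) + (\<Sum>l<n. z (i, l) * g (Inr l, Inl j)) else if i = j then 1 else 0)"
proof -
  have s: "Sum_any (\<lambda>l. z (i, l) * g (Inr l, Inl j)) = (\<Sum>l<n. z (i, l) * g (Inr l, Inl j))"
    by (rule Sum_any_eq_sum) (use supported_belowD(4)[OF g, of _ j] n in auto)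
  have "(\<Sum>l<n. z (i, l) * g (Inr l, Inl j)) = 0" if "j \<ge> n"
    using supported_belowD(4)[OF g, of _ j] n that by (intro sum.neutral) auto
  thus ?thesis
    using supported_belowD(1)[OF g, of i j] n
    by (auto simp: imat_add_def imat_mult_def blk_a_def blk_c_def s)
qed

lemma b_zd_entry:
  assumes g: "supported_below N g" and n: "N \<le> n" and ij: "i < n" "j < n"
  shows "(blk_b g ++\<^sub>i z **\<^sub>i blk_d g) (i, j) = fin_right n (corner n g) z $$ (i, j)"
proof -
  have s: "Sum_any (\<lambda>l. z (i, l) * g (Inr l, Inr j)) = (\<Sum>l<n. z (i, l) * g (Inr l, Inr j))"
    by (rule Sum_any_eq_sum) (use supported_belowD(2)[OF g, of _ j] n ij in auto)
  show ?thesis using ij by (simp add: imat_add_def imat_mult_def blk_b_def blk_d_def s fin_right_def corner_index)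
qed

lemma a_zc_corner:
  assumes g: "supported_below N g" and n: "N \<le> n" and ij: "i < n" "j < n"
  shows "(blk_a g ++\<^sub>i z **\<^sub>i blk_c g) (i, j) = fin_left n (corner n g) z $$ (i, j)"
  unfolding a_zc_entry[OF g n] using ij by (simp add: fin_left_def corner_index)

lemma mat_a_zc:
  assumes g: "supported_below N g" and n: "N \<le> n"
  shows "Matrix.mat n n (blk_a g) + Matrix.mat n n z * Matrix.mat n n (blk_c g) = fin_left n (corner n g) z"
proof (rule eq_matI)
  fix i j assume "i < dim_row (fin_left n (corner n g) z)" "j < dim_col (fin_left n (corner n g) z)"
  hence ij: "i < n" "j < n" by (simp_all add: fin_left_def)
  have "(Matrix.mat n n z * Matrix.mat n n (blk_c g)) $$ (i, j) = (\<Sum>l<n. z (i, l) * g (Inr l, Inl j))"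
    unfolding mult_mat_index[OF mat_carrier mat_carrier ij] using ij by (intro sum.cong) (simp_all add: blk_c_def)
  thus "(Matrix.mat n n (blk_a g) + Matrix.mat n n z * Matrix.mat n n (blk_c g)) $$ (i, j) = fin_left n (corner n g) z $$ (i, j)"
    using ij by (simp add: fin_left_def corner_index blk_a_def)
qed (simp_all add: fin_left_def)

text \<open>Expansion along the last column.\<close>

lemma fin_det_Suc:
  assumes g: "supported_below N g" and n: "N \<le> n"
  shows "fin_det (Suc n) (corner (Suc n) g) z = fin_det n (corner n (g :: 'p::prime_card padic block_imat)) z"
proof -
  let ?A = "fin_left (Suc n) (corner (Suc n) g) z"
  have A: "?A \<in> carrier_mat (Suc n) (Suc n)" by simp
  have ent: "?A $$ (i, j) = (blk_a g ++\<^sub>i z **\<^sub>i blk_c g) (i, j)" if "i < Suc n" "j < Suc n" for i j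
    using a_zc_corner[OF g _ that] n by simp
  have last: "?A $$ (i, n) = (if i = n then 1 else 0)" if "i < Suc n" for i
    using ent[OF that, of n] a_zc_entry[OF g n, of z i n] by simp
  have "mat_delete ?A n n = fin_left n (corner n g) z"
  proof (rule eq_matI)
    fix i j assume "i < dim_row (fin_left n (corner n g) z)" "j < dim_col (fin_left n (corner n g) z)"
    hence ij: "i < n" "j < n" by (simp_all add: fin_left_def)
    have "mat_delete ?A n n $$ (i, j) = ?A $$ (i, j)" using ij by (simp add: mat_delete_def fin_left_def)
    also have "\<dots> = fin_left n (corner n g) z $$ (i, j)" using ent[of i j] a_zc_corner[OF g n ij] ij by simp
    finally show "mat_delete ?A n n $$ (i, j) = fin_left n (corner n g) z $$ (i, j)" .
  qed (simp_all add: mat_delete_def fin_left_def)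
  hence cof: "cofactor ?A n n = fin_det n (corner n g) z" by (simp add: cofactor_def fin_det_def)
  have "det ?A = (\<Sum>i<Suc n. ?A $$ (i, n) * cofactor ?A i n)"
    by (rule laplace_expansion_column[OF A]) simp
  also have "\<dots> = (\<Sum>i<Suc n. if i = n then cofactor ?A n n else 0)"
    by (rule sum.cong) (auto simp: last)
  also have "\<dots> = cofactor ?A n n" by simp
  finally show ?thesis by (simp add: fin_det_def[of "Suc n"] cof)
qed

text \<open>The determinants of the corners are constant from N on, so the eventual value in the
  description is attained at every such corner.\<close>

lemma det_a_zc_eq:
  assumes g: "supported_below N g" and n: "N \<le> n"
  shows "det_a_zc g z = fin_det n (corner n (g :: 'p::prime_card padic block_imat)) z"
proof -
  have const: "fin_det m (corner m g) z = fin_det N (corner N g) z" if "N \<le> m" for m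
    using that by (induction rule: dec_induct) (simp_all add: fin_det_Suc[OF g])
  have ev: "\<forall>\<^sub>F k in sequentially. fin_det N (corner N g) z
      = det (Matrix.mat k k (blk_a g) + Matrix.mat k k z * Matrix.mat k k (blk_c g))"
    using eventually_ge_at_top[of N]
  proof eventually_elim
    case (elim k)
    show ?case unfolding mat_a_zc[OF g elim] using const[OF elim] by (simp add: fin_det_def)
  qed
  have "det_a_zc g z = fin_det N (corner N g) z"
    unfolding det_a_zc_def
  proof (rule the_equality)
    show "\<forall>\<^sub>F k in sequentially. fin_det N (corner N g) z
        = det (Matrix.mat k k (blk_a g) + Matrix.mat k k z * Matrix.mat k k (blk_c g))" by (rule ev)
    fix x assume "\<forall>\<^sub>F k in sequentially. x
      = det (Matrix.mat k k (blk_a g) + Matrix.mat k k z * Matrix.mat k k (blk_c g))"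
    hence "\<forall>\<^sub>F k in sequentially. x = fin_det N (corner N g) z" using ev by eventually_elim simp
    thus "x = fin_det N (corner N g) z" by simp
  qed
  thus ?thesis using const[OF n] by simp
qed

text \<open>In blocks of size n + \<infinity> the matrix a + zc is (L 0; R 1), with inverse (L^-1 0;
  -R L^-1 1). The upper left corner of its product with b + zd involves only L^-1 and the upper left
  corner of b + zd.\<close>

lemma act_corner:
  fixes g :: "'p::prime_card padic block_imat"
  assumes g: "supported_below N g" and n: "N \<le> n" and nz: "det_a_zc g z \<noteq> 0"
  shows "restrict (act g z) (mat_idx n) = fin_act n (corner n g) z"
proof -
  let ?M = "blk_a g ++\<^sub>i z **\<^sub>i blk_c g" and ?X = "blk_b g ++\<^sub>i z **\<^sub>i blk_d g"
  let ?L = "fin_left n (corner n g) z"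
  have L: "?L \<in> carrier_mat n n" by simp
  have d: "det ?L \<noteq> 0" using nz unfolding det_a_zc_eq[OF g n] fin_det_def .
  note adj = adj_mat[OF L]
  \<comment> \<open>The inverse of L by Cramer's rule, as in \<open>fin_act\<close>.\<close>
  define Q where "Q = inverse (det ?L) \<cdot>\<^sub>m adj_mat ?L"
  have Q: "Q \<in> carrier_mat n n" using adj(1) by (simp add: Q_def)
  have LQ: "?L * Q = 1\<^sub>m n"
    unfolding Q_def mult_smult_distrib[OF L adj(1)] adj(2) using d by (intro eq_matI) auto
  have QL: "Q * ?L = 1\<^sub>m n"
    unfolding Q_def mult_smult_assoc_mat[OF adj(1) L] adj(3) using d by (intro eq_matI) auto
  have Lent: "?M (i, j) = ?L $$ (i, j)" if "i < n" "j < n" for i j by (rule a_zc_corner[OF g n that])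
  have Mhi: "?M (i, j) = (if i = j then 1 else 0)" if "j \<ge> n" for i j
    using a_zc_entry[OF g n, of z i j] that by simp
  have prod1: "(\<Sum>k<n. ?L $$ (i, k) * Q $$ (k, j)) = (if i = j then 1 else 0)" if "i < n" "j < n" for i j
    using arg_cong[OF LQ, of "\<lambda>A. A $$ (i, j)"] that unfolding mult_mat_index[OF L Q that] by simp
  have prod2: "(\<Sum>k<n. Q $$ (i, k) * ?L $$ (k, j)) = (if i = j then 1 else 0)" if "i < n" "j < n" for i j
    using arg_cong[OF QL, of "\<lambda>A. A $$ (i, j)"] that unfolding mult_mat_index[OF Q L that] by simp
  \<comment> \<open>The block inverse (Q 0; -RQ 1), where the rows of \<open>?M\<close> from n on
    provide R.\<close>
  define B where "B = (\<lambda>(i, j). if j < n then (if i < n then Q $$ (i, j) else - (\<Sum>k<n. ?M (i, k) * Q $$ (k, j)))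
      else if i = j then 1 else 0)"
  have rfM: "row_finite ?M"
    unfolding row_finite_def
  proof
    fix i
    have "j \<in> insert i {..<n}" if "?M (i, j) \<noteq> 0" for j
      using Mhi[of j i] that by (cases "j < n") (auto simp: not_less split: if_splits)
    hence "{j. ?M (i, j) \<noteq> 0} \<subseteq> insert i {..<n}" by blast
    thus "finite {j. ?M (i, j) \<noteq> 0}" by (rule finite_subset) simp
  qed
  have rfB: "row_finite B"
    unfolding row_finite_def
  proof
    fix i
    have "{j. B (i, j) \<noteq> 0} \<subseteq> insert i {..<n}" by (auto simp: B_def split: if_splits)
    thus "finite {j. B (i, j) \<noteq> 0}" by (rule finite_subset) simp
  qed
  have split: "(\<Sum>k\<in>insert i {..<n}. f k) = (\<Sum>k<n. f k) + (if i < n then 0 else f i)" for i and f :: "nat \<Rightarrow> 'p padic"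
    by (auto simp: insert_absorb)
  have MB: "?M **\<^sub>i B = imat_one"
  proof (rule ext, clarify)
    fix i j
    have "(?M **\<^sub>i B) (i, j) = (\<Sum>k\<in>insert i {..<n}. ?M (i, k) * B (k, j))"
      unfolding imat_mult_def[of ?M] prod.case
      by (rule Sum_any_eq_sum) (use Mhi[of _ i] in \<open>auto simp: not_less\<close>)
    also have "\<dots> = (\<Sum>k<n. ?M (i, k) * B (k, j)) + (if i < n then 0 else ?M (i, i) * B (i, j))" by (rule split)
    also have "\<dots> = imat_one (i, j)"
    proof (cases "j < n")
      case j: True
      have B1: "(\<Sum>k<n. ?M (i, k) * B (k, j)) = (\<Sum>k<n. ?M (i, k) * Q $$ (k, j))"
        using j by (intro sum.cong) (simp_all add: B_def)
      show ?thesis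
      proof (cases "i < n")
        case True
        have "(\<Sum>k<n. ?M (i, k) * Q $$ (k, j)) = (\<Sum>k<n. ?L $$ (i, k) * Q $$ (k, j))"
          using True by (intro sum.cong) (simp_all add: Lent)
        thus ?thesis using True j prod1[OF True j] unfolding B1 by (simp add: imat_one_def)
      next
        case False
        thus ?thesis using j Mhi[of i i] unfolding B1 by (simp add: B_def imat_one_def)
      qed
    next
      case j: False
      have "(\<Sum>k<n. ?M (i, k) * B (k, j)) = 0" using j by (intro sum.neutral) (simp add: B_def)
      thus ?thesis using j Mhi[of i i] by (auto simp: B_def imat_one_def)
    qed
    finally show "(?M **\<^sub>i B) (i, j) = imat_one (i, j)" .
  qed
  have BM: "B **\<^sub>i ?M = imat_one"
  proof (rule ext, clarify)
    fix i j
    have "(B **\<^sub>i ?M) (i, j) = (\<Sum>k\<in>insert i {..<n}. B (i, k) * ?M (k, j))"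
      unfolding imat_mult_def[of B] prod.case
      by (rule Sum_any_eq_sum) (auto simp: B_def)
    also have "\<dots> = (\<Sum>k<n. B (i, k) * ?M (k, j)) + (if i < n then 0 else B (i, i) * ?M (i, j))" by (rule split)
    also have "\<dots> = imat_one (i, j)"
    proof (cases "j < n")
      case j: True
      have left_sum: "(\<Sum>k<n. B (i, k) * ?M (k, j)) = (\<Sum>k<n. B (i, k) * ?L $$ (k, j))"
        using j by (intro sum.cong) (simp_all add: Lent)
      show ?thesis
      proof (cases "i < n")
        case True
        have "(\<Sum>k<n. B (i, k) * ?L $$ (k, j)) = (\<Sum>k<n. Q $$ (i, k) * ?L $$ (k, j))"
          using True by (intro sum.cong) (simp_all add: B_def)
        thus ?thesis using True prod2[OF True j] unfolding left_sum by (simp add: imat_one_def)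
      next
        case False
        have "(\<Sum>k<n. B (i, k) * ?L $$ (k, j)) = (\<Sum>k<n. - (\<Sum>l<n. ?M (i, l) * Q $$ (l, k)) * ?L $$ (k, j))"
          using False by (intro sum.cong) (simp_all add: B_def)
        also have "\<dots> = - (\<Sum>l<n. ?M (i, l) * (\<Sum>k<n. Q $$ (l, k) * ?L $$ (k, j)))"
          unfolding mult_minus_left sum_negf sum_distrib_right sum_distrib_left
          by (subst sum.swap) (simp add: mult.assoc)
        also have "(\<Sum>l<n. ?M (i, l) * (\<Sum>k<n. Q $$ (l, k) * ?L $$ (k, j))) = (\<Sum>l<n. ?M (i, l) * (if l = j then 1 else 0))"
          using j by (intro sum.cong) (simp_all add: prod2)
        also have "\<dots> = ?M (i, j)" by (rule sum_mult_delta[OF j])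
        finally show ?thesis using False j unfolding left_sum by (simp add: B_def imat_one_def)
      qed
    next
      case j: False
      have "(\<Sum>k<n. B (i, k) * ?M (k, j)) = 0" using j Mhi[of j] by (intro sum.neutral) auto
      thus ?thesis using j Mhi[of j i] by (auto simp: B_def imat_one_def)
    qed
    finally show "(B **\<^sub>i ?M) (i, j) = imat_one (i, j)" .
  qed
  have inv: "imat_inv ?M = B" by (rule imat_inv_eqI[OF rfB MB BM rfM])
  have act: "act g z (i, j) = (\<Sum>k<n. Q $$ (i, k) * fin_right n (corner n g) z $$ (k, j))" if ij: "i < n" "j < n" for i j
  proof -
    have "act g z (i, j) = Sum_any (\<lambda>k. B (i, k) * ?X (k, j))" by (simp add: act_def inv imat_mult_def[of B])
    \<comment> \<open>Row i < n of \<open>B\<close> is zero from column n on, which cuts off the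
      lower rows of \<open>?X\<close>.\<close>
    also have "\<dots> = (\<Sum>k<n. B (i, k) * ?X (k, j))"
      by (rule Sum_any_eq_sum) (use ij in \<open>auto simp: B_def\<close>)
    also have "\<dots> = (\<Sum>k<n. Q $$ (i, k) * fin_right n (corner n g) z $$ (k, j))"
      using ij by (intro sum.cong) (simp_all add: B_def b_zd_entry[OF g n])
    finally show ?thesis .
  qed
  show ?thesis
  proof (rule extensionalityI[of _ "mat_idx n"])
    fix x assume "x \<in> mat_idx n"
    then obtain i j where x: "x = (i, j)" "i < n" "j < n" by (auto simp: mat_idx_def)
    have "act g z (i, j) = fin_act n (corner n g) z (i, j)"
      using x adj(1) by (simp add: act fin_act_def mat_idx_def Q_def fin_det_def sum_distrib_left mult.assoc)
    thus "restrict (act g z) (mat_idx n) x = fin_act n (corner n g) z x" using x by (simp add: mat_idx_def)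
  qed (simp_all add: fin_act_extensional)
qed

text \<open>From level N on the rows and columns of g are those of the identity, so there the two
  products with h reproduce the rows and columns of h.\<close>

lemma inverse_supported_below:
  fixes g h :: "'a::comm_ring_1 block_imat"
  assumes g: "supported_below N g" and gh: "g **\<^sub>i h = imat_one" and hg: "h **\<^sub>i g = imat_one"
  shows "supported_below N h"
  unfolding supported_below_def
proof (intro allI impI)
  have out: "g (x, y) = imat_one (x, y)" if "\<not> (idx_level x < N \<and> idx_level y < N)" for x y
    using g that unfolding supported_below_def by blast
  fix x y assume h: "h (x, y) \<noteq> imat_one (x, y)"
  show "idx_level x < N \<and> idx_level y < N"
  proof (rule ccontr)
    assume "\<not> (idx_level x < N \<and> idx_level y < N)"
    then consider "\<not> idx_level x < N" | "\<not> idx_level y < N" by blast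
    thus False
    proof cases
      case 1
      have "(g **\<^sub>i h) (x, y) = (imat_one **\<^sub>i h) (x, y)"
        using 1 by (simp add: imat_mult_def out)
      thus False using h gh by (simp add: imat_one_mult)
    next
      case 2
      have "(h **\<^sub>i g) (x, y) = (h **\<^sub>i imat_one) (x, y)"
        using 2 by (simp add: imat_mult_def out)
      thus False using h hg by (simp add: imat_mult_one)
    qed
  qed
qed

text \<open>The inverse lies in the group again, with the same support bound N; a common N lets both
  be compared in the same corners.\<close>

lemma GL_2inf_inverse:
  assumes g: "g \<in> (GL_2inf :: 'p::prime_card padic block_imat set)"
  obtains h N where "h \<in> GL_2inf" "g **\<^sub>i h = imat_one" "h **\<^sub>i g = imat_one"
    "supported_below N g" "supported_below N h"
proof -
  obtain h where h: "range h \<subseteq> padic_ints" "g **\<^sub>i h = imat_one" "h **\<^sub>i g = imat_one"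
    using g by (auto simp: GL_2inf_def)
  have "finite {ij. g ij \<noteq> imat_one ij}" using g by (simp add: GL_2inf_def)
  then obtain N where N: "supported_below N g" by (rule finite_support_supported_below)
  have hN: "supported_below N h" by (rule inverse_supported_below[OF N h(2,3)])
  have "{ij. h ij \<noteq> imat_one ij} \<subseteq> (Inl ` {..<N} \<union> Inr ` {..<N}) \<times> (Inl ` {..<N} \<union> Inr ` {..<N})"
  proof (rule subsetI)
    fix xy assume "xy \<in> {ij. h ij \<noteq> imat_one ij}"
    then obtain x y where xy: "xy = (x, y)" "h (x, y) \<noteq> imat_one (x, y)" by (cases xy) auto
    hence "idx_level x < N" "idx_level y < N" using hN unfolding supported_below_def by blast+
    thus "xy \<in> (Inl ` {..<N} \<union> Inr ` {..<N}) \<times> (Inl ` {..<N} \<union> Inr ` {..<N})"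
      unfolding xy(1) by (cases x; cases y) auto
  qed
  hence "finite {ij. h ij \<noteq> imat_one ij}" by (rule finite_subset) simp
  hence "h \<in> GL_2inf" using h g unfolding GL_2inf_def by blast
  thus ?thesis using h(2,3) N hN that by blast
qed

lemma corner_GL:
  assumes g: "g \<in> (GL_2inf :: 'p::prime_card padic block_imat set)" and h: "h \<in> GL_2inf"
    and gh: "g **\<^sub>i h = imat_one" "h **\<^sub>i g = imat_one"
    and N: "supported_below N g" "supported_below N h" and n: "N \<le> n"
  shows "corner n g \<in> GL_padic_ints (2 * n)" "corner n g * corner n h = 1\<^sub>m (2 * n)"
proof -
  show 1: "corner n g * corner n h = 1\<^sub>m (2 * n)"
    using corner_mult[OF N n] by (simp add: gh corner_one)
  have 2: "corner n h * corner n g = 1\<^sub>m (2 * n)"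
    using corner_mult[OF N(2,1) n] by (simp add: gh corner_one)
  have int: "corner n f $$ (i, j) \<in> padic_ints" if "f \<in> GL_2inf" "i < 2 * n" "j < 2 * n"
    for f :: "'p padic block_imat" and i j
    using that by (auto simp: corner_def GL_2inf_def)
  show "corner n g \<in> GL_padic_ints (2 * n)"
    by (rule GL_padic_intsI[OF corner_carrier corner_carrier 1 2 int[OF g] int[OF h]])
qed

lemma fin_left_restrict: "fin_left n g (restrict z (mat_idx n)) = fin_left n g z"
  by (rule eq_matI) (auto simp: fin_left_def mat_idx_def)

lemma fin_right_restrict: "fin_right n g (restrict z (mat_idx n)) = fin_right n g z"
  by (rule eq_matI) (auto simp: fin_right_def mat_idx_def)

lemma fin_det_restrict: "fin_det n g (restrict z (mat_idx n)) = fin_det n g z"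
  by (simp add: fin_det_def fin_left_restrict)

lemma fin_act_restrict: "fin_act n g (restrict z (mat_idx n)) = fin_act n g z"
  by (simp add: fin_act_def fin_det_restrict fin_left_restrict fin_right_restrict)

lemma fin_one:
  shows "fin_det n (1\<^sub>m (2 * n)) z = (1 :: 'a::field)" "fin_act n (1\<^sub>m (2 * n)) z = restrict z (mat_idx n)"
proof -
  have L: "fin_left n (1\<^sub>m (2 * n)) z = (1\<^sub>m n :: 'a mat)" by (rule eq_matI) (auto simp: fin_left_def)
  have R: "fin_right n (1\<^sub>m (2 * n)) z = Matrix.mat n n z"
    by (rule eq_matI) (auto simp: fin_right_def sum_mult_delta)
  show d: "fin_det n (1\<^sub>m (2 * n)) z = 1" by (simp add: fin_det_def L)
  show "fin_act n (1\<^sub>m (2 * n)) z = restrict z (mat_idx n)"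
  proof (rule fin_act_eqI)
    show "fin_right n (1\<^sub>m (2 * n)) z = fin_left n (1\<^sub>m (2 * n)) z * Matrix.mat n n (restrict z (mat_idx n))"
      unfolding L R left_mult_one_mat[OF mat_carrier] by (rule eq_matI) (auto simp: mat_idx_def)
  qed (simp_all add: d)
qed

text \<open>In every large corner the composition law applies to the corners of g and h, whose
  product is the identity. An infinite matrix is determined by its corners.\<close>

lemma act_inverse:
  assumes g: "g \<in> (GL_2inf :: 'p::prime_card padic block_imat set)" and h: "h \<in> GL_2inf"
    and gh: "g **\<^sub>i h = imat_one" "h **\<^sub>i g = imat_one"
    and N: "supported_below N g" "supported_below N h"
    and z: "z \<in> act_domain g"
  shows "act g z \<in> act_domain h" "act h (act g z) = z"
proof -
  have nz: "det_a_zc g z \<noteq> 0" using z by (simp add: act_domain_def)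
  have fin: "fin_det n (corner n h) (act g z) \<noteq> 0 \<and> fin_act n (corner n h) (act g z) = restrict z (mat_idx n)"
    if n: "N \<le> n" for n
  proof -
    note gn = corner_carrier[of n g] and hn = corner_carrier[of n h]
    have nz': "fin_det n (corner n g) z \<noteq> 0" using nz unfolding det_a_zc_eq[OF N(1) n] .
    note m = fin_act_mult[OF gn hn nz', unfolded corner_GL(2)[OF g h gh N n] fin_one]
    \<comment> \<open>By the cocycle property the two determinants have product 1, so the second
      action is defined.\<close>
    have d: "fin_det n (corner n h) (fin_act n (corner n g) z) \<noteq> 0" using m(3) by auto
    have r: "fin_act n (corner n g) z = restrict (act g z) (mat_idx n)"
      by (rule act_corner[OF N(1) n nz, symmetric])
    show ?thesis using d m(4)[OF d] unfolding r fin_det_restrict fin_act_restrict by simp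
  qed
  have nzh: "det_a_zc h (act g z) \<noteq> 0" using fin[of N] det_a_zc_eq[OF N(2), of N "act g z"] by simp
  thus "act g z \<in> act_domain h" by (simp add: act_domain_def)
  show "act h (act g z) = z"
  proof (rule ext)
    fix x :: "nat \<times> nat"
    obtain i j where x: "x = (i, j)" by (cases x)
    define n where "n = max N (Suc (max i j))"
    have n: "N \<le> n" "x \<in> mat_idx n" by (auto simp: n_def x mat_idx_def)
    have "restrict (act h (act g z)) (mat_idx n) = restrict z (mat_idx n)"
      using act_corner[OF N(2) n(1) nzh] fin[OF n(1)] by simp
    thus "act h (act g z) x = z x" using n(2) by (metis restrict_apply')
  qed
qed

section \<open>Measurability and change of variables for infinite matrices\<close>

lemma space_inf_mat_algebra [simp]: "space inf_mat_algebra = UNIV"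
  by (simp add: inf_mat_algebra_def space_PiM)

lemma restrict_measurable_inf:
  "(\<lambda>z. restrict z (mat_idx n)) \<in> inf_mat_algebra \<rightarrow>\<^sub>M (mat_algebra n :: (nat \<times> nat \<Rightarrow> 'p::prime_card padic) measure)"
  unfolding inf_mat_algebra_def mat_algebra_def by (rule measurable_restrict_subset) simp

lemma det_a_zc_measurable:
  assumes N: "supported_below N (g :: 'p::prime_card padic block_imat)"
  shows "det_a_zc g \<in> borel_measurable inf_mat_algebra"
proof -
  have "det_a_zc g = (\<lambda>z. fin_det N (corner N g) (restrict z (mat_idx N)))"
    by (intro ext) (simp add: det_a_zc_eq[OF N] fin_det_restrict)
  thus ?thesis using measurable_compose[OF restrict_measurable_inf fin_det_measurable] by simp
qed

lemma act_domain_sets: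
  assumes N: "supported_below N (g :: 'p::prime_card padic block_imat)"
  shows "act_domain g \<in> sets inf_mat_algebra"
proof -
  have "act_domain g = det_a_zc g -` (- {0}) \<inter> space inf_mat_algebra" by (auto simp: act_domain_def)
  thus ?thesis using measurable_sets[OF det_a_zc_measurable[OF N], of "- {0}"] by simp
qed

text \<open>Outside of its domain the action has junk values, which come from \<open>imat_inv\<close>.\<close>

definition act0 :: "'p::prime_card padic block_imat \<Rightarrow> (nat \<times> nat \<Rightarrow> 'p padic) \<Rightarrow> (nat \<times> nat \<Rightarrow> 'p padic)" where
  "act0 g z = (if z \<in> act_domain g then act g z else (\<lambda>_. 0))"

lemma act0_measurable:
  assumes N: "supported_below N (g :: 'p::prime_card padic block_imat)"
  shows "act0 g \<in> inf_mat_algebra \<rightarrow>\<^sub>M inf_mat_algebra"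
proof -
  have "(\<lambda>z x. act0 g z x) \<in> inf_mat_algebra \<rightarrow>\<^sub>M PiM UNIV (\<lambda>_. borel)"
  proof (rule measurable_PiM_single')
    fix x :: "nat \<times> nat"
    obtain i j where x: "x = (i, j)" by (cases x)
    \<comment> \<open>The corner has to contain the entry x and to be large enough for the action to
      commute with cutting it out.\<close>
    define n where "n = max N (Suc (max i j))"
    have n: "N \<le> n" "x \<in> mat_idx n" by (auto simp: n_def x mat_idx_def)
    have eq: "(\<lambda>z. act0 g z x) = (\<lambda>z. if z \<in> act_domain g then fin_act n (corner n g) (restrict z (mat_idx n)) x else 0)"
    proof
      fix z
      have "act g z x = fin_act n (corner n g) z x" if "z \<in> act_domain g"
      proof -
        have "restrict (act g z) (mat_idx n) x = fin_act n (corner n g) z x"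
          using that by (subst act_corner[OF N n(1)]) (simp_all add: act_domain_def)
        thus ?thesis using n(2) by simp
      qed
      thus "act0 g z x = (if z \<in> act_domain g then fin_act n (corner n g) (restrict z (mat_idx n)) x else 0)"
        by (simp add: act0_def fin_act_restrict)
    qed
    have c: "(\<lambda>w. w x) \<in> borel_measurable (mat_algebra n :: (nat \<times> nat \<Rightarrow> 'p padic) measure)"
      unfolding mat_algebra_def by (rule coord_measurable[OF n(2)])
    have "(\<lambda>z. fin_act n (corner n g) (restrict z (mat_idx n)) x) \<in> borel_measurable inf_mat_algebra"
      by (rule measurable_compose[OF measurable_compose[OF restrict_measurable_inf fin_act_measurable] c])
    thus "(\<lambda>z. act0 g z x) \<in> borel_measurable inf_mat_algebra"
      unfolding eq using act_domain_sets[OF N] by (intro measurable_If_set) simp_all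
  qed simp
  thus ?thesis by (simp add: inf_mat_algebra_def)
qed

lemma det_a_zc_AE:
  assumes mu: "is_mu_inf s (\<mu> :: (nat \<times> nat \<Rightarrow> 'p::prime_card padic) measure)"
    and g: "g \<in> GL_2inf"
  shows "AE z in \<mu>. z \<in> act_domain g"
proof -
  obtain h N where h: "h \<in> GL_2inf" "g **\<^sub>i h = imat_one" "h **\<^sub>i g = imat_one"
    "supported_below N g" "supported_below N h" by (rule GL_2inf_inverse[OF g])
  \<comment> \<open>The corner size must be positive, since the marginals of the measure are
    prescribed only for n \<ge> 1.\<close>
  let ?n = "Suc N"
  have N: "N \<le> ?n" by simp
  have sets: "sets \<mu> = sets inf_mat_algebra" and marg: "distr \<mu> (mat_algebra ?n) (\<lambda>z. restrict z (mat_idx ?n)) = mu_fin s ?n"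
    using mu by (auto simp: is_mu_inf_def)
  have R: "(\<lambda>z. restrict z (mat_idx ?n)) \<in> \<mu> \<rightarrow>\<^sub>M mat_algebra ?n"
    using restrict_measurable_inf measurable_cong_sets[OF sets refl] by blast
  have "AE w in distr \<mu> (mat_algebra ?n) (\<lambda>z. restrict z (mat_idx ?n)). fin_det ?n (corner ?n g) w \<noteq> 0"
    unfolding marg by (rule mu_fin_change(1)[OF corner_GL(1)[OF g h(1-3) h(4,5) N]])
  hence "AE z in \<mu>. fin_det ?n (corner ?n g) (restrict z (mat_idx ?n)) \<noteq> 0" by (rule AE_distrD[OF R])
  thus ?thesis by eventually_elim (simp add: act_domain_def det_a_zc_eq[OF h(4) N] fin_det_restrict)
qed

text \<open>The change of variables is read as a pushforward, so that both sides are measures and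
  can be compared on cylinder sets; a cylinder depends on one corner, where
  \<open>mu_fin_change\<close> applies.\<close>

lemma distr_act0:
  assumes mu: "is_mu_inf s (\<mu> :: (nat \<times> nat \<Rightarrow> 'p::prime_card padic) measure)"
    and g: "g \<in> GL_2inf"
  shows "distr (density \<mu> (\<lambda>z. ennreal (padic_norm (det_a_zc g z) powr s))) inf_mat_algebra (act0 g) = \<mu>"
proof -
  let ?h = "\<lambda>z. ennreal (padic_norm (det_a_zc g z) powr s)"
  let ?M = "\<lambda>_ :: nat \<times> nat. borel :: 'p padic measure"
  obtain h N where h: "h \<in> GL_2inf" "g **\<^sub>i h = imat_one" "h **\<^sub>i g = imat_one"
    "supported_below N g" "supported_below N h" by (rule GL_2inf_inverse[OF g])
  have sets: "sets \<mu> = sets inf_mat_algebra" and prob: "prob_space \<mu>" using mu by (auto simp: is_mu_inf_def)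
  have sets': "sets \<mu> = sets (PiM UNIV ?M)" using sets by (simp add: inf_mat_algebra_def)
  have mh: "?h \<in> borel_measurable \<mu>"
  proof -
    have "(\<lambda>z. padic_norm (det_a_zc g z)) \<in> borel_measurable inf_mat_algebra"
      by (rule measurable_compose[OF det_a_zc_measurable[OF h(4)] padic_norm_measurable])
    hence "?h \<in> borel_measurable inf_mat_algebra" by measurable
    thus ?thesis using measurable_cong_sets[OF sets refl] by blast
  qed
  have ma: "act0 g \<in> density \<mu> ?h \<rightarrow>\<^sub>M inf_mat_algebra"
    using act0_measurable[OF h(4)] measurable_cong_sets[of "density \<mu> ?h" inf_mat_algebra] sets by simp
  let ?\<nu> = "distr (density \<mu> ?h) inf_mat_algebra (act0 g)"
  show "?\<nu> = \<mu>"
  proof (rule measure_eqI_PiM_infinite[symmetric])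
    show "sets \<mu> = sets (PiM UNIV ?M)" by (rule sets')
    show "sets ?\<nu> = sets (PiM UNIV ?M)" by (simp add: inf_mat_algebra_def)
    show "finite_measure \<mu>" using prob by (rule prob_space.finite_measure)
    fix A :: "nat \<times> nat \<Rightarrow> 'p padic set" and J :: "(nat \<times> nat) set"
    assume J: "finite J" "J \<subseteq> UNIV" and A: "\<And>i. i \<in> J \<Longrightarrow> A i \<in> sets borel"
    let ?E = "prod_emb UNIV ?M J (PiE J A)"
    \<comment> \<open>Large enough to contain J and to commute with the action, and at least 1 for
      the marginal.\<close>
    define n where "n = Max (insert (Suc N) ((\<lambda>(i, j). Suc (max i j)) ` J))"
    have finn: "finite (insert (Suc N) ((\<lambda>(i, j). Suc (max i j)) ` J))" using J by simp
    have nN: "N \<le> n" "n \<ge> 1" using Max_ge[OF finn, of "Suc N"] by (simp_all add: n_def)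
    have Jn: "J \<subseteq> mat_idx n"
    proof
      fix x assume x: "x \<in> J"
      obtain i j where ij: "x = (i, j)" by (cases x)
      have "Suc (max i j) \<in> insert (Suc N) ((\<lambda>(i, j). Suc (max i j)) ` J)" using x ij by force
      hence "Suc (max i j) \<le> n" unfolding n_def by (rule Max_ge[OF finn])
      thus "x \<in> mat_idx n" by (simp add: ij mat_idx_def Suc_le_eq)
    qed
    let ?R = "\<lambda>z :: nat \<times> nat \<Rightarrow> 'p padic. restrict z (mat_idx n)"
    let ?S = "prod_emb (mat_idx n) ?M J (PiE J A)"
    let ?F = "indicator ?S :: _ \<Rightarrow> ennreal"
    have E: "?E \<in> sets inf_mat_algebra" unfolding inf_mat_algebra_def by (rule sets_PiM_I[OF J]) (use A in auto)
    have S: "?S \<in> sets (mat_algebra n)" unfolding mat_algebra_def by (rule sets_PiM_I[OF J(1) Jn]) (use A in auto)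
    have F: "?F \<in> borel_measurable (mat_algebra n)" using S by simp
    have ES: "z \<in> ?E \<longleftrightarrow> ?R z \<in> ?S" for z
      using Jn by (auto simp: prod_emb_iff PiE_iff)
    have marg: "distr \<mu> (mat_algebra n) ?R = mu_fin s n" using mu nN by (simp add: is_mu_inf_def)
    have R: "?R \<in> \<mu> \<rightarrow>\<^sub>M mat_algebra n"
      using restrict_measurable_inf measurable_cong_sets[OF sets refl] by blast
    let ?G = "\<lambda>w. ?F (fin_act n (corner n g) w) * ennreal (padic_norm (fin_det n (corner n g) w) powr s)"
    have G: "?G \<in> borel_measurable (mat_algebra n)"
    proof -
      have "(\<lambda>z. padic_norm (fin_det n (corner n g) z)) \<in> borel_measurable (mat_algebra n)"
        by (rule measurable_compose[OF fin_det_measurable padic_norm_measurable])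
      thus ?thesis by (intro borel_measurable_times_ennreal measurable_compose[OF fin_act_measurable F]) measurable
    qed
    have "emeasure ?\<nu> ?E = (\<integral>\<^sup>+z. indicator ?E z \<partial>?\<nu>)" using E by (subst nn_integral_indicator) simp_all
    also have "\<dots> = (\<integral>\<^sup>+z. indicator ?E (act0 g z) \<partial>density \<mu> ?h)"
      using E by (intro nn_integral_distr[OF ma]) simp
    also have "\<dots> = (\<integral>\<^sup>+z. ?h z * indicator ?E (act0 g z) \<partial>\<mu>)"
    proof (rule nn_integral_density[OF mh])
      have "act0 g \<in> \<mu> \<rightarrow>\<^sub>M inf_mat_algebra"
        using act0_measurable[OF h(4)] measurable_cong_sets[OF sets refl] by blast
      thus "(\<lambda>z. indicator ?E (act0 g z) :: ennreal) \<in> borel_measurable \<mu>"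
        by (rule measurable_compose) (use E in simp)
    qed
    also have "\<dots> = (\<integral>\<^sup>+z. ?G (?R z) \<partial>\<mu>)"
    proof (rule nn_integral_cong_AE)
      show "AE z in \<mu>. ?h z * indicator ?E (act0 g z) = ?G (?R z)"
        using det_a_zc_AE[OF mu g]
      proof eventually_elim
        case (elim z)
        hence nz: "det_a_zc g z \<noteq> 0" by (simp add: act_domain_def)
        have "indicator ?E (act0 g z) = ?F (fin_act n (corner n g) z)"
          using ES[of "act g z"] elim unfolding act_corner[OF h(4) nN(1) nz]
          by (simp add: act0_def indicator_def)
        thus ?case
          by (simp add: det_a_zc_eq[OF h(4) nN(1)] fin_act_restrict fin_det_restrict mult.commute)
      qed
    qed
    also have "\<dots> = (\<integral>\<^sup>+w. ?G w \<partial>distr \<mu> (mat_algebra n) ?R)" by (rule nn_integral_distr[OF R, symmetric]) (use G in simp)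
    also have "\<dots> = (\<integral>\<^sup>+w. ?F w \<partial>mu_fin s n)"
      unfolding marg by (rule mu_fin_change(2)[OF corner_GL(1)[OF g h(1-3) h(4,5) nN(1)] F])
    also have "\<dots> = (\<integral>\<^sup>+z. ?F (?R z) \<partial>\<mu>)"
      unfolding marg[symmetric] by (rule nn_integral_distr[OF R]) (use F in simp)
    also have "\<dots> = (\<integral>\<^sup>+z. indicator ?E z \<partial>\<mu>)"
      by (intro nn_integral_cong) (simp add: indicator_def ES)
    also have "\<dots> = emeasure \<mu> ?E" using E sets by (subst nn_integral_indicator) simp_all
    finally show "emeasure \<mu> ?E = emeasure ?\<nu> ?E" ..
  qed
qed

text \<open>The action of the inverse of g is a measurable inverse on the domain, so direct images
  are preimages and therefore measurable. The measure of an image is then found by evaluating the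
  pushforward in \<open>distr_act0\<close> at it.\<close>

lemma quasiinvariant_act:
  assumes mu: "is_mu_inf s (\<mu> :: (nat \<times> nat \<Rightarrow> 'p::prime_card padic) measure)"
    and g: "g \<in> GL_2inf"
  shows "quasiinvariant_with \<mu> (act_domain g) (act g) (\<lambda>z. padic_norm (det_a_zc g z) powr s)"
proof -
  let ?h = "\<lambda>z. padic_norm (det_a_zc g z) powr s"
  obtain h N where h: "h \<in> GL_2inf" "g **\<^sub>i h = imat_one" "h **\<^sub>i g = imat_one"
    "supported_below N g" "supported_below N h" by (rule GL_2inf_inverse[OF g])
  note gh = act_inverse[OF g h(1-3) h(4,5)] and hg = act_inverse[OF h(1) g h(3,2) h(5,4)]
  have sets: "sets \<mu> = sets inf_mat_algebra" using mu by (simp add: is_mu_inf_def)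
  have space: "space \<mu> = UNIV" using sets_eq_imp_space_eq[OF sets] by simp
  have img: "act g ` B = act0 h -` B \<inter> act_domain h" if "B \<subseteq> act_domain g" for B
  proof (rule Set.set_eqI, rule iffI)
    fix w assume "w \<in> act g ` B"
    then obtain z where "z \<in> B" "w = act g z" by blast
    thus "w \<in> act0 h -` B \<inter> act_domain h" using gh[of z] that by (auto simp: act0_def)
  next
    fix w assume w: "w \<in> act0 h -` B \<inter> act_domain h"
    hence "w \<in> act_domain h" "act0 h w \<in> B" by simp_all
    hence "act h w \<in> B" by (simp add: act0_def)
    moreover have "w = act g (act h w)" using hg(2)[of w] w by simp
    ultimately show "w \<in> act g ` B" by blast
  qed
  \<comment> \<open>The image of the domain is the domain of the inverse, hence of full measure for
    the same reason.\<close>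
  have full: "act g ` act_domain g = act_domain h"
    unfolding img[OF subset_refl] using hg(1) by (auto simp: act0_def)
  have inj: "inj_on (act g) (act_domain g)" by (rule inj_on_inverseI[where g = "act h"]) (rule gh(2))
  have img_sets: "act g ` B \<in> sets \<mu>" if "B \<in> sets \<mu>" "B \<subseteq> act_domain g" for B
  proof -
    have "act0 h -` B \<inter> space inf_mat_algebra \<in> sets inf_mat_algebra"
      using that(1) sets by (intro measurable_sets[OF act0_measurable[OF h(5)]]) simp
    thus ?thesis unfolding img[OF that(2)] sets using act_domain_sets[OF h(5)] by auto
  qed
  have mh: "?h \<in> borel_measurable \<mu>"
  proof -
    have "(\<lambda>z. padic_norm (det_a_zc g z)) \<in> borel_measurable inf_mat_algebra"
      by (rule measurable_compose[OF det_a_zc_measurable[OF h(4)] padic_norm_measurable])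
    hence "?h \<in> borel_measurable inf_mat_algebra" by measurable
    thus ?thesis using measurable_cong_sets[OF sets refl] by blast
  qed
  have ma: "act0 g \<in> \<mu> \<rightarrow>\<^sub>M inf_mat_algebra"
    using act0_measurable[OF h(4)] measurable_cong_sets[OF sets refl] by blast
  have ma': "act0 g \<in> density \<mu> (\<lambda>z. ennreal (?h z)) \<rightarrow>\<^sub>M inf_mat_algebra"
    using ma measurable_cong_sets[of "density \<mu> (\<lambda>z. ennreal (?h z))" \<mu>] by simp
  have em: "emeasure \<mu> (act g ` B) = (\<integral>\<^sup>+z\<in>B. ennreal (?h z) \<partial>\<mu>)" if B: "B \<in> sets \<mu>" "B \<subseteq> act_domain g" for B
  proof -
    let ?C = "act g ` B"
    have C: "?C \<in> sets inf_mat_algebra" using img_sets[OF B] sets by simp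
    have "emeasure \<mu> ?C = emeasure (distr (density \<mu> (\<lambda>z. ennreal (?h z))) inf_mat_algebra (act0 g)) ?C"
      by (simp only: distr_act0[OF mu g])
    also have "\<dots> = (\<integral>\<^sup>+z. indicator ?C z \<partial>distr (density \<mu> (\<lambda>z. ennreal (?h z))) inf_mat_algebra (act0 g))"
      using C by (subst nn_integral_indicator) simp_all
    also have "\<dots> = (\<integral>\<^sup>+z. indicator ?C (act0 g z) \<partial>density \<mu> (\<lambda>z. ennreal (?h z)))"
      using C by (intro nn_integral_distr[OF ma']) simp
    also have "\<dots> = (\<integral>\<^sup>+z. ennreal (?h z) * indicator ?C (act0 g z) \<partial>\<mu>)"
    proof (rule nn_integral_density)
      show "(\<lambda>z. ennreal (?h z)) \<in> borel_measurable \<mu>" using mh by measurable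
      show "(\<lambda>z. indicator ?C (act0 g z) :: ennreal) \<in> borel_measurable \<mu>"
        by (rule measurable_compose[OF ma]) (use C in simp)
    qed
    also have "\<dots> = (\<integral>\<^sup>+z\<in>B. ennreal (?h z) \<partial>\<mu>)"
    proof (rule nn_integral_cong_AE)
      show "AE z in \<mu>. ennreal (?h z) * indicator ?C (act0 g z) = ennreal (?h z) * indicator B z"
        using det_a_zc_AE[OF mu g]
      proof eventually_elim
        case (elim z)
        \<comment> \<open>Injectivity excludes points of the domain outside of B with image in
          \<open>?C\<close>; the points outside of the domain form a null set.\<close>
        have "act g z \<in> ?C \<longleftrightarrow> z \<in> B" using inj_on_image_mem_iff[OF inj elim B(2)] .
        thus ?case using elim by (simp add: act0_def indicator_def)
      qed
    qed
    finally show ?thesis .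
  qed
  have null: "act g ` B \<in> null_sets \<mu> \<longleftrightarrow> B \<in> null_sets \<mu>" if B: "B \<in> sets \<mu>" "B \<subseteq> act_domain g" for B
  proof -
    have m: "(\<lambda>z. ennreal (?h z) * indicator B z) \<in> borel_measurable \<mu>" using mh B(1) by measurable
    \<comment> \<open>The density is positive on the domain, as the determinant is nonzero there, so
      null sets are preserved in both directions.\<close>
    have pos: "ennreal (?h z) * indicator B z = 0 \<longleftrightarrow> z \<notin> B" for z
      using B(2) by (auto simp: act_domain_def indicator_def)
    have "act g ` B \<in> null_sets \<mu> \<longleftrightarrow> (\<integral>\<^sup>+z\<in>B. ennreal (?h z) \<partial>\<mu>) = 0"
      using img_sets[OF B] em[OF B] by (simp add: null_sets_def)
    also have "\<dots> \<longleftrightarrow> (AE z in \<mu>. z \<notin> B)" unfolding nn_integral_0_iff_AE[OF m] pos ..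
    also have "\<dots> \<longleftrightarrow> B \<in> null_sets \<mu>" using AE_iff_null_sets[OF B(1)] by simp
    finally show ?thesis .
  qed
  show ?thesis
    unfolding quasiinvariant_with_def full
  proof (intro conjI ballI impI)
    show "act_domain g \<in> sets \<mu>" "act_domain h \<in> sets \<mu>"
      using act_domain_sets[OF h(4)] act_domain_sets[OF h(5)] sets by simp_all
    show "AE z in \<mu>. z \<in> act_domain g" "AE z in \<mu>. z \<in> act_domain h"
      by (rule det_a_zc_AE[OF mu g], rule det_a_zc_AE[OF mu h(1)])
    show "inj_on (act g) (act_domain g)" by (rule inj)
    have "act0 g \<in> restrict_space \<mu> (act_domain g) \<rightarrow>\<^sub>M \<mu>"
      using measurable_restrict_space1[OF ma] measurable_cong_sets[OF refl sets] by blast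
    thus "act g \<in> restrict_space \<mu> (act_domain g) \<rightarrow>\<^sub>M \<mu>"
      by (rule measurable_cong[THEN iffD1, rotated]) (simp add: space_restrict_space act0_def)
    show "?h \<in> borel_measurable (restrict_space \<mu> (act_domain g))" by (rule measurable_restrict_space1[OF mh])
  qed (use img_sets em null in auto)
qed

text \<open>Serves the case s = 0: off the domain the determinant is 0 and
  \<open>0 powr 0 = 0\<close>, so the density equals 1 on the domain only.\<close>

lemma quasiinvariant_with_cong:
  assumes "quasiinvariant_with M D \<phi> h" "\<And>z. z \<in> D \<Longrightarrow> h z = h' z"
  shows "quasiinvariant_with M D \<phi> h'"
proof -
  have m: "h' \<in> borel_measurable (restrict_space M D)"
    by (rule measurable_cong[THEN iffD1, of _ h]) (use assms in \<open>auto simp: space_restrict_space quasiinvariant_with_def\<close>)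
  have i: "(\<integral>\<^sup>+z\<in>B. ennreal (h' z) \<partial>M) = (\<integral>\<^sup>+z\<in>B. ennreal (h z) \<partial>M)" if "B \<subseteq> D" for B
    by (intro nn_integral_cong) (use that assms(2) in \<open>auto simp: indicator_def\<close>)
  show ?thesis using assms m i unfolding quasiinvariant_with_def by simp
qed

text \<open>If \<open>c = 0\<close>, then the upper left block of \<open>g\<^sup>-\<^sup>1\<close> is a left inverse of \<open>a\<close>.\<close>

lemma padic_norm_det_a:
  assumes g: "g \<in> (P_subgroup :: 'p::prime_card padic block_imat set)"
  shows "padic_norm (det_a_zc g z) = 1"
proof -
  have gG: "g \<in> GL_2inf" and c0: "\<And>i j. g (Inr i, Inl j) = 0" using g by (auto simp: P_subgroup_def blk_c_def)
  obtain h N where h: "h \<in> GL_2inf" "g **\<^sub>i h = imat_one" "h **\<^sub>i g = imat_one"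
    "supported_below N g" "supported_below N h" by (rule GL_2inf_inverse[OF gG])
  let ?a = "fin_left N (corner N g) z"
  let ?b = "Matrix.mat N N (\<lambda>(i, j). h (Inl i, Inl j))"
  have a: "?a $$ (i, j) = g (Inl i, Inl j)" if "i < N" "j < N" for i j
    using that by (simp add: fin_left_def corner_index c0)
  have ac: "?a \<in> carrier_mat N N" and bc: "?b \<in> carrier_mat N N" by simp_all
  have hg: "corner N h * corner N g = 1\<^sub>m (2 * N)"
    using corner_mult[OF h(5,4)] by (simp add: h(3) corner_one)
  have "?b * ?a = 1\<^sub>m N"
  proof (rule eq_matI)
    fix i j assume "i < dim_row (1\<^sub>m N :: 'p padic mat)" "j < dim_col (1\<^sub>m N :: 'p padic mat)"
    hence ij: "i < N" "j < N" by simp_all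
    have "(if i = j then 1 else 0) = (corner N h * corner N g) $$ (i, j)" using ij by (simp add: hg)
    also have "\<dots> = (\<Sum>k<2 * N. corner N h $$ (i, k) * corner N g $$ (k, j))"
      by (rule mult_mat_index[OF corner_carrier corner_carrier]) (use ij in simp_all)
    \<comment> \<open>The indices of the second block drop out because c = 0.\<close>
    also have "\<dots> = (\<Sum>k<N. h (Inl i, Inl k) * g (Inl k, Inl j))"
    proof (rule sum.mono_neutral_cong_right)
      show "\<forall>k\<in>{..<2 * N} - {..<N}. corner N h $$ (i, k) * corner N g $$ (k, j) = 0"
        using ij by (auto simp: corner_def block_idx_def c0)
    qed (use ij in \<open>auto simp: corner_index\<close>)
    also have "\<dots> = (?b * ?a) $$ (i, j)"
      unfolding mult_mat_index[OF bc ac ij] using ij by (intro sum.cong) (simp_all add: a)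
    finally show "(?b * ?a) $$ (i, j) = 1\<^sub>m N $$ (i, j)" using ij by simp
  qed (simp_all add: fin_left_def)
  hence "det ?b * det ?a = 1" using det_mult[OF bc ac] by simp
  hence m: "padic_norm (det ?b) * padic_norm (det ?a) = 1" by (simp flip: padic_norm_mult)
  have int: "f xy \<in> padic_ints" if "f \<in> GL_2inf" for f :: "'p padic block_imat" and xy
    using that by (auto simp: GL_2inf_def)
  have "padic_norm (det ?a) \<le> (\<Prod>j<N. 1)"
    by (rule padic_norm_det_le[OF ac]) (use int[OF gG] in \<open>simp add: a padic_ints_def\<close>)
  moreover have "padic_norm (det ?b) \<le> (\<Prod>j<N. 1)"
    by (rule padic_norm_det_le[OF bc]) (use int[OF h(1)] in \<open>simp add: padic_ints_def\<close>)
  ultimately have le: "padic_norm (det ?a) \<le> 1" "padic_norm (det ?b) \<le> 1" by simp_all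
  \<comment> \<open>Two norms that are at most 1 and have product 1 both equal 1.\<close>
  have "padic_norm (det ?b) * padic_norm (det ?a) \<le> 1 * padic_norm (det ?a)"
    using le by (intro mult_right_mono) simp_all
  hence "padic_norm (det ?a) = 1" using m le by simp
  thus ?thesis using det_a_zc_eq[OF h(4) order_refl, of z] by (simp add: fin_det_def)
qed

theorem proposition1p4:
  fixes s :: real and \<mu> :: "(nat \<times> nat \<Rightarrow> 'p::prime_card padic) measure"
  assumes "s > -1"
    and "is_mu_inf s \<mu>"
  shows "(\<forall>g\<in>GL_2inf. quasiinvariant_with \<mu> (act_domain g) (act g)
            (\<lambda>z. padic_norm (det_a_zc g z) powr s)) \<and>
         (s = 0 \<longrightarrow> (\<forall>g\<in>GL_2inf. invariant_under \<mu> (act_domain g) (act g))) \<and>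
         (\<forall>g\<in>P_subgroup. invariant_under \<mu> (act_domain g) (act g))"
proof (intro conjI ballI impI)
  fix g :: "'p padic block_imat"
  show "quasiinvariant_with \<mu> (act_domain g) (act g) (\<lambda>z. padic_norm (det_a_zc g z) powr s)"
    if "g \<in> GL_2inf" using assms(2) that by (rule quasiinvariant_act)
  show "invariant_under \<mu> (act_domain g) (act g)" if "s = 0" "g \<in> GL_2inf"
    unfolding invariant_under_def
    by (rule quasiinvariant_with_cong[OF quasiinvariant_act[OF assms(2) that(2)]])
       (simp add: that(1) act_domain_def)
  show "invariant_under \<mu> (act_domain g) (act g)" if g: "g \<in> P_subgroup"
  proof -
    have "g \<in> GL_2inf" using g by (simp add: P_subgroup_def)
    thus ?thesis unfolding invariant_under_def
      by (rule quasiinvariant_with_cong[OF quasiinvariant_act[OF assms(2)]])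
         (simp add: padic_norm_det_a[OF g])
  qed
qed

end
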